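(* Consider any rhombus in the quiver $Q$, with vertices $z,x_1,y,x_2$ where $z,y$ are opposite, and arrows $b_1:z\to x_1$, $b_2:z\to x_2$, $d:x_1\to y$, $c:x_2\to y$. There is a unique (up to isomorphism) $A$-module $R$ with top isomorphic to $S_y$, socle isomorphic to $S_z$ and $\mathrm{rad}(R)/\mathrm{soc}(R)\cong S_{x_1}\oplus S_{x_2}$. Explicitly, $R=b_1dA=b_2cA$.
   Context: Tiling. Let $\mathrm p:\mathbb R^3\to\mathbb R^2$ be linear with $\mathrm p(\mathbf e_1)=(-\frac{\sqrt3}{2},-\frac12)$, $\mathrm p(\mathbf e_2)=(\frac{\sqrt3}{2},-\frac12)$, $\mathrm p(\mathbf e_3)=(0,1)$. For $\{i,j,k\}=\{1,2,3\}$ let $R_k=\{\lambda \mathrm p(\mathbf e_i)+\mu \mathrm p(\mathbf e_j):0\le\lambda,\mu\le1\}$. Let $\mathbf M=\begin{pmatrix}0&1&0\\0&0&1\\1&-1&-1\end{pmatrix}$ with columns $\mathbf c_1,\mathbf c_2,\mathbf c_3$. A pair $(z,k)$, $z\in\mathbb Z^3$, represents the rhombus $\mathrm p(z)+R_k$. Put $\mathcal P_0=\{(0,1),(0,2),(0,3)\}$ and $\mathcal P_{i+1}=\bigcup_{(z,k)\in\mathcal P_i}\mathcal R(z,k)$, where $\mathcal R(z,1)=\{(\mathbf Mz,3),(\mathbf Mz+\mathbf c_2,1),(\mathbf Mz+\mathbf c_3,2)\}$, $\mathcal R(z,2)=\{(\mathbf Mz,1)\}$, $\mathcal R(z,3)=\{(\mathbf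 Mz,2)\}$. Then $\mathcal P_i\subset\mathcal P_{i+1}$ and $\bigcup_i\mathcal P_i$ is a tiling of the plane by rhombi (the Rauzy tiling). Algebra $A$. Let $Q$ be the quiver whose vertices are the vertices of the Rauzy tiling, with each edge replaced by two arrows in opposite directions; $\bar b$ is the arrow opposite to $b$. Let $k$ be a field. Paths are composed left to right and modules are right modules. The Rauzy algebra is $A=kQ/I$, where $I$ is generated by: (1) a path of length two along two distinct edges that are not both edges of one rhombus is zero; (2) the two paths of length two joining opposite vertices of a rhombus (along its boundary) are equal; (3) for each vertex $z$, $s_1(z)D_1(z)=s_2(z)D_2(z)=s_3(z)D_3(z)$, where $D_a(z)=L_a^+(z)-L_a^-(z)$, $L_a^{\pm}(z)=g\bar g$ if there is an arrow $g:z\to z\pm\mathrm p(\mathbf e_a)$ and $L_a^\pm(z)=0$ otherwise, and $s_a(z)\in\{\pm1\}$ is a fixed choice of signs such that whenever $z,x$ are joined by an edge parallel to $\mathrm p(\mathbf e_a)$, $s_a(x)=-s_a(z)$ and $s_c(x)=s_c(z)$ for $c\ne a$ (such signs are determined by their values at one vertex). $e_z$ is the trivial path at $z$, and $S_z$ is the one-dimensional simple module at $z$ ($S_ze_z=S_z$, all arrows act as zero). *)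

theory Defs
  imports "HOL-Analysis.Analysis" "HOL-Library.Poly_Mapping"
    "HOL-Algebra.Module" "HOL-Algebra.QuotRing" "HOL-Algebra.Generated_Groups"
begin

section \<open>The Rauzy tiling\<close>

type_synonym point = "real^2"
type_synonym tile = "(int^3) \<times> 3"

definition proj :: "real^3 \<Rightarrow> point" where
  "proj v = v$1 *\<^sub>R vector [- sqrt 3 / 2, - 1 / 2]
          + v$2 *\<^sub>R vector [sqrt 3 / 2, - 1 / 2]
          + v$3 *\<^sub>R vector [0, 1]"

definition projZ :: "int^3 \<Rightarrow> point" where
  "projZ z = proj (\<chi> i. of_int (z$i))"

definition pe :: "3 \<Rightarrow> point" where
  "pe a = proj (axis a 1)"

definition rauzy_mat :: "int^3^3" where
  "rauzy_mat = vector [vector [0, 1, 0], vector [0, 0, 1], vector [1, -1, -1]]"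

definition rauzy_subst :: "tile \<Rightarrow> tile set" where
  "rauzy_subst t = (case t of (z, k) \<Rightarrow>
     if k = 1 then {(rauzy_mat *v z, 3), (rauzy_mat *v z + column 2 rauzy_mat, 1),
                    (rauzy_mat *v z + column 3 rauzy_mat, 2)}
     else if k = 2 then {(rauzy_mat *v z, 1)}
     else {(rauzy_mat *v z, 2)})"

primrec rauzy_patch :: "nat \<Rightarrow> tile set" where
  "rauzy_patch 0 = {(0, 1), (0, 2), (0, 3)}"
| "rauzy_patch (Suc i) = (\<Union>t\<in>rauzy_patch i. rauzy_subst t)"

definition rauzy_tiling :: "tile set" where
  "rauzy_tiling = (\<Union>i. rauzy_patch i)"

text \<open>The pair \<open>(z, k)\<close> stands for the rhombus \<open>projZ z + R\<^sub>k\<close>, spanned by \<open>pe i\<close> and \<open>pe j\<close> with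
  \<open>{i, j, k} = {1, 2, 3} = UNIV\<close>. A side is represented by the set of its two end points; as
  \<open>i\<close> and \<open>j\<close> may be exchanged, the set below consists of all four sides.\<close>

definition sides :: "tile \<Rightarrow> point set set" where
  "sides t = (case t of (z, k) \<Rightarrow>
     {{projZ z + \<mu> *\<^sub>R pe j, projZ z + pe i + \<mu> *\<^sub>R pe j} | i j \<mu>.
        {i, j, k} = UNIV \<and> \<mu> \<in> {0, 1}})"

definition edges :: "point set set" where
  "edges = (\<Union>t\<in>rauzy_tiling. sides t)"

definition vertices :: "point set" where
  "vertices = \<Union> edges"

text \<open>\<open>z, x, y, x'\<close> are the vertices of a rhombus of the tiling in cyclic order. The four sides of
  a rhombus are distinct, so the equation forces the four points to be distinct, with \<open>z\<close>
  opposite to \<open>y\<close>.\<close>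

definition rhombus :: "point \<Rightarrow> point \<Rightarrow> point \<Rightarrow> point \<Rightarrow> bool" where
  "rhombus z x y x' \<longleftrightarrow> (\<exists>t\<in>rauzy_tiling. sides t = {{z, x}, {x, y}, {y, x'}, {x', z}})"

section \<open>The path algebra\<close>

text \<open>The quiver has exactly one arrow \<open>x \<rightarrow> y\<close> for every edge \<open>{x, y}\<close>, so a path is the
  nonempty list of the vertices it visits: \<open>[z]\<close> is the trivial path at \<open>z\<close> and \<open>[x, y]\<close> the arrow
  from \<open>x\<close> to \<open>y\<close>.\<close>

definition arrow :: "point \<Rightarrow> point \<Rightarrow> bool" where
  "arrow x y \<longleftrightarrow> {x, y} \<in> edges"

definition paths :: "point list set" where
  "paths = {u. u \<noteq> [] \<and> set u \<subseteq> vertices \<and> successively arrow u}"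

type_synonym 'k comb = "point list \<Rightarrow>\<^sub>0 'k"

definition path_mult :: "'k::field comb \<Rightarrow> 'k comb \<Rightarrow> 'k comb" where
  "path_mult f g = (\<Sum>u\<in>Poly_Mapping.keys f. \<Sum>v\<in>Poly_Mapping.keys g.
     if last u = hd v
     then Poly_Mapping.single (u @ tl v) (Poly_Mapping.lookup f u * Poly_Mapping.lookup g v)
     else 0)"

text \<open>The quiver is infinite, so its path algebra has no unit and the field \<^term>\<open>one\<close> of the
  record is meaningless here and in the quotient. In particular the library's \<open>ring\<close>, \<open>ideal\<close> and
  \<open>module\<close> locales, which demand a unit, do not apply.\<close>

definition path_algebra :: "'k::field comb ring" where
  "path_algebra = \<lparr>carrier = {f. Poly_Mapping.keys f \<subseteq> paths}, mult = path_mult,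
     one = undefined, zero = 0, add = (+)\<rparr>"

text \<open>Ideals are automatically closed under scalars \<open>\<lambda>\<close> from the field, because
  \<open>\<lambda> f = (\<Sum>z. \<lambda> e\<^sub>z) f\<close> with \<open>z\<close> ranging over the finitely many starting vertices in \<open>f\<close>.\<close>

definition two_sided_ideal :: "'a set \<Rightarrow> ('a, 'b) ring_scheme \<Rightarrow> bool" where
  "two_sided_ideal I R \<longleftrightarrow> additive_subgroup I R \<and>
     (\<forall>a\<in>I. \<forall>x\<in>carrier R. x \<otimes>\<^bsub>R\<^esub> a \<in> I \<and> a \<otimes>\<^bsub>R\<^esub> x \<in> I)"

definition ideal_generated :: "('a, 'b) ring_scheme \<Rightarrow> 'a set \<Rightarrow> 'a set" where
  "ideal_generated R S = \<Inter>{I. two_sided_ideal I R \<and> S \<subseteq> I}"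

section \<open>The Rauzy algebra\<close>

definition pth :: "point list \<Rightarrow> 'k::field comb" where
  "pth u = Poly_Mapping.single u 1"

definition scale :: "'k::field \<Rightarrow> 'k comb \<Rightarrow> 'k comb" where
  "scale c = Poly_Mapping.map ((*) c)"

definition loop :: "point \<Rightarrow> point \<Rightarrow> 'k::field comb" where
  "loop z x = (if arrow z x then pth [z, x, z] else 0)"

definition D :: "3 \<Rightarrow> point \<Rightarrow> 'k::field comb" where
  "D a z = loop z (z + pe a) - loop z (z - pe a)"

definition sign_choice :: "(3 \<Rightarrow> point \<Rightarrow> int) \<Rightarrow> bool" where
  "sign_choice s \<longleftrightarrow>
     (\<forall>a. \<forall>z\<in>vertices. s a z \<in> {1, -1}) \<and>
     (\<forall>a z x. {z, x} \<in> edges \<and> (\<exists>r. x - z = r *\<^sub>R pe a) \<longrightarrow>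
        s a x = - s a z \<and> (\<forall>c. c \<noteq> a \<longrightarrow> s c x = s c z))"

definition rauzy_relations :: "(3 \<Rightarrow> point \<Rightarrow> int) \<Rightarrow> 'k::field comb set" where
  "rauzy_relations s =
     {pth [x, y, w] | x y w. {x, y} \<in> edges \<and> {y, w} \<in> edges \<and> {x, y} \<noteq> {y, w} \<and>
        \<not> (\<exists>t\<in>rauzy_tiling. {x, y} \<in> sides t \<and> {y, w} \<in> sides t)}
   \<union> {pth [z, x, y] - pth [z, x', y] | z x y x'. rhombus z x y x'}
   \<union> {scale (of_int (s a z)) (D a z) - scale (of_int (s b z)) (D b z) | a b z. z \<in> vertices}"

definition rauzy_ideal :: "(3 \<Rightarrow> point \<Rightarrow> int) \<Rightarrow> 'k::field comb set" where
  "rauzy_ideal s = ideal_generated path_algebra (rauzy_relations s)"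

definition rauzy_algebra :: "(3 \<Rightarrow> point \<Rightarrow> int) \<Rightarrow> 'k::field comb set ring" where
  "rauzy_algebra s = path_algebra Quot rauzy_ideal s"

definition arrow_class :: "(3 \<Rightarrow> point \<Rightarrow> int) \<Rightarrow> point \<Rightarrow> point \<Rightarrow> 'k::field comb set" where
  "arrow_class s x y = rauzy_ideal s +>\<^bsub>path_algebra\<^esub> pth [x, y]"

section \<open>Right modules\<close>

text \<open>Modules are records of type \<^typ>\<open>('a, 'm) module\<close>, whose fields \<^term>\<open>mult\<close> and
  \<^term>\<open>one\<close> are ignored; \<open>a \<odot>\<^bsub>M\<^esub> m\<close> is the right action \<open>m \<cdot> a\<close>. Instead of a unit law (the algebra
  has no unit) we require \<open>M A = M\<close>. For the Rauzy algebra every \<open>m\<close> is then a finite sum of elements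
  \<open>m e\<^sub>z\<close>, and the action of a scalar \<open>\<lambda>\<close> is \<open>m \<mapsto> (\<Sum>z. m (\<lambda> e\<^sub>z))\<close>; so submodules are subspaces
  and homomorphisms are linear without further mention of scalars.\<close>

definition right_module :: "('a, 'c) ring_scheme \<Rightarrow> ('a, 'm) module \<Rightarrow> bool" where
  "right_module A M \<longleftrightarrow> abelian_group M \<and>
     (\<forall>a\<in>carrier A. \<forall>m\<in>carrier M. a \<odot>\<^bsub>M\<^esub> m \<in> carrier M) \<and>
     (\<forall>a\<in>carrier A. \<forall>m\<in>carrier M. \<forall>n\<in>carrier M.
        a \<odot>\<^bsub>M\<^esub> (m \<oplus>\<^bsub>M\<^esub> n) = a \<odot>\<^bsub>M\<^esub> m \<oplus>\<^bsub>M\<^esub> a \<odot>\<^bsub>M\<^esub> n) \<and>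
     (\<forall>a\<in>carrier A. \<forall>b\<in>carrier A. \<forall>m\<in>carrier M.
        (a \<oplus>\<^bsub>A\<^esub> b) \<odot>\<^bsub>M\<^esub> m = a \<odot>\<^bsub>M\<^esub> m \<oplus>\<^bsub>M\<^esub> b \<odot>\<^bsub>M\<^esub> m) \<and>
     (\<forall>a\<in>carrier A. \<forall>b\<in>carrier A. \<forall>m\<in>carrier M.
        (a \<otimes>\<^bsub>A\<^esub> b) \<odot>\<^bsub>M\<^esub> m = b \<odot>\<^bsub>M\<^esub> (a \<odot>\<^bsub>M\<^esub> m)) \<and>
     generate (add_monoid M) {a \<odot>\<^bsub>M\<^esub> m | a m. a \<in> carrier A \<and> m \<in> carrier M} = carrier M"

definition module_iso ::
    "('a, 'c) ring_scheme \<Rightarrow> ('a, 'm) module \<Rightarrow> ('a, 'n) module \<Rightarrow> bool" where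
  "module_iso A M N \<longleftrightarrow> (\<exists>h. bij_betw h (carrier M) (carrier N) \<and>
     (\<forall>m\<in>carrier M. \<forall>n\<in>carrier M. h (m \<oplus>\<^bsub>M\<^esub> n) = h m \<oplus>\<^bsub>N\<^esub> h n) \<and>
     (\<forall>a\<in>carrier A. \<forall>m\<in>carrier M. h (a \<odot>\<^bsub>M\<^esub> m) = a \<odot>\<^bsub>N\<^esub> h m))"

definition restrict_module :: "('a, 'm) module \<Rightarrow> 'm set \<Rightarrow> ('a, 'm) module" where
  "restrict_module M N = M\<lparr>carrier := N\<rparr>"

definition quotient_module :: "('a, 'm) module \<Rightarrow> 'm set \<Rightarrow> ('a, 'm set) module" where
  "quotient_module M N = \<lparr>carrier = a_rcosets\<^bsub>M\<^esub> N, mult = undefined, one = undefined,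
     zero = N, add = set_add M, smult = (\<lambda>a X. \<Union>m\<in>X. N +>\<^bsub>M\<^esub> (a \<odot>\<^bsub>M\<^esub> m))\<rparr>"

definition direct_sum :: "('a, 'm) module \<Rightarrow> ('a, 'n) module \<Rightarrow> ('a, 'm \<times> 'n) module" where
  "direct_sum M N = \<lparr>carrier = carrier M \<times> carrier N, mult = undefined, one = undefined,
     zero = (\<zero>\<^bsub>M\<^esub>, \<zero>\<^bsub>N\<^esub>),
     add = (\<lambda>u v. (fst u \<oplus>\<^bsub>M\<^esub> fst v, snd u \<oplus>\<^bsub>N\<^esub> snd v)),
     smult = (\<lambda>a u. (a \<odot>\<^bsub>M\<^esub> fst u, a \<odot>\<^bsub>N\<^esub> snd u))\<rparr>"

definition maximal_submodule :: "('a, 'c) ring_scheme \<Rightarrow> ('a, 'm) module \<Rightarrow> 'm set \<Rightarrow> bool" where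
  "maximal_submodule A M N \<longleftrightarrow> submodule N A M \<and> N \<noteq> carrier M \<and>
     (\<forall>L. submodule L A M \<and> N \<subseteq> L \<longrightarrow> L = N \<or> L = carrier M)"

definition simple_submodule :: "('a, 'c) ring_scheme \<Rightarrow> ('a, 'm) module \<Rightarrow> 'm set \<Rightarrow> bool" where
  "simple_submodule A M N \<longleftrightarrow> submodule N A M \<and> N \<noteq> {\<zero>\<^bsub>M\<^esub>} \<and>
     (\<forall>L. submodule L A M \<and> L \<subseteq> N \<longrightarrow> L = {\<zero>\<^bsub>M\<^esub>} \<or> L = N)"

definition rad :: "('a, 'c) ring_scheme \<Rightarrow> ('a, 'm) module \<Rightarrow> 'm set" where
  "rad A M = carrier M \<inter> \<Inter>{N. maximal_submodule A M N}"

text \<open>The socle is the sum of all simple submodules.\<close>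

definition soc :: "('a, 'c) ring_scheme \<Rightarrow> ('a, 'm) module \<Rightarrow> 'm set" where
  "soc A M = generate (add_monoid M) (\<Union>{N. simple_submodule A M N})"

definition right_ideal_module :: "('a, 'c) ring_scheme \<Rightarrow> 'a \<Rightarrow> ('a, 'a) module" where
  "right_ideal_module A a = \<lparr>carrier = {a \<otimes>\<^bsub>A\<^esub> b | b. b \<in> carrier A},
     mult = undefined, one = undefined, zero = \<zero>\<^bsub>A\<^esub>, add = add A, smult = (\<lambda>b m. m \<otimes>\<^bsub>A\<^esub> b)\<rparr>"

text \<open>The module \<open>S\<^sub>z\<close>: an element of the algebra acts through the coefficient of the trivial path
  at \<open>z\<close>, which is the same for all representatives, since the relations only involve paths of
  length two.\<close>

definition trivial_coeff :: "point \<Rightarrow> 'k::field comb set \<Rightarrow> 'k" where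
  "trivial_coeff z X = (THE c. \<forall>f\<in>X. Poly_Mapping.lookup f [z] = c)"

definition simple_at :: "point \<Rightarrow> ('k::field comb set, 'k) module" where
  "simple_at z = \<lparr>carrier = UNIV, mult = undefined, one = undefined, zero = 0, add = (+),
     smult = (\<lambda>X c. c * trivial_coeff z X)\<rparr>"

text \<open>The right module \<open>M\<close> has top \<open>S\<^sub>y\<close>, socle \<open>S\<^sub>z\<close> and \<open>rad M / soc M \<cong> S\<^sub>x \<oplus> S\<^sub>x\<^sub>'\<close>; the inclusion
  of the socle in the radical is implicit in writing the latter quotient.\<close>

definition rhombus_module ::
    "'k::field comb set ring \<Rightarrow> point \<Rightarrow> point \<Rightarrow> point \<Rightarrow> point \<Rightarrow> ('k comb set, 'm) module \<Rightarrow> bool"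
  where
  "rhombus_module A z x y x' M \<longleftrightarrow> right_module A M \<and>
     module_iso A (quotient_module M (rad A M)) (simple_at y) \<and>
     module_iso A (restrict_module M (soc A M)) (simple_at z) \<and>
     soc A M \<subseteq> rad A M \<and>
     module_iso A (quotient_module (restrict_module M (rad A M)) (soc A M))
       (direct_sum (simple_at x) (simple_at x'))"

end

theory Submission
  imports Defs
begin

text \<open>
  Let \<open>0 < \<lambda> < 1\<close> be the real root of \<open>\<lambda>\<^sup>3 + \<lambda>\<^sup>2 + \<lambda> = 1\<close>. Measured by a left eigenvector of the
  substitution matrix for the eigenvalue \<open>\<lambda>\<close>, the height of lattice points shows that the tiles are
  exactly the lattice squares inside a strip: the substitution preserves the strip, and conversely
  passing to parents contracts a quadratic form on the strip, so that every square has an ancestor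
  in a finite list. Thus arrows are unit steps inside the strip, whose width is the height of the
  diagonal of the unit cube, so that it contains no unit cube. By this, and by the star relations,
  every path that starts with \<open>z x y\<close> and leaves the rhombus, or goes on beyond \<open>z x y x z\<close>, is
  zero in the algebra. The closed path \<open>z x y x z\<close> itself is not: an explicit linear functional
  on closed paths of length four annihilates the ideal and takes the value \<open>\<plusminus> 1\<close> there.

  Both the right ideal generated by \<open>z x y\<close> and an arbitrary module of the given shape therefore
  have a generator \<open>n = n e\<^sub>y\<close> that is killed by all paths except those from \<open>y\<close> to \<open>z\<close> along the
  rhombus and their initial segments, which do not kill it. Such a module has the basis
  \<open>n, n [y, x], n [y, x'], n [y, x, z]\<close>, on which the action is determined.
\<close>

section \<open>The tiling as a strip of the lattice\<close>

text \<open>Telling zero paths from nonzero ones is the crux. Straight and rhombus relations only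
  kill a path or reroute it across a square, and they never kill a walk that stays on one rhombus:
  \<open>z x y x y\<close> vanishes through the star relation at \<open>y\<close>, which can be
  chosen such that all its other loops leave the rhombus. Conversely, no rerouting shows that
  \<open>z x y x z\<close> is nonzero, because a star relation equates sums of paths; hence a
  functional, which certifies it by linear algebra. Its values come from solving the star relations
  for the closed paths at a single vertex \<open>z\<close>. All relations have length two, so in a
  closed path of length four they can stand at three places only, and reversing the path exchanges
  the first with the last. Points of the plane are lifted to the lattice throughout, where a turn is
  a pair of signed unit vectors and membership in the strip is an inequality between heights; this
  is possible because the projection is injective on the strip.\<close>

text \<open>The weights \<open>18393, 15437, 10000\<close> are \<open>10\<^sup>4\<close> times those in \<open>ht\<close> below, rounded, and select the
  parent of a tile. Rounding is harmless: whatever branch is taken, it inverts a substitution step.\<close>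

fun ancestor_check :: "nat \<Rightarrow> int \<Rightarrow> int \<Rightarrow> int \<Rightarrow> int \<Rightarrow> bool" where
  "ancestor_check 0 k a b c \<longleftrightarrow> a = 0 \<and> b = 0 \<and> c = 0"
| "ancestor_check (Suc n) k a b c \<longleftrightarrow>
     (if a = 0 \<and> b = 0 \<and> c = 0 then True
      else if k = 3 then ancestor_check n 1 (a + b + c) a b
      else if k = 2 then
        (if 18393 * a + 15437 * b + 10000 * c < 5430 then ancestor_check n 3 (a + b + c) a b
         else ancestor_check n 1 (a + b + c) a (b - 1))
      else
        (if 18393 * a + 15437 * b + 10000 * c < 8390 then ancestor_check n 2 (a + b + c) a b
         else ancestor_check n 1 (a + b + c) (a - 1) b))"

text \<open>The ranges contain every tile of the strip with \<open>quad < 9\<close>. The margins of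
  3 absorb the rounding of heights, which therefore cannot separate a tile just below the top of its
  strip from the unit vector of direction \<open>k\<close>, whose height is exactly
  \<open>weight k\<close>; that vector is excluded by hand.\<close>

definition small_check :: bool where
  "small_check \<longleftrightarrow> (\<forall>b\<in>set [-3..3]. \<forall>c\<in>set [-4..4]. \<forall>a\<in>set [-5..5].
     let i = 18393 * a + 15437 * b + 10000 * c in
     if i < -3 \<or> 18396 < i then True
     else (if i \<le> 10003 \<and> \<not> (a = 0 \<and> b = 0 \<and> c = 1) then ancestor_check 10 3 a b c else True) \<and>
       (if i \<le> 15440 \<and> \<not> (a = 0 \<and> b = 1 \<and> c = 0) then ancestor_check 10 2 a b c else True) \<and>
       (if \<not> (a = 1 \<and> b = 0 \<and> c = 0) then ancestor_check 10 1 a b c else True))"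

lemma small_check: small_check
  by code_simp

definition mk :: "int \<Rightarrow> int \<Rightarrow> int \<Rightarrow> int^3" where
  "mk a b c = vector [a, b, c]"

lemma mk_nth [simp]: "mk a b c $ 1 = a" "mk a b c $ 2 = b" "mk a b c $ 3 = c"
  by (simp_all add: mk_def)

lemma vec3_eq_iff: "(u :: 'a^3) = v \<longleftrightarrow> u$1 = v$1 \<and> u$2 = v$2 \<and> u$3 = v$3"
  by (simp add: vec_eq_iff forall_3)

lemma mk_cases: obtains a b c where "z = mk a b c"
proof
  show "z = mk (z$1) (z$2) (z$3)" by (simp add: vec3_eq_iff)
qed

lemma type3_distinct [simp]: "(1::3) \<noteq> 2" "(2::3) \<noteq> 1" "(1::3) \<noteq> 3" "(3::3) \<noteq> 1" "(2::3) \<noteq> 3" "(3::3) \<noteq> 2"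
  by simp_all

section \<open>The eigenvalue, the height function and the invariance of the strip\<close>

lemma ex_lam: "\<exists>l::real. 54368/100000 < l \<and> l < 54369/100000 \<and> l^3 = 1 - l - l^2"
proof -
  let ?f = "\<lambda>l::real. l^3 + l^2 + l - 1"
  have "\<exists>l\<ge>54368/100000. l \<le> 54369/100000 \<and> ?f l = 0"
    by (rule IVT') (auto intro!: continuous_intros simp: power2_eq_square power3_eq_cube)
  then obtain l where l: "l \<ge> 54368/100000" "l \<le> 54369/100000" "?f l = 0" by blast
  have "?f (54368/100000) \<noteq> 0" "?f (54369/100000) \<noteq> 0"
    by (simp_all add: power2_eq_square power3_eq_cube)
  then have "l \<noteq> 54368/100000" "l \<noteq> 54369/100000"
    using l(3) by blast+
  then show ?thesis using l by (intro exI[of _ l]) auto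
qed

text \<open>The reciprocal of the tribonacci constant. All later numerical estimates rest on this
  enclosure.\<close>

definition lam :: real where
  "lam = (SOME l. 54368/100000 < l \<and> l < 54369/100000 \<and> l^3 = 1 - l - l^2)"

lemma lam: "54368/100000 < lam" "lam < 54369/100000" "lam^3 = 1 - lam - lam^2"
  using someI_ex[OF ex_lam] unfolding lam_def by blast+

lemma lam_sq: "29558/100000 < lam^2" "lam^2 < 29560/100000"
proof -
  have "(54368/100000)^2 < lam^2" "lam^2 < (54369/100000)^2"
    using lam by (intro power_strict_mono; simp)+
  then show "29558/100000 < lam^2" "lam^2 < 29560/100000"
    by (simp_all add: power2_eq_square)
qed

definition weight :: "3 \<Rightarrow> real" where
  "weight k = (if k = 1 then 1 + lam + lam^2 else if k = 2 then 1 + lam else 1)"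

lemma weight_simps [simp]: "weight 1 = 1 + lam + lam^2" "weight 2 = 1 + lam" "weight 3 = 1"
  by (simp_all add: weight_def)

text \<open>The weights form a left eigenvector of the substitution matrix for the eigenvalue \<open>lam\<close>.\<close>

definition ht :: "int^3 \<Rightarrow> real" where
  "ht z = (\<Sum>i\<in>UNIV. weight i * of_int (z$i))"

lemma ht_eq: "ht z = (1 + lam + lam^2) * of_int (z$1) + (1 + lam) * of_int (z$2) + of_int (z$3)"
  by (simp add: ht_def sum_3)

lemma ht_add: "ht (u + v) = ht u + ht v"
  and ht_diff: "ht (u - v) = ht u - ht v"
  and ht_minus: "ht (- u) = - ht u"
  and ht_0: "ht 0 = 0"
  by (simp_all add: ht_eq algebra_simps)

text \<open>The corner opposite to \<open>z\<close> is higher by the other two weights, so the bound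
  \<open>weight k\<close> says that the whole tile lies below the sum of all three weights.\<close>

definition tile_strip :: "tile set" where
  "tile_strip = {(z, k). 0 \<le> ht z \<and> ht z < weight k}"

lemma rauzy_mat_mult: "rauzy_mat *v z = mk (z$2) (z$3) (z$1 - z$2 - z$3)"
  by (simp add: vec3_eq_iff rauzy_mat_def matrix_vector_mult_def sum_3)

lemma rauzy_mat_columns: "column 2 rauzy_mat = mk 1 0 (-1)" "column 3 rauzy_mat = mk 0 1 (-1)"
  by (simp_all add: vec3_eq_iff rauzy_mat_def column_def)

lemma ht_rauzy_mat: "ht (rauzy_mat *v z) = lam * ht z"
proof -
  have "lam * (lam * lam) = 1 - lam - lam * lam"
    using lam(3) by (simp add: power2_eq_square power3_eq_cube)
  then have *: "lam * (lam * (lam * x)) = (1 - lam - lam * lam) * x" for x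
    by (metis mult.assoc)
  show ?thesis
    by (simp add: ht_eq rauzy_mat_mult algebra_simps power2_eq_square *)
qed

text \<open>Scaling by \<open>lam\<close> and the shifts of the substitution cut the intervals
  \<open>[0, weight k)\<close> into the images of one another: type 1 consists of
  \<open>[0, lam + lam^2)\<close>, coming from type 2, and a rest coming from type 1; type 2 of
  \<open>[0, lam)\<close>, coming from type 3, and a rest coming from type 1; type 3 comes from type
  1 as a whole. The same cuts select the parent in \<open>strip_parent\<close>.\<close>

lemma rauzy_subst_strip: "t \<in> tile_strip \<Longrightarrow> rauzy_subst t \<subseteq> tile_strip"
proof -
  assume t: "t \<in> tile_strip"
  obtain z k where tz: "t = (z, k)" by force
  have l3: "lam * (lam * lam) = 1 - lam - lam * lam"
    using lam(3) by (simp add: power2_eq_square power3_eq_cube)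
  have h: "0 \<le> ht z" "ht z < weight k" using t by (auto simp: tile_strip_def tz)
  have h0: "0 \<le> lam * ht z" using h lam by simp
  have "lam * ht z < lam * weight k" using h lam by simp
  moreover have "lam * weight 1 = 1" "lam * weight 2 = lam + lam * lam" "lam * weight 3 = lam"
    using l3 by (simp_all add: algebra_simps power2_eq_square)
  ultimately have h1: "k = 1 \<Longrightarrow> lam * ht z < 1" "k = 2 \<Longrightarrow> lam * ht z < lam + lam * lam"
    "k = 3 \<Longrightarrow> lam * ht z < lam"
    by auto
  have c: "ht (mk 1 0 (-1)) = lam + lam * lam" "ht (mk 0 1 (-1)) = lam"
    by (simp_all add: ht_eq power2_eq_square)
  have l2: "0 \<le> lam * lam" by simp
  consider "k = 1" | "k = 2" | "k = 3" using exhaust_3 by blast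
  then show ?thesis
  proof cases
    case 1
    then show ?thesis using h0 h1(1) lam(1) l2
      by (simp add: rauzy_subst_def tz tile_strip_def ht_add ht_rauzy_mat rauzy_mat_columns c
          power2_eq_square)
  next
    case 2
    then show ?thesis using h0 h1(2) lam(1,2) l2
      by (simp add: rauzy_subst_def tz tile_strip_def ht_rauzy_mat power2_eq_square)
  next
    case 3
    then have "lam * ht z < 1 + lam" using h1(3) by simp
    with 3 show ?thesis using h0
      by (simp add: rauzy_subst_def tz tile_strip_def ht_rauzy_mat power2_eq_square)
  qed
qed

lemma rauzy_patch_strip: "rauzy_patch i \<subseteq> tile_strip"
proof (induction i)
  case 0
  then show ?case using lam lam_sq by (auto simp: tile_strip_def ht_0)
next
  case (Suc i)
  then show ?case using rauzy_subst_strip by fastforce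
qed

lemma rauzy_tiling_subst: "t \<in> rauzy_tiling \<Longrightarrow> t' \<in> rauzy_subst t \<Longrightarrow> t' \<in> rauzy_tiling"
  unfolding rauzy_tiling_def by (metis UN_iff UNIV_I rauzy_patch.simps(2))

lemma rauzy_tiling_0: "(0, k) \<in> rauzy_tiling"
proof -
  have "(0, k) \<in> rauzy_patch 0" using exhaust_3[of k] by auto
  then show ?thesis unfolding rauzy_tiling_def by blast
qed

text \<open>The inverse of \<open>rauzy_mat\<close> sends \<open>(a, b, c)\<close> to
  \<open>(a + b + c, a, b)\<close>; the last two cases undo the shift by a column first.\<close>

lemma rauzy_tiling_parent:
  "(mk (a + b + c) a b, 1) \<in> rauzy_tiling \<Longrightarrow> (mk a b c, 3) \<in> rauzy_tiling"
  "(mk (a + b + c) a b, 2) \<in> rauzy_tiling \<Longrightarrow> (mk a b c, 1) \<in> rauzy_tiling"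
  "(mk (a + b + c) a b, 3) \<in> rauzy_tiling \<Longrightarrow> (mk a b c, 2) \<in> rauzy_tiling"
  "(mk (a + b + c) (a - 1) b, 1) \<in> rauzy_tiling \<Longrightarrow> (mk a b c, 1) \<in> rauzy_tiling"
  "(mk (a + b + c) a (b - 1), 1) \<in> rauzy_tiling \<Longrightarrow> (mk a b c, 2) \<in> rauzy_tiling"
  by (erule rauzy_tiling_subst;
      simp add: rauzy_subst_def rauzy_mat_mult rauzy_mat_columns vec3_eq_iff)+

lemma ancestor_check:
  "ancestor_check n k a b c \<Longrightarrow> k \<in> {1, 2, 3} \<Longrightarrow> (mk a b c, of_int k) \<in> rauzy_tiling"
proof (induction n arbitrary: k a b c)
  case 0
  then have "mk a b c = 0" by (simp add: vec3_eq_iff)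
  then show ?case by (simp add: rauzy_tiling_0)
next
  case (Suc n)
  show ?case
  proof (cases "a = 0 \<and> b = 0 \<and> c = 0")
    case True
    then have "mk a b c = 0" by (simp add: vec3_eq_iff)
    then show ?thesis by (simp add: rauzy_tiling_0)
  next
    case False
    have IH: "ancestor_check n 1 a b c \<Longrightarrow> (mk a b c, 1) \<in> rauzy_tiling"
      "ancestor_check n 2 a b c \<Longrightarrow> (mk a b c, 2) \<in> rauzy_tiling"
      "ancestor_check n 3 a b c \<Longrightarrow> (mk a b c, 3) \<in> rauzy_tiling" for a b c
      using Suc.IH[of 1 a b c] Suc.IH[of 2 a b c] Suc.IH[of 3 a b c] by simp_all
    consider "k = 1" | "k = 2" | "k = 3" using Suc.prems by auto
    then show ?thesis
    proof cases
      case 1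
      show ?thesis
      proof (cases "18393 * a + 15437 * b + 10000 * c < 8390")
        case True
        then have "ancestor_check n 2 (a + b + c) a b" using Suc.prems(1) False 1 by simp
        then show ?thesis using rauzy_tiling_parent(2)[OF IH(2)] 1 by simp
      next
        case False': False
        then have "ancestor_check n 1 (a + b + c) (a - 1) b" using Suc.prems(1) False 1 by simp
        then show ?thesis using rauzy_tiling_parent(4)[OF IH(1)] 1 by simp
      qed
    next
      case 2
      show ?thesis
      proof (cases "18393 * a + 15437 * b + 10000 * c < 5430")
        case True
        then have "ancestor_check n 3 (a + b + c) a b" using Suc.prems(1) False 2 by simp
        then show ?thesis using rauzy_tiling_parent(3)[OF IH(3)] 2 by simp
      next
        case False': False
        then have "ancestor_check n 1 (a + b + c) a (b - 1)" using Suc.prems(1) False 2 by simp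
        then show ?thesis using rauzy_tiling_parent(5)[OF IH(1)] 2 by simp
      qed
    next
      case 3
      then have "ancestor_check n 1 (a + b + c) a b" using Suc.prems(1) False by simp
      then show ?thesis using rauzy_tiling_parent(1)[OF IH(1)] 3 by simp
    qed
  qed
qed

text \<open>On the plane of height zero, with coordinates \<open>z$2, z$3\<close>, the inverse of the substitution matrix
  acts by \<open>(x, y) \<mapsto> (- (lam + lam\<^sup>2) x - lam y, x)\<close>, with complex eigenvalues of modulus \<open>\<surd>lam\<close>.
  This is the quadratic form that it scales by \<open>lam\<close>.\<close>

definition quad :: "real \<Rightarrow> real \<Rightarrow> real" where
  "quad x y = x^2 + (lam + lam^2) * x * y + lam * y^2"

text \<open>Complete the square in one variable at a time. With \<open>t = lam + lam^2\<close> the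
  exact constants are \<open>lam - t^2 / 4\<close>, about 0.3676, and
  \<open>1 - t^2 / (4 * lam)\<close>, about 0.6761.\<close>

lemma quad_lower: "36 / 100 * y^2 \<le> quad x y" "67 / 100 * x^2 \<le> quad x y"
proof -
  define t where "t = lam + lam^2"
  have t: "0 < t" "t < 8393/10000" using lam lam_sq unfolding t_def by simp_all
  have t2: "t^2 \<le> 7045 / 10000"
  proof -
    have "t^2 \<le> (8393/10000)^2" using t by (intro power_mono) auto
    then show ?thesis by (simp add: power2_eq_square)
  qed
  have "quad x y - 36/100 * y^2 = (x + t / 2 * y)^2 + (lam - 36/100 - t^2 / 4) * y^2"
    unfolding quad_def t_def[symmetric] by (simp add: power2_eq_square algebra_simps)
  also have "\<dots> \<ge> 0" using t2 lam by (intro add_nonneg_nonneg mult_nonneg_nonneg) auto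
  finally show "36 / 100 * y^2 \<le> quad x y" by simp
  have "lam * quad x y - lam * (67/100) * x^2 = (lam * y + t / 2 * x)^2 + (lam * (33 / 100) - t^2 / 4) * x^2"
    unfolding quad_def t_def[symmetric] by (simp add: power2_eq_square algebra_simps)
  also have "\<dots> \<ge> 0" using t2 lam by (intro add_nonneg_nonneg mult_nonneg_nonneg) auto
  finally have "lam * (67 / 100 * x^2) \<le> lam * quad x y" by simp
  then show "67 / 100 * x^2 \<le> quad x y" using lam by simp
qed

lemma quad_nonneg: "0 \<le> quad x y"
  using quad_lower(2)[of x y] zero_le_power2[of x] by linarith

text \<open>A positive form satisfies
  \<open>q (v + w) \<le> (1 + r) * q v + (1 + 1 / r) * q w\<close>. Here \<open>r = 1 / 3\<close>,
  small enough that \<open>4 / 3 * lam < 3 / 4\<close>.\<close>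

lemma quad_add: "quad (x + x') (y + y') \<le> 4 / 3 * quad x y + 4 * quad x' y'"
proof -
  have "4 / 3 * quad x y + 4 * quad x' y' - quad (x + x') (y + y')
      = 1 / 3 * quad (x - 3 * x') (y - 3 * y')"
    unfolding quad_def by (simp add: power2_eq_square field_simps)
  then show ?thesis using quad_nonneg[of "x - 3 * x'" "y - 3 * y'"] by linarith
qed

lemma quad_contract: "quad (- (lam + lam^2) * x - lam * y) x = lam * quad x y"
  unfolding quad_def by (simp add: power2_eq_square algebra_simps)

text \<open>In a parent, \<open>e\<close> is \<open>lam\<close> times the height, possibly minus 1,
  and \<open>q\<close> is 1 if the column \<open>(0, 1, -1)\<close> has been subtracted and 0
  otherwise. Passing to the parent is thus a bounded perturbation of the linear contraction.\<close>

lemma quad_step: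
  assumes "quad e (- q) \<le> 55 / 100"
  shows "quad (e - (lam + lam^2) * x - lam * y) (x - q) \<le> 3 / 4 * quad x y + 22 / 10"
proof -
  have "quad (e - (lam + lam^2) * x - lam * y) (x - q)
      = quad ((- (lam + lam^2) * x - lam * y) + e) (x + - q)" by (simp add: algebra_simps)
  also have "\<dots> \<le> 4 / 3 * (lam * quad x y) + 4 * quad e (- q)"
    using quad_add quad_contract by metis
  also have "\<dots> \<le> 4 / 3 * (9 / 16 * quad x y) + 4 * (55 / 100)"
    using assms lam quad_nonneg[of x y] by (intro add_mono mult_left_mono mult_right_mono) auto
  finally show ?thesis by simp
qed

lemma quad_perturbation_0: "- 6 / 10 \<le> e \<Longrightarrow> e \<le> 6 / 10 \<Longrightarrow> quad e 0 \<le> 55 / 100"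
proof -
  assume "- 6 / 10 \<le> e" "e \<le> 6 / 10"
  then have "e^2 \<le> (6/10)^2" by (intro abs_le_square_iff[THEN iffD1]) auto
  then show ?thesis by (simp add: quad_def power2_eq_square)
qed

text \<open>As a function of \<open>e\<close> the value is a convex parabola equal to
  \<open>lam\<close> at both ends of the interval, and 55/100 is just above
  \<open>lam\<close>.\<close>

lemma quad_perturbation_1:
  assumes "0 \<le> e" "e \<le> lam + lam^2" shows "quad e (- 1) \<le> 55 / 100"
proof -
  have "quad e (- 1) = lam - e * (lam + lam^2 - e)"
    by (simp add: quad_def power2_eq_square algebra_simps)
  also have "\<dots> \<le> lam" using assms by simp
  finally show ?thesis using lam by simp
qed

text \<open>The height alone decides the branch, by the cuts described at
  \<open>rauzy_subst_strip\<close>. The last two coordinates of the parent are \<open>a\<close> and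
  \<open>b\<close> up to a shift, and the height expresses \<open>a\<close> by \<open>b\<close> and
  \<open>c\<close>, which brings the claim into the form of \<open>quad_step\<close>.\<close>

lemma strip_parent:
  assumes "(mk a b c, k) \<in> tile_strip"
  shows "\<exists>a' b' c' k'. (mk a' b' c', k') \<in> tile_strip \<and>
    ((mk a' b' c', k') \<in> rauzy_tiling \<longrightarrow> (mk a b c, k) \<in> rauzy_tiling) \<and>
    quad (of_int b') (of_int c') \<le> 3 / 4 * quad (of_int b) (of_int c) + 22 / 10"
proof -
  define h where "h = ht (mk a b c)"
  have l3: "lam * (lam * lam) = 1 - lam - lam * lam"
    using lam(3) by (simp add: power2_eq_square power3_eq_cube)
  then have l3': "lam * (lam * (lam * x)) = (1 - lam - lam * lam) * x" for x
    by (metis mult.assoc)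
  have h: "0 \<le> h" "h < weight k" using assms by (auto simp: tile_strip_def h_def)
  \<comment> \<open>The definition of the height, multiplied by \<open>lam\<close>: the coefficient
    \<open>lam * weight 1\<close> of \<open>a\<close> is 1.\<close>
  have a: "of_int a = lam * h - (lam + lam^2) * of_int b - lam * of_int c"
    unfolding h_def ht_eq by (simp add: power2_eq_square algebra_simps l3 l3')
  have hh: "lam * ht (mk (a + b + c) a b) = h" 
    unfolding h_def ht_eq by (simp add: power2_eq_square algebra_simps l3 l3')
  have shift: "ht (mk (a + b + c) (a - 1) b) = ht (mk (a + b + c) a b) - (1 + lam)"
    "ht (mk (a + b + c) a (b - 1)) = ht (mk (a + b + c) a b) - 1"
    by (simp_all add: ht_eq algebra_simps)
  have l0: "0 < lam" using lam by simp
  have ge: "0 \<le> ht (mk (a + b + c) a b) - x" if "lam * x \<le> h" for x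
    using that l0 unfolding hh[symmetric] by simp
  have le: "ht (mk (a + b + c) a b) < x" if "h < lam * x" for x
    using that l0 unfolding hh[symmetric] by simp
  have w: "lam * weight 1 = 1" "lam * weight 2 = lam + lam^2" "lam * weight 3 = lam"
    using l3 by (simp_all add: algebra_simps power2_eq_square)
  have lh: "0 \<le> lam * h" using h l0 by simp
  consider "k = 3" | "k = 1" "h < lam + lam^2" | "k = 1" "lam + lam^2 \<le> h"
    | "k = 2" "h < lam" | "k = 2" "lam \<le> h"
    using exhaust_3[of k] by linarith
  then show ?thesis
  proof cases
    case 1
    have "lam * h \<le> lam * 1" using h 1 l0 by (intro mult_left_mono) auto
    then have "quad (lam * h) 0 \<le> 55 / 100"
      using quad_perturbation_0[of "lam * h"] lam lh by linarith
    then have "quad (lam * h) (- 0) \<le> 55 / 100" by simp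
    from quad_step[OF this, of "of_int b" "of_int c"]
    have q: "quad (of_int a) (of_int b) \<le> 3 / 4 * quad (of_int b) (of_int c) + 22 / 10"
      by (simp add: a)
    have "(mk (a + b + c) a b, 1) \<in> tile_strip"
      using ge[of 0] le[of "weight 1"] h 1 w by (simp add: tile_strip_def)
    then show ?thesis using q rauzy_tiling_parent(1)[of a b c] 1 by blast
  next
    case 2
    have "lam * h \<le> lam * 1" using 2 l0 lam lam_sq by (intro mult_left_mono) auto
    then have "quad (lam * h) 0 \<le> 55 / 100"
      using quad_perturbation_0[of "lam * h"] lam lh by linarith
    then have "quad (lam * h) (- 0) \<le> 55 / 100" by simp
    from quad_step[OF this, of "of_int b" "of_int c"]
    have q: "quad (of_int a) (of_int b) \<le> 3 / 4 * quad (of_int b) (of_int c) + 22 / 10"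
      by (simp add: a)
    have "(mk (a + b + c) a b, 2) \<in> tile_strip"
      using ge[of 0] le[of "weight 2"] h 2 w by (simp add: tile_strip_def)
    then show ?thesis using q rauzy_tiling_parent(2)[of a b c] 2 by blast
  next
    case 3
    have "lam * h < 1" using h 3 l0 w(1) by (metis mult_strict_left_mono)
    \<comment> \<open>8392/10000 is a lower bound of \<open>lam + lam^2\<close>, good enough to keep
      \<open>lam * h - 1\<close> above -6/10.\<close>
    moreover have "lam * (8392 / 10000) \<le> lam * h"
      using 3 l0 lam lam_sq by (intro mult_left_mono) auto
    ultimately have "quad (lam * h - 1) 0 \<le> 55 / 100"
      using quad_perturbation_0[of "lam * h - 1"] lam by linarith
    then have "quad (lam * h - 1) (- 0) \<le> 55 / 100" by simp
    from quad_step[OF this, of "of_int b" "of_int c"]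
    have q: "quad (of_int (a - 1)) (of_int b) \<le> 3 / 4 * quad (of_int b) (of_int c) + 22 / 10"
      by (simp add: a algebra_simps)
    have "lam * (weight 1 + (1 + lam)) = lam * weight 1 + (lam + lam^2)"
      by (simp add: algebra_simps power2_eq_square)
    then have "(mk (a + b + c) (a - 1) b, 1) \<in> tile_strip"
      using ge[of "1 + lam"] le[of "weight 1 + (1 + lam)"] h 3 w lam lam_sq shift(1)
      by (simp add: tile_strip_def)
    then show ?thesis using q rauzy_tiling_parent(4)[of a b c] 3 by blast
  next
    case 4
    have "lam * h \<le> lam * 1" using 4 l0 lam by (intro mult_left_mono) auto
    then have "quad (lam * h) 0 \<le> 55 / 100"
      using quad_perturbation_0[of "lam * h"] lam lh by linarith
    then have "quad (lam * h) (- 0) \<le> 55 / 100" by simp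
    from quad_step[OF this, of "of_int b" "of_int c"]
    have q: "quad (of_int a) (of_int b) \<le> 3 / 4 * quad (of_int b) (of_int c) + 22 / 10"
      by (simp add: a)
    have "(mk (a + b + c) a b, 3) \<in> tile_strip"
      using ge[of 0] le[of "weight 3"] h 4 w by (simp add: tile_strip_def)
    then show ?thesis using q rauzy_tiling_parent(3)[of a b c] 4 by blast
  next
    case 5
    have "lam * h \<le> lam * weight 2" using h 5 l0 by (intro mult_left_mono) auto
    then have "quad (lam * h) (- 1) \<le> 55 / 100"
      using quad_perturbation_1[of "lam * h"] w lh by simp
    from quad_step[OF this, of "of_int b" "of_int c"]
    have q: "quad (of_int a) (of_int (b - 1)) \<le> 3 / 4 * quad (of_int b) (of_int c) + 22 / 10"
      by (simp add: a)
    have "lam * (weight 1 + 1) = lam * weight 1 + lam"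
      by (simp add: algebra_simps power2_eq_square)
    then have "(mk (a + b + c) a (b - 1), 1) \<in> tile_strip"
      using ge[of 1] le[of "weight 1 + 1"] h 5 w lam lam_sq shift(2)
      by (simp add: tile_strip_def)
    then show ?thesis using q rauzy_tiling_parent(5)[of a b c] 5 by blast
  qed
qed

text \<open>\<open>quad\<close> bounds the last two coordinates, the height then bounds the first
  one, and finitely many tiles remain for \<open>small_check\<close>.\<close>

lemma small_strip:
  assumes "(mk a b c, k) \<in> tile_strip" "quad (of_int b) (of_int c) < 9"
  shows "(mk a b c, k) \<in> rauzy_tiling"
proof -
  have "36 / 100 * (of_int c)^2 < (9::real)" "67 / 100 * (of_int b)^2 < (9::real)"
    using quad_lower(1)[of "of_int c" "of_int b"] quad_lower(2)[of "of_int b" "of_int c"] assms(2)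
    by linarith+
  then have "(of_int c)^2 < (5::real)^2" "(of_int b)^2 < (4::real)^2" by (simp_all)
  then have "\<bar>of_int c\<bar> < (5::real)" "\<bar>of_int b\<bar> < (4::real)"
    by (metis abs_le_square_iff abs_numeral linorder_not_less)+
  then have bc: "\<bar>c\<bar> < 5" "\<bar>b\<bar> < 4" by linarith+
  define h where "h = ht (mk a b c)"
  have h: "0 \<le> h" "h < weight k" using assms by (auto simp: tile_strip_def h_def)
  have h': "h = (1 + lam + lam^2) * of_int a + (1 + lam) * of_int b + of_int c"
    by (simp add: h_def ht_eq)
  have h2: "h < 2" using h lam lam_sq exhaust_3[of k] by auto
  have prod: "- (x * m) \<le> x * of_int i \<and> x * of_int i \<le> x * m"
    if "0 \<le> x" "\<bar>of_int i\<bar> \<le> m" for x m :: real and i :: int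
    using that by (metis abs_le_D1 abs_le_D2 minus_le_iff mult_left_mono mult_minus_right)
  have c4: "- 4 \<le> real_of_int c" "real_of_int c \<le> 4" using bc by linarith+
  have b3: "\<bar>real_of_int b\<bar> \<le> 3" using bc by linarith
  have b1: "- 5 \<le> (1 + lam) * real_of_int b" "(1 + lam) * real_of_int b \<le> 5"
    using prod[OF _ b3, of "1 + lam"] lam by simp_all
  define X Y where "X = (1 + lam + lam^2) * real_of_int a" and "Y = (1 + lam) * real_of_int b"
  have hXY: "h = X + Y + of_int c" unfolding h' X_def Y_def by simp
  \<comment> \<open>Since \<open>0 \<le> h < 2\<close> and the other two terms are at most 5 and 4
    in absolute value, \<open>X\<close> cannot exceed 11 in absolute value.\<close>
  have w6: "11 + 3 / 100 < (1 + lam + lam^2) * 6" using lam lam_sq by simp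
  have "\<bar>a\<bar> < 6"
  proof (rule ccontr)
    assume "\<not> \<bar>a\<bar> < 6"
    then consider "6 \<le> real_of_int a" | "real_of_int a \<le> - 6" by linarith
    then show False
    proof cases
      case 1
      then have "(1 + lam + lam^2) * 6 \<le> X"
        unfolding X_def using lam lam_sq by (intro mult_left_mono) auto
      with w6 have "11 + 3 / 100 < X" by (rule order.strict_trans2)
      then show False using hXY h2 b1(1)[folded Y_def] c4 by linarith
    next
      case 2
      then have "X \<le> (1 + lam + lam^2) * (- 6)"
        unfolding X_def using lam lam_sq by (intro mult_left_mono) auto
      then have "X < - 11" using w6 by linarith
      then show False using hXY h b1(2)[folded Y_def] c4 by linarith
    qed
  qed
  then have a6: "\<bar>a\<bar> \<le> 5" by simp
  then have a5: "\<bar>real_of_int a\<bar> \<le> 5" by linarith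
  define i where "i = 18393 * a + 15437 * b + 10000 * c"
  have i: "10000 * h - real_of_int i
      = - ((18393 - 10000 * (1 + lam + lam^2)) * of_int a) - (15437 - 10000 * (1 + lam)) * of_int b"
    unfolding h' i_def by (simp add: algebra_simps)
  have d: "0 \<le> 18393 - 10000 * (1 + lam + lam^2)" "18393 - 10000 * (1 + lam + lam^2) \<le> 4 / 10"
    "0 \<le> 15437 - 10000 * (1 + lam)" "15437 - 10000 * (1 + lam) \<le> 2/10"
    using lam lam_sq by auto
  \<comment> \<open>The weights are rounded by at most 0.4 and 0.2, and the coordinates are at most
    5 and 3: an error of at most 2.6, whence the margin 3 in \<open>small_check\<close>.\<close>
  have ih: "\<bar>10000 * h - real_of_int i\<bar> < 3"
  proof -
    define X Y where "X = (18393 - 10000 * (1 + lam + lam^2)) * real_of_int a"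
      and "Y = (15437 - 10000 * (1 + lam)) * real_of_int b"
    have "\<bar>X\<bar> \<le> 4 / 10 * 5" "\<bar>Y\<bar> \<le> 2 / 10 * 3"
      unfolding X_def Y_def abs_mult using d a5 b3 by (intro mult_mono; simp)+
    then show ?thesis unfolding i X_def[symmetric] Y_def[symmetric] by linarith
  qed
  have mem: "a \<in> set [-5..5]" "b \<in> set [-3..3]" "c \<in> set [-4..4]"
    using a6 bc by auto
  have "\<not> (i < -3 \<or> 18396 < i)"
    using ih h lam lam_sq exhaust_3[of k] by auto
  then have chk:
    "i \<le> 10003 \<and> \<not> (a = 0 \<and> b = 0 \<and> c = 1) \<longrightarrow> ancestor_check 10 3 a b c"
    "i \<le> 15440 \<and> \<not> (a = 0 \<and> b = 1 \<and> c = 0) \<longrightarrow> ancestor_check 10 2 a b c"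
    "\<not> (a = 1 \<and> b = 0 \<and> c = 0) \<longrightarrow> ancestor_check 10 1 a b c"
    using small_check[unfolded small_check_def Let_def, rule_format, OF mem(2,3,1)]
    unfolding i_def by metis+
  consider "k = 1" | "k = 2" | "k = 3" using exhaust_3 by blast
  then show ?thesis
  proof cases
    case 1
    then have "\<not> (a = 1 \<and> b = 0 \<and> c = 0)" using h h' by auto
    then show ?thesis using chk(3) ancestor_check[of 10 1 a b c] 1 by simp
  next
    case 2
    then have "\<not> (a = 0 \<and> b = 1 \<and> c = 0)" using h h' by auto
    moreover have "i \<le> 15440" using ih h lam 2 by auto
    ultimately show ?thesis using chk(2) ancestor_check[of 10 2 a b c] 2 by simp
  next
    case 3
    then have "\<not> (a = 0 \<and> b = 0 \<and> c = 1)" using h h' by auto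
    moreover have "i \<le> 10003" using ih h 3 by auto
    ultimately show ?thesis using chk(1) ancestor_check[of 10 3 a b c] 3 by simp
  qed
qed

text \<open>The map \<open>q \<mapsto> 3 / 4 * q + 22 / 10\<close> has the fixed point 44/5, below
  89/10, so each parent multiplies the excess over 89/10 by at most 3/4. The exponent counts the
  steps until this excess is below 1/10, where \<open>small_strip\<close> takes over.\<close>

lemma bounded_strip:
  "(z, k) \<in> tile_strip \<Longrightarrow> quad (of_int (z$2)) (of_int (z$3)) < 89 / 10 + 1 / 10 * (4 / 3) ^ n
    \<Longrightarrow> (z, k) \<in> rauzy_tiling"
proof (induction n arbitrary: z k)
  case 0
  obtain a b c where z: "z = mk a b c" by (rule mk_cases)
  then show ?case using small_strip[of a b c k] 0 by simp
next
  case (Suc n)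
  obtain a b c where z: "z = mk a b c" by (rule mk_cases)
  obtain a' b' c' k' where p: "(mk a' b' c', k') \<in> tile_strip"
    "(mk a' b' c', k') \<in> rauzy_tiling \<Longrightarrow> (mk a b c, k) \<in> rauzy_tiling"
    "quad (of_int b') (of_int c') \<le> 3 / 4 * quad (of_int b) (of_int c) + 22 / 10"
    using strip_parent Suc.prems(1) unfolding z by blast
  have "quad (of_int b) (of_int c) < 89 / 10 + 1 / 10 * (4 / 3 * (4 / 3) ^ n)"
    using Suc.prems(2) unfolding z by simp
  with p(3) have "quad (of_int b') (of_int c') < 89 / 10 + 1 / 10 * (4 / 3) ^ n"
    by linarith
  then show ?case using p(2) Suc.IH[OF p(1)] unfolding z by simp
qed

theorem rauzy_tiling_eq: "rauzy_tiling = tile_strip"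
proof
  show "rauzy_tiling \<subseteq> tile_strip"
    using rauzy_patch_strip unfolding rauzy_tiling_def by blast
  show "tile_strip \<subseteq> rauzy_tiling"
  proof (rule subrelI)
    fix z k assume "(z, k) \<in> tile_strip"
    moreover obtain n where "10 * quad (of_int (z$2)) (of_int (z$3)) < (4 / 3) ^ n"
      using real_arch_pow[of "4/3"] by auto
    then have "quad (of_int (z$2)) (of_int (z$3)) < 89 / 10 + 1 / 10 * (4 / 3) ^ n" by simp
    ultimately show "(z, k) \<in> rauzy_tiling" by (rule bounded_strip)
  qed
qed

section \<open>Arrows and rhombi in the lattice\<close>

lemma distinct3_iff: "{i, j, k} = (UNIV :: 3 set) \<longleftrightarrow> i \<noteq> j \<and> j \<noteq> k \<and> i \<noteq> k"
proof -
  have e: "{i, j, k} = UNIV \<longleftrightarrow> 1 \<in> {i, j, k} \<and> 2 \<in> {i, j, k} \<and> 3 \<in> {i, j, k}"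
    using forall_3[of "\<lambda>x. x \<in> {i, j, k}"] by blast
  show ?thesis
    unfolding e using exhaust_3[of i] exhaust_3[of j] exhaust_3[of k]
    by (elim disjE; hypsubst; simp)
qed

lemma ex_other: "\<exists>k::3. k \<noteq> i"
  by (metis type3_distinct(1))

lemma ex_third: "i \<noteq> j \<Longrightarrow> \<exists>k::3. k \<noteq> i \<and> k \<noteq> j"
  using exhaust_3[of i] exhaust_3[of j] by (metis type3_distinct)

lemma third_unique: "i \<noteq> j \<Longrightarrow> j \<noteq> k \<Longrightarrow> i \<noteq> k \<Longrightarrow> x = i \<or> x = j \<or> x = (k::3)"
  using distinct3_iff[of i j k] by blast

text \<open>The lattice points above the vertices of the tiling. The upper bound is the sum of the
  three weights, that is, the height of \<open>(1, 1, 1)\<close>.\<close>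

definition strip :: "(int^3) set" where
  "strip = {z. 0 \<le> ht z \<and> ht z < 3 + 2 * lam + lam^2}"

lemma weight_sum: "i \<noteq> j \<Longrightarrow> j \<noteq> k \<Longrightarrow> i \<noteq> k \<Longrightarrow> weight i + weight j + weight k = 3 + 2 * lam + lam^2"
  using exhaust_3[of i] exhaust_3[of j] exhaust_3[of k] by auto

lemma weight_pos: "0 < weight k"
  using exhaust_3[of k] lam lam_sq by auto

lemma ht_axis: "ht (axis a e) = weight a * of_int e"
  using exhaust_3[of a] by (auto simp: ht_eq axis_def)

lemma axis_add: "axis a e + axis a f = axis a (e + f :: int)"
  and axis_neg: "- axis a e = axis a (- e :: int)"
  by (auto simp: vec_eq_iff axis_def)

lemma axis_zero [simp]: "axis a 0 = (0 :: int^3)"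
  by (auto simp: vec_eq_iff axis_def)

section \<open>Injectivity of the projection on the strip\<close>

lemma projZ_nth: "projZ z $ 1 = sqrt 3 / 2 * (of_int (z$2) - of_int (z$1))"
  "projZ z $ 2 = of_int (z$3) - (of_int (z$1) + of_int (z$2)) / 2"
  by (simp_all add: projZ_def proj_def algebra_simps add_divide_distrib)

lemma point_eq_iff: "(u :: real^2) = v \<longleftrightarrow> u$1 = v$1 \<and> u$2 = v$2"
  by (simp add: vec_eq_iff forall_2)

lemma projZ_add: "projZ (u + v) = projZ u + projZ v"
  by (simp add: point_eq_iff projZ_nth algebra_simps add_divide_distrib)

lemma projZ_diff: "projZ (u - v) = projZ u - projZ v"
  by (simp add: point_eq_iff projZ_nth algebra_simps add_divide_distrib diff_divide_distrib)

lemma projZ_axis: "projZ (axis a 1) = pe a"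
proof -
  have "(\<chi> i. real_of_int ((axis a 1 :: int^3) $ i)) = axis a 1"
    by (auto simp: vec_eq_iff axis_def)
  then show ?thesis by (simp add: pe_def projZ_def)
qed

lemma projZ_zero: "projZ 0 = 0"
  by (simp add: point_eq_iff projZ_nth)

lemma projZ_axis_neg: "projZ (axis a (- 1)) = - pe a"
proof -
  have "projZ (axis a (-1)) + projZ (axis a 1) = 0"
    by (simp add: projZ_add[symmetric] axis_add projZ_zero)
  then show ?thesis by (simp add: projZ_axis eq_neg_iff_add_eq_0)
qed

lemma projZ_eq_zero: "projZ d = 0 \<Longrightarrow> d = mk (d$1) (d$1) (d$1)"
  by (simp add: point_eq_iff projZ_nth vec3_eq_iff)

text \<open>The kernel of the projection is spanned by \<open>(1, 1, 1)\<close>, whose height is the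
  full width of the half-open strip.\<close>

lemma inj_on_projZ: "inj_on projZ strip"
proof (rule inj_onI)
  fix u v assume uv: "u \<in> strip" "v \<in> strip" "projZ u = projZ v"
  then have "projZ (u - v) = 0" by (simp add: projZ_diff)
  from projZ_eq_zero[OF this] obtain t where t: "u - v = mk t t t" by blast
  have "ht u - ht v = (3 + 2 * lam + lam^2) * of_int t"
    by (simp add: ht_diff[symmetric] t ht_eq[of "mk t t t"] algebra_simps)
  moreover have "\<bar>ht u - ht v\<bar> < 3 + 2 * lam + lam^2"
    using uv unfolding strip_def by auto
  moreover have "0 < 3 + 2 * lam + lam^2" using lam lam_sq by simp
  ultimately have "\<bar>real_of_int t\<bar> < 1" by (simp add: abs_mult)
  then have "t = 0" by linarith
  then have "u - v = 0" by (simp add: t vec3_eq_iff)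
  then show "u = v" by simp
qed

lemma projZ_eq_iff [simp]: "p \<in> strip \<Longrightarrow> q \<in> strip \<Longrightarrow> projZ p = projZ q \<longleftrightarrow> p = q"
  using inj_on_projZ by (auto dest: inj_onD)

lemma axis_eq_iff: "e \<noteq> 0 \<Longrightarrow> axis a e = axis b f \<longleftrightarrow> a = b \<and> e = (f::int)"
  by (auto simp: vec_eq_iff axis_def split: if_splits)

lemma axis_add_nonzero: "g \<noteq> 0 \<Longrightarrow> (c, g) \<noteq> (x, - h) \<Longrightarrow> axis x h + axis c g \<noteq> (0 :: int^3)"
proof
  assume g: "g \<noteq> 0" "(c, g) \<noteq> (x, - h)" and "axis x h + axis c g = (0 :: int^3)"
  then have "(axis x h + axis c g) $ c = 0" "(axis x h + axis c g) $ x = 0" by simp_all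
  then show False using g by (cases "c = x") (auto simp: axis_def add_eq_0_iff)
qed

text \<open>The difference of two signed unit vectors has a vanishing coordinate, so it cannot be a
  nonzero multiple of \<open>(1, 1, 1)\<close>.\<close>

lemma projZ_axis_eq: "e \<noteq> 0 \<Longrightarrow> projZ (axis a e) = projZ (axis b f) \<Longrightarrow> a = b \<and> e = f"
proof -
  assume e: "e \<noteq> 0" and "projZ (axis a e) = projZ (axis b f)"
  then have "projZ (axis a e - axis b f) = 0" by (simp add: projZ_diff)
  from projZ_eq_zero[OF this] obtain t where t: "axis a e - axis b f = mk t t t" by blast
  obtain k where "k \<noteq> a" "k \<noteq> b"
    using ex_third[of a b] ex_other[of a] by blast
  then have "(axis a e - axis b f) $ k = 0" by (simp add: axis_def)
  then have "t = 0" using exhaust_3[of k] by (auto simp: t)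
  then have "axis a e = axis b f" using t by (simp add: vec3_eq_iff)
  then show ?thesis using e axis_eq_iff by blast
qed

text \<open>Heights increase in every direction, so only the lowest and the highest corner of a tile
  matter.\<close>

lemma tile_iff:
  assumes "i \<noteq> j" "j \<noteq> k" "i \<noteq> k"
  shows "(z, k) \<in> rauzy_tiling \<longleftrightarrow> z \<in> strip \<and> z + axis i 1 + axis j 1 \<in> strip"
  using weight_sum[OF assms] weight_pos[of i] weight_pos[of j] weight_pos[of k]
  by (auto simp: rauzy_tiling_eq tile_strip_def strip_def ht_add ht_axis)

lemma strip_between:
  "z \<in> strip \<Longrightarrow> z + axis i 1 + axis j 1 \<in> strip \<Longrightarrow> z + axis i 1 \<in> strip \<and> z + axis j 1 \<in> strip"
  using weight_pos[of i] weight_pos[of j] by (auto simp: strip_def ht_add ht_axis)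

lemma sides_eq: "sides (z, k) = {{projZ (z + axis j m), projZ (z + axis j m + axis i 1)} | i j m.
   i \<noteq> j \<and> j \<noteq> k \<and> i \<noteq> k \<and> m \<in> {0, 1}}"
proof -
  have 0: "projZ z + (0::real) *\<^sub>R pe j = projZ (z + axis j 0)"
    "projZ z + pe i + (0::real) *\<^sub>R pe j = projZ (z + axis j 0 + axis i 1)" for i j
    by (simp_all add: projZ_add projZ_axis)
  have 1: "projZ z + (1::real) *\<^sub>R pe j = projZ (z + axis j 1)"
    "projZ z + pe i + (1::real) *\<^sub>R pe j = projZ (z + axis j 1 + axis i 1)" for i j
    by (simp_all add: projZ_add projZ_axis)
  show ?thesis
    unfolding sides_def prod.case distinct3_iff
  proof (intro Collect_cong iffI; elim exE conjE)
    fix x i j \<mu>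
    assume "x = {projZ z + \<mu> *\<^sub>R pe j, projZ z + pe i + \<mu> *\<^sub>R pe j}"
      "i \<noteq> j" "j \<noteq> k" "i \<noteq> k" "\<mu> \<in> {0, 1}"
    then show "\<exists>i j m. x = {projZ (z + axis j m), projZ (z + axis j m + axis i 1)} \<and>
      i \<noteq> j \<and> j \<noteq> k \<and> i \<noteq> k \<and> m \<in> {0, 1}"
      using 0 1 by (metis insertE singletonD insertI1 insertI2)
  next
    fix x i j and m :: int
    assume "x = {projZ (z + axis j m), projZ (z + axis j m + axis i 1)}"
      "i \<noteq> j" "j \<noteq> k" "i \<noteq> k" "m \<in> {0, 1}"
    then show "\<exists>i j \<mu>. x = {projZ z + \<mu> *\<^sub>R pe j, projZ z + pe i + \<mu> *\<^sub>R pe j} \<and>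
      (i \<noteq> j \<and> j \<noteq> k \<and> i \<noteq> k) \<and> \<mu> \<in> {0, 1}"
      using 0 1 by (metis insertE singletonD insertI1 insertI2)
  qed
qed

lemma sides_in_strip:
  assumes "(z, k) \<in> rauzy_tiling" "i \<noteq> j" "j \<noteq> k" "i \<noteq> k" "m \<in> {0, 1}"
  shows "z + axis j m \<in> strip" "z + axis j m + axis i 1 \<in> strip"
proof -
  have "z \<in> strip" "z + axis i 1 + axis j 1 \<in> strip" using assms tile_iff by blast+
  with strip_between[OF this] assms(5)
  show "z + axis j m \<in> strip" "z + axis j m + axis i 1 \<in> strip" by (auto simp: add_ac)
qed

text \<open>For an edge from \<open>p\<close> in direction \<open>a\<close>, the height of
  \<open>p\<close> is below \<open>weight j + weight k\<close>. If it is below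
  \<open>weight k\<close>, the tile based at \<open>p\<close> has the edge as a lower side;
  otherwise the tile based at \<open>p - axis k 1\<close> has it as an upper side.\<close>

lemma edges_eq:
  "edges = {{projZ p, projZ (p + axis a 1)} | p a. p \<in> strip \<and> p + axis a 1 \<in> strip}"
proof (rule subset_antisym; rule subsetI)
  fix x assume "x \<in> edges"
  then obtain z k where t: "(z, k) \<in> rauzy_tiling" "x \<in> sides (z, k)"
    unfolding edges_def by force
  then show "x \<in> {{projZ p, projZ (p + axis a 1)} | p a. p \<in> strip \<and> p + axis a 1 \<in> strip}"
    using sides_in_strip[OF t(1)] unfolding sides_eq by blast
next
  fix x assume "x \<in> {{projZ p, projZ (p + axis a 1)} | p a. p \<in> strip \<and> p + axis a 1 \<in> strip}"
  then obtain p a where p: "p \<in> strip" "p + axis a 1 \<in> strip"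
    and x: "x = {projZ p, projZ (p + axis a 1)}" by blast
  obtain j where j: "j \<noteq> a" using ex_other by blast
  obtain k where k: "k \<noteq> a" "k \<noteq> j" using ex_third j by metis
  have w: "weight a + weight j + weight k = 3 + 2 * lam + lam^2"
    using weight_sum j k by metis
  show "x \<in> edges"
  proof (cases "ht p < weight k")
    case True
    then have "(p, k) \<in> rauzy_tiling"
      using p by (simp add: rauzy_tiling_eq tile_strip_def strip_def)
    moreover have "x \<in> sides (p, k)"
      unfolding sides_eq mem_Collect_eq
      by (rule exI[of _ a], rule exI[of _ j], rule exI[of _ 0]) (use x j k in auto)
    ultimately show ?thesis unfolding edges_def by blast
  next
    case False
    then have "(p - axis k 1, j) \<in> rauzy_tiling"
      using p w by (simp add: rauzy_tiling_eq tile_strip_def strip_def ht_diff ht_add ht_axis)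
    moreover have "x \<in> sides (p - axis k 1, j)"
      unfolding sides_eq mem_Collect_eq
      by (rule exI[of _ a], rule exI[of _ k], rule exI[of _ 1]) (use x j k in auto)
    ultimately show ?thesis unfolding edges_def by blast
  qed
qed

lemma vertices_eq: "vertices = projZ ` strip"
proof
  show "vertices \<subseteq> projZ ` strip" unfolding vertices_def edges_eq by auto
  show "projZ ` strip \<subseteq> vertices"
  proof (rule image_subsetI)
    fix p assume p: "p \<in> strip"
    \<comment> \<open>The strip is wider than \<open>2 * weight 3\<close>, so one of the two steps
      in direction 3 stays inside.\<close>
    have "p + axis 3 1 \<in> strip \<or> (p - axis 3 1) \<in> strip"
      using p lam lam_sq by (auto simp: strip_def ht_add ht_diff ht_axis)
    then show "projZ p \<in> vertices"
    proof
      assume "p + axis 3 1 \<in> strip"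
      then show ?thesis using p unfolding vertices_def edges_eq by blast
    next
      assume "p - axis 3 1 \<in> strip"
      then have "{projZ (p - axis 3 1), projZ (p - axis 3 1 + axis 3 1)} \<in> edges"
        using p unfolding edges_eq
        by (intro CollectI exI[of _ "p - axis 3 1"] exI[of _ 3]) simp
      then show ?thesis unfolding vertices_def by auto
    qed
  qed
qed

section \<open>Arrows and tile sides as unit steps\<close>

lemma arrow_sym: "arrow x y \<longleftrightarrow> arrow y x"
  by (simp add: arrow_def insert_commute)

lemma arrow_vertices: "arrow x y \<Longrightarrow> x \<in> vertices \<and> y \<in> vertices"
  unfolding arrow_def vertices_def by blast

lemma arrow_axis:
  assumes "p \<in> strip" "p + axis a e \<in> strip" "e \<in> {1, - 1}"
  shows "arrow (projZ p) (projZ (p + axis a e))"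
proof -
  have 1: "arrow (projZ p) (projZ (p + axis a 1))" if "p \<in> strip" "p + axis a 1 \<in> strip" for p
    using that unfolding arrow_def edges_eq by blast
  have "arrow (projZ (p + axis a (-1))) (projZ p)"
    if "p \<in> strip" "p + axis a (-1) \<in> strip"
    using 1[of "p + axis a (-1)"] that by (simp add: add.assoc axis_add)
  then show ?thesis using 1 assms arrow_sym by auto
qed

lemma arrow_lift:
  assumes "p \<in> strip" "arrow (projZ p) y"
  obtains a e where "e \<in> {1, - 1}" "p + axis a e \<in> strip" "y = projZ (p + axis a e)"
proof -
  obtain q a where q: "q \<in> strip" "q + axis a 1 \<in> strip"
    "{projZ p, y} = {projZ q, projZ (q + axis a 1)}"
    using assms(2) unfolding arrow_def edges_eq by blast
  from q(3) consider "projZ p = projZ q" "y = projZ (q + axis a 1)"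
    | "projZ p = projZ (q + axis a 1)" "y = projZ q"
    by (auto simp: doubleton_eq_iff)
  then show thesis
  proof cases
    case 1
    then show thesis using q assms(1) that[of 1 a] by simp
  next
    case 2
    then have p: "p = q + axis a 1" using q assms(1) by simp
    then have "q = p + axis a (- 1)" by (simp add: add.assoc axis_add)
    then show thesis using q 2 that[of "-1" a] by simp
  qed
qed

text \<open>The point can be a vertex although \<open>p + axis a e\<close> has left the strip,
  namely as the projection of another lattice point. It is then not joined to
  \<open>projZ p\<close>: an arrow is a unit step inside the strip, and the six unit steps have
  distinct projections.\<close>

lemma arrow_pe:
  assumes "p \<in> strip" "e \<in> {1, - 1}"
  shows "arrow (projZ p) (projZ p + of_int e *\<^sub>R pe a) \<longleftrightarrow> p + axis a e \<in> strip"
proof -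
  have pe: "of_int e *\<^sub>R pe a = projZ (axis a e)"
    using assms(2) projZ_axis projZ_axis_neg by auto
  show ?thesis
  proof
    assume "arrow (projZ p) (projZ p + of_int e *\<^sub>R pe a)"
    then obtain b f where b: "f \<in> {1, - 1}" "p + axis b f \<in> strip"
      "projZ p + of_int e *\<^sub>R pe a = projZ (p + axis b f)"
      using arrow_lift[OF assms(1)] by metis
    then have "projZ (axis a e) = projZ (axis b f)" by (simp add: pe projZ_add)
    then have "a = b \<and> e = f" using projZ_axis_eq[of e a b f] assms(2) by auto
    then show "p + axis a e \<in> strip" using b by simp
  next
    assume "p + axis a e \<in> strip"
    then show "arrow (projZ p) (projZ p + of_int e *\<^sub>R pe a)"
      using arrow_axis[OF assms(1) _ assms(2)] by (simp add: pe projZ_add)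
  qed
qed

lemma sign_choice_lift:
  assumes "sign_choice s" "p \<in> strip" "p + axis a e \<in> strip" "e \<in> {1, - 1}"
  shows "s a (projZ (p + axis a e)) = - s a (projZ p)"
    and "c \<noteq> a \<Longrightarrow> s c (projZ (p + axis a e)) = s c (projZ p)"
proof -
  have "{projZ p, projZ (p + axis a e)} \<in> edges"
    using arrow_axis[OF assms(2-4)] unfolding arrow_def .
  moreover have "projZ (p + axis a e) - projZ p = of_int e *\<^sub>R pe a"
    using assms(4) projZ_axis projZ_axis_neg by (auto simp: projZ_add)
  ultimately have "s a (projZ (p + axis a e)) = - s a (projZ p) \<and>
      (\<forall>c. c \<noteq> a \<longrightarrow> s c (projZ (p + axis a e)) = s c (projZ p))"
    using assms(1) unfolding sign_choice_def by blast
  then show "s a (projZ (p + axis a e)) = - s a (projZ p)"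
    and "c \<noteq> a \<Longrightarrow> s c (projZ (p + axis a e)) = s c (projZ p)" by blast+
qed

text \<open>Here \<open>n\<close> records the direction in which the side is traversed.\<close>

lemma side_lift:
  assumes "p \<in> strip" "q \<in> strip" "(z, k) \<in> rauzy_tiling" "{projZ p, projZ q} \<in> sides (z, k)"
  obtains i j m n where "i \<noteq> j" "j \<noteq> k" "i \<noteq> k" "m \<in> {0, 1}" "n \<in> {0, 1}"
    "p = z + axis j m + axis i (1 - n)" "q = z + axis j m + axis i n"
proof -
  obtain i j m where i: "i \<noteq> j" "j \<noteq> k" "i \<noteq> k" "m \<in> {0, 1}"
    "{projZ p, projZ q} = {projZ (z + axis j m), projZ (z + axis j m + axis i 1)}"
    using assms(4) unfolding sides_eq by blast
  from i(5) consider "projZ p = projZ (z + axis j m)" "projZ q = projZ (z + axis j m + axis i 1)"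
    | "projZ q = projZ (z + axis j m)" "projZ p = projZ (z + axis j m + axis i 1)"
    by (auto simp: doubleton_eq_iff)
  then show thesis
    using that[of i j m 1] that[of i j m 0] i assms(1,2) sides_in_strip[OF assms(3) i(1-4)]
    by cases auto
qed

text \<open>Two consecutive sides of a tile use both of its directions, and its fourth corner is
  then \<open>p + axis b f\<close>. The assumption \<open>ne\<close> excludes walking back along the
  same edge, which shares a tile with itself.\<close>

lemma common_tile_iff:
  assumes "p \<in> strip" "p + axis a e \<in> strip" "p + axis a e + axis b f \<in> strip"
    and ef: "e \<in> {1, - 1}" "f \<in> {1, - 1}" and ne: "axis a e + axis b f \<noteq> 0"
  shows "(\<exists>t\<in>rauzy_tiling. {projZ p, projZ (p + axis a e)} \<in> sides t \<and>
      {projZ (p + axis a e), projZ (p + axis a e + axis b f)} \<in> sides t)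
    \<longleftrightarrow> a \<noteq> b \<and> p + axis b f \<in> strip" (is "?L \<longleftrightarrow> ?R")
proof
  assume ?L
  then obtain z k where t: "(z, k) \<in> rauzy_tiling"
    "{projZ p, projZ (p + axis a e)} \<in> sides (z, k)"
    "{projZ (p + axis a e), projZ (p + axis a e + axis b f)} \<in> sides (z, k)" by force
  obtain i j m n where 1: "i \<noteq> j" "j \<noteq> k" "i \<noteq> k" "m \<in> {0, 1}" "n \<in> {0, 1}"
    "p = z + axis j m + axis i (1 - n)" "p + axis a e = z + axis j m + axis i n"
    using side_lift[OF assms(1,2) t(1,2)] by blast
  obtain i' j' m' n' where 2: "i' \<noteq> j'" "j' \<noteq> k" "i' \<noteq> k" "m' \<in> {0, 1}" "n' \<in> {0, 1}"
    "p + axis a e = z + axis j' m' + axis i' (1 - n')"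
    "p + axis a e + axis b f = z + axis j' m' + axis i' n'"
    using side_lift[OF assms(2,3) t(1,3)] by blast
  \<comment> \<open>Both sides use the two directions of the tile; if they used the same one, the
    second step would reverse the first.\<close>
  have ij: "i' = i \<and> j' = j \<or> i' = j \<and> j' = i"
    using third_unique[OF 1(1-3)] 1 2 by metis
  have q: "axis j m + axis i n = axis j' m' + axis i' (1 - n')" using 1(7) 2(6) by simp
  have ae: "axis a e = axis i (n - (1 - n))"
  proof -
    have "axis a e = axis i n - axis i (1 - n)" using 1(6,7) by (simp add: algebra_simps)
    then show ?thesis by (metis axis_add axis_neg diff_conv_add_uminus uminus_add_conv_diff add.commute minus_diff_eq)
  qed
  have bf: "axis b f = axis i' (n' - (1 - n'))"
  proof -
    have "axis b f = axis i' n' - axis i' (1 - n')" using 2(6,7) by (simp add: algebra_simps)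
    then show ?thesis by (metis axis_add axis_neg diff_conv_add_uminus uminus_add_conv_diff add.commute minus_diff_eq)
  qed
  have e0: "e \<noteq> 0" "f \<noteq> 0" using ef by auto
  have a: "a = i" "e = n - (1 - n)" using ae axis_eq_iff[OF e0(1)] by blast+
  have b: "b = i'" "f = n' - (1 - n')" using bf axis_eq_iff[OF e0(2)] by blast+
  have qi: "(axis j m + axis i n) $ x = (axis j' m' + axis i' (1 - n')) $ x" for x
    by (simp add: q)
  from ij show ?R
  proof
    assume s: "i' = i \<and> j' = j"
    then have "n = 1 - n'" using qi[of i] 1(1) by (simp add: axis_def)
    then have "axis a e + axis b f = 0" using a b s by (simp add: axis_add)
    then show ?R using ne by blast
  next
    assume s: "i' = j \<and> j' = i"
    then have "n = m'" "m = 1 - n'" using qi[of i] qi[of j] 1(1) by (simp_all add: axis_def)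
    then have "p + axis b f = z + axis j n' + axis i (1 - n)"
      using 1(6) b s by (simp add: add_ac axis_add)
    moreover have "z + axis j n' + axis i (1 - n) \<in> strip"
      using sides_in_strip[OF t(1) 1(1-3) 2(5)] 1(5) by auto
    ultimately show ?R using a b s 1(1) by simp
  qed
next
  assume r: ?R
  then obtain k where k: "k \<noteq> a" "k \<noteq> b" using ex_third by metis
  \<comment> \<open>\<open>m\<close> and \<open>n\<close> are 1 for descending steps, so that
    \<open>z\<close> is the lowest corner of the square, where the tile is based.\<close>
  define m n :: int where "m = (if e = 1 then 0 else 1)" and "n = (if f = 1 then 0 else 1)"
  define z where "z = p - axis a m - axis b n"
  have mn: "m \<in> {0, 1}" "n \<in> {0, 1}" "1 - m \<in> {0, 1}" "1 - n \<in> {0, 1}"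
    and ef': "e = 1 - 2 * m" "f = 1 - 2 * n"
    using ef by (auto simp: m_def n_def)
  have p: "p = z + axis a m + axis b n" by (simp add: z_def)
  have n1: "axis x (- 1 :: int) = - axis x 1" for x by (simp add: axis_neg)
  have am: "axis a (1 - m) = axis a m + axis a (1 - 2 * m)"
    and bn: "axis b (1 - n) = axis b n + axis b (1 - 2 * n)"
    by (simp_all add: axis_add)
  have corners: "{z + axis a m + axis b n, z + axis a (1 - m) + axis b n,
    z + axis a (1 - m) + axis b (1 - n), z + axis a m + axis b (1 - n)} \<subseteq> strip"
  proof -
    have "z + axis a (1 - m) + axis b n = p + axis a e"
      "z + axis a (1 - m) + axis b (1 - n) = p + axis a e + axis b f"
      "z + axis a m + axis b (1 - n) = p + axis b f"
      by (simp_all only: p ef' am bn add_ac)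
    then show ?thesis using assms(1-3) r p
      by (simp only: insert_subset empty_subsetI simp_thms)
  qed
  moreover have mn4: "m = 0 \<and> n = 0 \<or> m = 0 \<and> n = 1 \<or> m = 1 \<and> n = 0 \<or> m = 1 \<and> n = 1"
    using mn(1,2) by blast
  ultimately have "z \<in> strip" "z + axis a 1 + axis b 1 \<in> strip"
    by (elim disjE conjE; simp add: add_ac)+
  then have t: "(z, k) \<in> rauzy_tiling" using tile_iff k r by metis
  have "{projZ (z + axis b n), projZ (z + axis b n + axis a 1)} \<in> sides (z, k)"
    unfolding sides_eq using r k mn by blast
  moreover have "{projZ (z + axis b n), projZ (z + axis b n + axis a 1)} = {projZ p, projZ (p + axis a e)}"
    unfolding p ef' using mn4 by (elim disjE conjE; simp add: insert_commute algebra_simps n1)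
  moreover have "{projZ (z + axis a (1 - m)), projZ (z + axis a (1 - m) + axis b 1)} \<in> sides (z, k)"
    unfolding sides_eq using r k mn by blast
  moreover have "{projZ (z + axis a (1 - m)), projZ (z + axis a (1 - m) + axis b 1)}
     = {projZ (p + axis a e), projZ (p + axis a e + axis b f)}"
    unfolding p ef' using mn4 by (elim disjE conjE; simp add: insert_commute algebra_simps n1)
  ultimately show ?L using t by metis
qed

section \<open>Labelled rhombi as lattice squares\<close>

lemma four_cycle_aux:
  assumes d: "distinct [P, Q, R, T]"
    and e: "{{P, Q}, {Q, Y}, {Y, X}, {X, P}} = {{P, Q}, {Q, R}, {R, T}, {T, P}}"
  shows "Y = R \<and> X = T"
proof -
  have "{Q, Y} \<in> {{P, Q}, {Q, R}, {R, T}, {T, P}}" unfolding e[symmetric] by simp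
  then have Y: "Y = P \<or> Y = R" using d by (auto simp: doubleton_eq_iff)
  have "{X, P} \<in> {{P, Q}, {Q, R}, {R, T}, {T, P}}" unfolding e[symmetric] by simp
  then have X: "X = Q \<or> X = T" using d by (auto simp: doubleton_eq_iff)
  have "{Q, R} \<in> {{P, Q}, {Q, Y}, {Y, X}, {X, P}}" unfolding e by simp
  then have Y': "Y = R" using d X Y by (auto simp: doubleton_eq_iff)
  have "{R, T} \<in> {{P, Q}, {Q, Y}, {Y, X}, {X, P}}" unfolding e by simp
  then show ?thesis using d X Y' by (auto simp: doubleton_eq_iff)
qed

text \<open>A 4-cycle given by its set of edges has only the eight dihedral labellings. The set of
  sides of a tile thus determines the points in \<open>rhombus\<close> up to these
  symmetries.\<close>

lemma four_cycle:
  assumes "distinct [P, Q, R, T]"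
    "{{Z, X}, {X, Y}, {Y, X'}, {X', Z}} = {{P, Q}, {Q, R}, {R, T}, {T, P}}"
  shows "(Z, X, Y, X') \<in> {(P, Q, R, T), (Q, R, T, P), (R, T, P, Q), (T, P, Q, R),
    (P, T, R, Q), (T, R, Q, P), (R, Q, P, T), (Q, P, T, R)}"
proof -
  have d: "Q \<noteq> P" "R \<noteq> P" "T \<noteq> P" "R \<noteq> Q" "T \<noteq> Q" "T \<noteq> R" using assms(1) by auto
  have "{Z, X} \<in> {{P, Q}, {Q, R}, {R, T}, {T, P}}" unfolding assms(2)[symmetric] by simp
  then consider "Z = P" "X = Q" | "Z = Q" "X = P" | "Z = Q" "X = R" | "Z = R" "X = Q"
    | "Z = R" "X = T" | "Z = T" "X = R" | "Z = T" "X = P" | "Z = P" "X = T"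
    by (auto simp: doubleton_eq_iff)
  then show ?thesis
  proof cases
    case 1
    then show ?thesis using assms d four_cycle_aux[of P Q R T Y X'] by simp
  next
    case 2
    then show ?thesis using assms d four_cycle_aux[of Q P T R Y X'] by (simp add: insert_commute)
  next
    case 3
    then show ?thesis using assms d four_cycle_aux[of Q R T P Y X'] by (simp add: insert_commute)
  next
    case 4
    then show ?thesis using assms d four_cycle_aux[of R Q P T Y X'] by (simp add: insert_commute)
  next
    case 5
    then show ?thesis using assms d four_cycle_aux[of R T P Q Y X'] by (simp add: insert_commute)
  next
    case 6
    then show ?thesis using assms d four_cycle_aux[of T R Q P Y X'] by (simp add: insert_commute)
  next
    case 7
    then show ?thesis using assms d four_cycle_aux[of T P Q R Y X'] by (simp add: insert_commute)
  next
    case 8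
    then show ?thesis using assms d four_cycle_aux[of P T R Q Y X'] by (simp add: insert_commute)
  qed
qed

lemma sides_square:
  assumes "i \<noteq> j" "j \<noteq> k" "i \<noteq> k"
  shows "sides (z, k) = {{projZ z, projZ (z + axis i 1)}, {projZ (z + axis i 1), projZ (z + axis i 1 + axis j 1)},
     {projZ (z + axis i 1 + axis j 1), projZ (z + axis j 1)}, {projZ (z + axis j 1), projZ z}}"
    (is "_ = ?S")
proof
  show "sides (z, k) \<subseteq> ?S"
  proof
    fix x assume "x \<in> sides (z, k)"
    then obtain i' j' m where x: "i' \<noteq> j'" "j' \<noteq> k" "i' \<noteq> k" "m = 0 \<or> m = 1"
      "x = {projZ (z + axis j' m), projZ (z + axis j' m + axis i' 1)}"
      unfolding sides_eq by blast
    have "i' = i \<and> j' = j \<or> i' = j \<and> j' = i"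
      using third_unique[OF assms] x by metis
    then show "x \<in> ?S" using x(4,5)
      by (elim disjE conjE) (simp_all add: add_ac insert_commute)
  qed
  have "{projZ (z + axis j' m), projZ (z + axis j' m + axis i' 1)} \<in> sides (z, k)"
    if "i' \<noteq> j'" "j' \<noteq> k" "i' \<noteq> k" "m \<in> {0, 1}" for i' j' m
    using that unfolding sides_eq by blast
  from this[of i j 0] this[of i j 1] this[of j i 0] this[of j i 1] assms
  show "?S \<subseteq> sides (z, k)" by (auto simp: add_ac insert_commute)
qed

text \<open>The signs allow any of the four corners as \<open>p\<close>, which makes the predicate
  stable under the symmetries of a rhombus.\<close>

definition square :: "int^3 \<Rightarrow> 3 \<Rightarrow> int \<Rightarrow> 3 \<Rightarrow> int \<Rightarrow> bool" where
  "square p a e b f \<longleftrightarrow> a \<noteq> b \<and> e \<in> {1, - 1} \<and> f \<in> {1, - 1} \<and> p \<in> strip \<and> p + axis a e \<in> strip \<and>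
     p + axis b f \<in> strip \<and> p + axis a e + axis b f \<in> strip"

definition lattice_rhombus :: "point \<Rightarrow> point \<Rightarrow> point \<Rightarrow> point \<Rightarrow> bool" where
  "lattice_rhombus Z X Y X' \<longleftrightarrow> (\<exists>p a e b f. square p a e b f \<and> Z = projZ p \<and>
     X = projZ (p + axis a e) \<and> Y = projZ (p + axis a e + axis b f) \<and> X' = projZ (p + axis b f))"

lemma square_swap: "square p a e b f \<Longrightarrow> square p b f a e"
  unfolding square_def by (auto simp: add_ac)

lemma square_flip: "square p a e b f \<Longrightarrow> square (p + axis a e) a (- e) b f"
proof -
  assume s: "square p a e b f"
  have n: "p + axis a e + axis a (- e) = p" by (simp add: axis_neg[symmetric])
  have "p + axis a e + axis a (- e) + axis b f = p + axis b f" by (simp add: n)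
  then show ?thesis unfolding square_def n using s by (auto simp: square_def)
qed

lemma lattice_rhombus_swap: "lattice_rhombus Z X Y X' \<Longrightarrow> lattice_rhombus Z X' Y X"
proof -
  assume "lattice_rhombus Z X Y X'"
  then obtain p a e b f where "square p a e b f" "Z = projZ p" "X = projZ (p + axis a e)"
     "Y = projZ (p + axis a e + axis b f)" "X' = projZ (p + axis b f)"
    unfolding lattice_rhombus_def by blast
  then show ?thesis unfolding lattice_rhombus_def
    by (intro exI[of _ p] exI[of _ b] exI[of _ f] exI[of _ a] exI[of _ e])
      (simp add: square_swap add_ac)
qed

lemma lattice_rhombus_flip: "lattice_rhombus Z X Y X' \<Longrightarrow> lattice_rhombus X Z X' Y"
proof -
  assume "lattice_rhombus Z X Y X'"
  then obtain p a e b f where "square p a e b f" "Z = projZ p" "X = projZ (p + axis a e)"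
     "Y = projZ (p + axis a e + axis b f)" "X' = projZ (p + axis b f)"
    unfolding lattice_rhombus_def by blast
  then show ?thesis unfolding lattice_rhombus_def
    by (intro exI[of _ "p + axis a e"] exI[of _ a] exI[of _ "- e"] exI[of _ b] exI[of _ f])
      (simp add: square_flip axis_neg[symmetric])
qed

text \<open>Swapping and flipping generate the dihedral group of order eight.\<close>

lemma lattice_rhombus_cycle:
  assumes r: "lattice_rhombus P Q R T"
    and "(Z, X, Y, X') \<in> {(P, Q, R, T), (Q, R, T, P), (R, T, P, Q), (T, P, Q, R),
    (P, T, R, Q), (T, R, Q, P), (R, Q, P, T), (Q, P, T, R)}"
  shows "lattice_rhombus Z X Y X'"
proof -
  note r1 = lattice_rhombus_swap[OF r] and r2 = lattice_rhombus_flip[OF r]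
  note r3 = lattice_rhombus_swap[OF r2] and r4 = lattice_rhombus_flip[OF r1]
  note r5 = lattice_rhombus_swap[OF r4]
  note r6 = lattice_rhombus_flip[OF r5]
  note r7 = lattice_rhombus_swap[OF r6]
  show ?thesis
    using assms(2) r r1 r2 r3 r4 r5 r6 r7 by (elim insertE emptyE) simp_all
qed

lemma rhombus_swap: "rhombus Z X Y X' \<Longrightarrow> rhombus Z X' Y X"
  and rhombus_flip: "rhombus Z X Y X' \<Longrightarrow> rhombus X Z X' Y"
  unfolding rhombus_def by (simp_all add: insert_commute)

lemma square_rhombus_pos:
  assumes "square p a 1 b 1"
  shows "rhombus (projZ p) (projZ (p + axis a 1)) (projZ (p + axis a 1 + axis b 1)) (projZ (p + axis b 1))"
proof -
  have ab: "a \<noteq> b" using assms unfolding square_def by blast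
  obtain k where k: "k \<noteq> a" "k \<noteq> b" using ex_third ab by metis
  have "(p, k) \<in> rauzy_tiling" using tile_iff[of a b k p] k ab assms unfolding square_def by metis
  moreover note sides_square[of a b k p]
  ultimately show ?thesis unfolding rhombus_def using ab k by metis
qed

lemma square_rhombus:
  assumes "square p a e b f"
  shows "rhombus (projZ p) (projZ (p + axis a e)) (projZ (p + axis a e + axis b f)) (projZ (p + axis b f))"
proof -
  have 1: "rhombus (projZ p) (projZ (p + axis a e)) (projZ (p + axis a e + axis b 1)) (projZ (p + axis b 1))"
    if sq: "square p a e b 1" for p a e b
  proof (cases "e = 1")
    case True
    then show ?thesis using sq square_rhombus_pos by simp
  next
    case False
    then have e: "e = - 1" using sq unfolding square_def by auto
    have n: "p + axis a (- 1) + axis a 1 = p" by (simp add: add.assoc axis_add)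
    show ?thesis
      using rhombus_flip[OF square_rhombus_pos[of "p + axis a (- 1)" a b]] square_flip[OF sq] n
      unfolding e by simp
  qed
  show ?thesis
  proof (cases "f = 1")
    case True
    then show ?thesis using assms 1 by simp
  next
    case False
    then have f: "f = - 1" using assms unfolding square_def by auto
    have n: "p + axis b (- 1) + axis b 1 = p" by (simp add: add.assoc axis_add)
    have c: "p + axis b (- 1) + axis a e = p + axis a e + axis b (- 1)" by (simp add: add_ac)
    \<comment> \<open>A descending step in direction \<open>b\<close> is an ascending one seen from
      the other end of the side.\<close>
    have "square (p + axis b (- 1)) b 1 a e" using square_flip[OF square_swap[OF assms]] f by simp
    then have "rhombus (projZ (p + axis b (- 1))) (projZ (p + axis b (- 1) + axis a e))
      (projZ (p + axis b (- 1) + axis a e + axis b 1)) (projZ (p + axis b (- 1) + axis b 1))"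
      by (rule 1[OF square_swap])
    moreover have "p + axis b (- 1) + axis a e + axis b 1 = p + axis a e" 
    proof -
      have "p + axis b (- 1) + axis a e + axis b 1 = (p + axis b (- 1) + axis b 1) + axis a e"
        by (simp only: add_ac)
      then show ?thesis by (simp only: n)
    qed
    ultimately have "rhombus (projZ (p + axis b (- 1))) (projZ (p + axis a e + axis b (- 1)))
      (projZ (p + axis a e)) (projZ p)" by (simp only: n c)
    from rhombus_swap[OF rhombus_flip[OF rhombus_swap[OF this]]]
    show ?thesis unfolding f .
  qed
qed

lemma rhombus_iff_lattice: "rhombus Z X Y X' \<longleftrightarrow> lattice_rhombus Z X Y X'"
proof
  assume "rhombus Z X Y X'"
  then obtain z k where t: "(z, k) \<in> rauzy_tiling"
    "sides (z, k) = {{Z, X}, {X, Y}, {Y, X'}, {X', Z}}" unfolding rhombus_def by force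
  obtain i where i: "i \<noteq> k" using ex_other by blast
  obtain j where j: "j \<noteq> i" "j \<noteq> k" using ex_third i by metis
  let ?u = "axis i 1 :: int^3" and ?v = "axis j 1 :: int^3"
  have st: "z \<in> strip" "z + ?u + ?v \<in> strip" using tile_iff t i j by metis+
  note st' = strip_between[OF st]
  have ne: "?u \<noteq> ?v" "?u \<noteq> 0" "?v \<noteq> 0" "?u + ?v \<noteq> 0"
  proof -
    show "?u \<noteq> ?v" using j axis_eq_iff[of 1 i j 1] by auto
    show "?u \<noteq> 0" "?v \<noteq> 0" by (simp_all add: axis_eq_0_iff)
    have "(?u + ?v) $ i = 1" using j by (simp add: axis_def)
    then show "?u + ?v \<noteq> 0" by (metis zero_index zero_neq_one)
  qed
  have "distinct [projZ z, projZ (z + ?u), projZ (z + ?u + ?v), projZ (z + ?v)]"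
    using st st' ne by (auto simp: add.assoc)
  moreover have "{{Z, X}, {X, Y}, {Y, X'}, {X', Z}} = {{projZ z, projZ (z + ?u)},
     {projZ (z + ?u), projZ (z + ?u + ?v)}, {projZ (z + ?u + ?v), projZ (z + ?v)},
     {projZ (z + ?v), projZ z}}"
    using sides_square[of i j k z] t(2) i j by metis
  ultimately have c: "(Z, X, Y, X') \<in> {
    (projZ z, projZ (z + ?u), projZ (z + ?u + ?v), projZ (z + ?v)),
    (projZ (z + ?u), projZ (z + ?u + ?v), projZ (z + ?v), projZ z),
    (projZ (z + ?u + ?v), projZ (z + ?v), projZ z, projZ (z + ?u)),
    (projZ (z + ?v), projZ z, projZ (z + ?u), projZ (z + ?u + ?v)),
    (projZ z, projZ (z + ?v), projZ (z + ?u + ?v), projZ (z + ?u)),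
    (projZ (z + ?v), projZ (z + ?u + ?v), projZ (z + ?u), projZ z),
    (projZ (z + ?u + ?v), projZ (z + ?u), projZ z, projZ (z + ?v)),
    (projZ (z + ?u), projZ z, projZ (z + ?v), projZ (z + ?u + ?v))}"
    by (rule four_cycle)
  have "lattice_rhombus (projZ z) (projZ (z + ?u)) (projZ (z + ?u + ?v)) (projZ (z + ?v))"
    unfolding lattice_rhombus_def square_def
    by (intro exI[of _ z] exI[of _ i] exI[of _ 1] exI[of _ j] exI[of _ 1]) (use st st' j in auto)
  from lattice_rhombus_cycle[OF this c] show "lattice_rhombus Z X Y X'" .
next
  assume "lattice_rhombus Z X Y X'"
  then show "rhombus Z X Y X'" unfolding lattice_rhombus_def using square_rhombus by blast
qed

section \<open>The path algebra and its quotients\<close>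

abbreviation "pcoeff \<equiv> Poly_Mapping.lookup"
abbreviation "supp \<equiv> Poly_Mapping.keys"
abbreviation "single \<equiv> Poly_Mapping.single"

lemma comb_sum: "f = (\<Sum>u\<in>supp f. single u (pcoeff f u))"
  by (rule poly_mapping_eqI) (simp add: lookup_sum lookup_single when_def sum.If_cases in_keys_iff)

text \<open>With common index sets, products of elements with different supports can be compared
  term by term.\<close>

lemma path_mult_supset:
  assumes "finite U" "finite V" "supp f \<subseteq> U" "supp g \<subseteq> V"
  shows "path_mult f g = (\<Sum>u\<in>U. \<Sum>v\<in>V. if last u = hd v
     then single (u @ tl v) (pcoeff f u * pcoeff g v) else 0)"
proof -
  have "path_mult f g = (\<Sum>u\<in>U. \<Sum>v\<in>supp g. if last u = hd v
     then single (u @ tl v) (pcoeff f u * pcoeff g v) else 0)"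
    unfolding path_mult_def
    by (rule sum.mono_neutral_left) (use assms in \<open>auto simp: in_keys_iff intro!: sum.neutral\<close>)
  also have "\<dots> = (\<Sum>u\<in>U. \<Sum>v\<in>V. if last u = hd v
     then single (u @ tl v) (pcoeff f u * pcoeff g v) else 0)"
    by (intro sum.cong refl sum.mono_neutral_left) (use assms in \<open>auto simp: in_keys_iff\<close>)
  finally show ?thesis .
qed

lemma path_mult_add_left: "path_mult (f + f') g = path_mult f g + path_mult f' g"
proof -
  let ?U = "supp f \<union> supp f'" and ?V = "supp g"
  have k: "supp (f + f') \<subseteq> ?U" by (rule keys_add)
  show ?thesis
    by (subst (1 2 3) path_mult_supset[of ?U ?V])
      (use k in \<open>auto simp: lookup_add distrib_right single_add sum.distrib[symmetric] intro!: sum.cong\<close>)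
qed

lemma path_mult_add_right: "path_mult f (g + g') = path_mult f g + path_mult f g'"
proof -
  let ?U = "supp f" and ?V = "supp g \<union> supp g'"
  have k: "supp (g + g') \<subseteq> ?V" by (rule keys_add)
  show ?thesis
    by (subst (1 2 3) path_mult_supset[of ?U ?V])
      (use k in \<open>auto simp: lookup_add distrib_left single_add sum.distrib[symmetric] intro!: sum.cong\<close>)
qed

lemma path_mult_zero [simp]: "path_mult 0 g = 0" "path_mult f 0 = 0"
  by (simp_all add: path_mult_def)

lemma path_mult_minus: "path_mult (- f) g = - path_mult f g" "path_mult f (- g) = - path_mult f g"
  using path_mult_add_left[of f "- f" g] path_mult_add_right[of f g "- g"]
  by (simp_all add: eq_neg_iff_add_eq_0 add.commute)

lemma path_mult_diff: "path_mult (f - f') g = path_mult f g - path_mult f' g"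
   "path_mult f (g - g') = path_mult f g - path_mult f g'"
  by (simp_all add: diff_conv_add_uminus path_mult_add_left path_mult_add_right path_mult_minus
      del: add_uminus_conv_diff)

lemma path_mult_single: "path_mult (single u a) (single v b) =
   (if last u = hd v then single (u @ tl v) (a * b) else 0)"
  by (subst path_mult_supset[of "{u}" "{v}"]) auto

lemma pth_mult: "path_mult (pth u) (pth v) = (if last u = hd v then pth (u @ tl v) else 0)"
  by (simp add: pth_def path_mult_single)

lemma coeff_scale [simp]: "pcoeff (scale c f) u = c * pcoeff f u"
  by (simp add: scale_def Poly_Mapping.map.rep_eq when_def)

lemma scale_simps: "scale c (f + g) = scale c f + scale c g" "scale c (f - g) = scale c f - scale c g"
  "scale c 0 = 0" "scale 1 f = f" "scale c (scale d f) = scale (c * d) f"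
  "scale c (single u a) = single u (c * a)" "scale (- 1) f = - f"
  "scale 0 f = 0" "scale (- c) f = - scale c f" "scale (c + d) f = scale c f + scale d f"
  by (rule poly_mapping_eqI; simp add: lookup_add lookup_minus lookup_single when_def algebra_simps)+

lemma single_eq_scale: "single u c = scale c (pth u)"
  by (simp add: pth_def scale_simps)

lemma supp_scale: "supp (scale c f) \<subseteq> supp f"
  by (auto simp: in_keys_iff)

lemma path_mult_scale: "path_mult (scale c f) g = scale c (path_mult f g)"
  "path_mult f (scale c g) = scale c (path_mult f g)"
proof -
  have hom: "scale c (\<Sum>u\<in>U. h u) = (\<Sum>u\<in>U. scale c (h u))" for h :: "point list \<Rightarrow> 'a comb" and U
    by (induction U rule: infinite_finite_induct) (simp_all add: scale_simps)
  have eq: "path_mult f g = (\<Sum>u\<in>supp f. \<Sum>v\<in>supp g. if last u = hd v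
     then single (u @ tl v) (pcoeff f u * pcoeff g v) else 0)" by (simp add: path_mult_def)
  show "path_mult (scale c f) g = scale c (path_mult f g)"
    by (subst path_mult_supset[of "supp f" "supp g"])
      (auto simp: supp_scale eq hom scale_simps mult.assoc intro!: sum.cong)
  show "path_mult f (scale c g) = scale c (path_mult f g)"
    by (subst path_mult_supset[of "supp f" "supp g"])
      (auto simp: supp_scale eq hom scale_simps mult_ac intro!: sum.cong)
qed

definition combs :: "'k::field comb set" where
  "combs = {f. supp f \<subseteq> paths}"

lemma carrier_path_algebra: "carrier path_algebra = combs"
  by (simp add: path_algebra_def combs_def)

lemma combs_iff: "f \<in> combs \<longleftrightarrow> (\<forall>u. u \<notin> paths \<longrightarrow> pcoeff f u = 0)"
  unfolding combs_def by (auto simp: in_keys_iff)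

lemma combs_closed [simp]:
  "0 \<in> combs" "f \<in> combs \<Longrightarrow> g \<in> combs \<Longrightarrow> f + g \<in> combs"
  "f \<in> combs \<Longrightarrow> - f \<in> combs" "f \<in> combs \<Longrightarrow> g \<in> combs \<Longrightarrow> f - g \<in> combs"
  "f \<in> combs \<Longrightarrow> scale c f \<in> combs"
  "u \<in> paths \<Longrightarrow> pth u \<in> combs" "u \<in> paths \<Longrightarrow> single u a \<in> combs"
  unfolding combs_iff pth_def by (auto simp: lookup_add lookup_minus lookup_single when_def)

lemma combs_induct [consumes 1, case_names zero add single]:
  assumes "f \<in> combs" "P 0" "\<And>f g. f \<in> combs \<Longrightarrow> g \<in> combs \<Longrightarrow> P f \<Longrightarrow> P g \<Longrightarrow> P (f + g)"
    "\<And>u a. u \<in> paths \<Longrightarrow> P (single u a)"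
  shows "P f"
proof -
  have "P (\<Sum>u\<in>U. single u (pcoeff f u)) \<and> (\<Sum>u\<in>U. single u (pcoeff f u)) \<in> combs"
    if "finite U" "U \<subseteq> paths" for U
    using that
  proof (induction U rule: finite_induct)
    case (insert x F)
    then show ?case using assms(3)[of "single x (pcoeff f x)"] assms(4) by simp
  qed (simp add: assms)
  from this[of "supp f"] show ?thesis using assms(1) comb_sum[of f] by (simp add: combs_def)
qed

lemma paths_nonempty: "u \<in> paths \<Longrightarrow> u \<noteq> []"
  by (simp add: paths_def)

lemma paths_last: "u \<in> paths \<Longrightarrow> [last u] \<in> paths"
  by (auto simp: paths_def)

lemma paths_append:
  assumes "u \<in> paths" "v \<in> paths" "last u = hd v"
  shows "u @ tl v \<in> paths"
proof (cases "tl v")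
  case Nil
  then show ?thesis using assms by simp
next
  case (Cons x xs)
  then have v: "v = hd v # x # xs" using assms(2) by (metis list.collapse paths_nonempty)
  have "successively arrow (hd v # x # xs)" using assms(2) v by (simp add: paths_def)
  then have "successively arrow (u @ x # xs)"
    using assms by (auto simp: paths_def successively_append_iff)
  moreover have "set (x # xs) \<subseteq> vertices" using assms(2) Cons unfolding paths_def
    by (metis (mono_tags, lifting) list.set_sel(2) mem_Collect_eq subset_code(1))
  ultimately show ?thesis using assms(1) Cons by (simp add: paths_def)
qed

lemma combs_mult [simp]: "f \<in> combs \<Longrightarrow> g \<in> combs \<Longrightarrow> path_mult f g \<in> combs"
proof (induction f rule: combs_induct)
  case (single u a)
  from single(2,1) show ?case
    by (induction g rule: combs_induct) (auto simp: path_mult_add_right path_mult_single paths_append)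
qed (simp_all add: path_mult_add_left)

lemma path_mult_assoc:
  assumes "f \<in> combs" "g \<in> combs" "h \<in> combs"
  shows "path_mult (path_mult f g) h = path_mult f (path_mult g h)"
  using assms
proof (induction f rule: combs_induct)
  case (single u a)
  from single(2,1,3) show ?case
  proof (induction g rule: combs_induct)
    case (single v b)
    from single(3,1,2) show ?case
    proof (induction h rule: combs_induct)
      case (single w c)
      have "last (u @ tl v) = last v" if "last u = hd v"
        using that paths_nonempty[OF single(2)] by (cases v) auto
      then show ?case using paths_nonempty[OF single(2)]
        by (auto simp: path_mult_single mult.assoc)
    qed (simp_all add: path_mult_add_right)
  qed (simp_all add: path_mult_add_left path_mult_add_right)
qed (simp_all add: path_mult_add_left)

section \<open>Two-sided ideals of the path algebra\<close>

lemma path_algebra_simps: "mult path_algebra = path_mult" "zero path_algebra = 0"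
   "add path_algebra = (+)"
  by (simp_all add: path_algebra_def)

lemma abelian_group_path_algebra: "abelian_group path_algebra"
proof (rule abelian_groupI)
  fix x :: "'a comb" assume "x \<in> carrier path_algebra"
  then show "\<exists>y\<in>carrier path_algebra. y \<oplus>\<^bsub>path_algebra\<^esub> x = \<zero>\<^bsub>path_algebra\<^esub>"
    by (intro bexI[of _ "- x"]) (auto simp: carrier_path_algebra path_algebra_simps)
qed (auto simp: carrier_path_algebra path_algebra_simps add_ac)

lemma path_algebra_neg: "f \<in> combs \<Longrightarrow> \<ominus>\<^bsub>path_algebra\<^esub> f = - f"
  by (rule abelian_group.minus_equality[OF abelian_group_path_algebra])
    (auto simp: carrier_path_algebra path_algebra_simps)

lemma two_sided_ideal_iff: "two_sided_ideal I path_algebra \<longleftrightarrow> I \<subseteq> combs \<and> 0 \<in> I \<and>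
   (\<forall>f\<in>I. \<forall>g\<in>I. f + g \<in> I) \<and> (\<forall>f\<in>I. - f \<in> I) \<and>
   (\<forall>f\<in>I. \<forall>g\<in>combs. path_mult g f \<in> I \<and> path_mult f g \<in> I)"
proof -
  interpret G: abelian_group "path_algebra :: 'a comb ring" by (rule abelian_group_path_algebra)
  have "additive_subgroup I path_algebra \<longleftrightarrow> I \<subseteq> combs \<and> 0 \<in> I \<and>
   (\<forall>f\<in>I. \<forall>g\<in>I. f + g \<in> I) \<and> (\<forall>f\<in>I. - f \<in> I)"
  proof
    assume "additive_subgroup I path_algebra"
    then have s: "subgroup I (add_monoid path_algebra)" by (rule additive_subgroup.a_subgroup)
    have c: "I \<subseteq> combs" using subgroup.subset[OF s] by (simp add: carrier_path_algebra)
    moreover have "- f \<in> I" if "f \<in> I" for f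
      using subgroup.m_inv_closed[OF s that] path_algebra_neg[of f] c that by (auto simp: a_inv_def)
    ultimately show "I \<subseteq> combs \<and> 0 \<in> I \<and>
   (\<forall>f\<in>I. \<forall>g\<in>I. f + g \<in> I) \<and> (\<forall>f\<in>I. - f \<in> I)"
      using subgroup.one_closed[OF s] subgroup.m_closed[OF s] by (simp add: path_algebra_simps)
  next
    assume r: "I \<subseteq> combs \<and> 0 \<in> I \<and> (\<forall>f\<in>I. \<forall>g\<in>I. f + g \<in> I) \<and> (\<forall>f\<in>I. - f \<in> I)"
    show "additive_subgroup I path_algebra"
    proof (rule additive_subgroupI, rule group.subgroupI[OF G.a_group])
      fix a assume "a \<in> I"
      then show "inv\<^bsub>add_monoid path_algebra\<^esub> a \<in> I"
        using r path_algebra_neg[of a] by (auto simp: a_inv_def)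
    qed (use r in \<open>auto simp: carrier_path_algebra path_algebra_simps\<close>)
  qed
  then show ?thesis
    by (auto simp: two_sided_ideal_def carrier_path_algebra path_algebra_simps)
qed

lemma two_sided_ideal_generated:
  assumes "S \<subseteq> combs"
  shows "two_sided_ideal (ideal_generated path_algebra S) path_algebra"
proof -
  have "two_sided_ideal combs (path_algebra :: 'a comb ring)"
    by (simp add: two_sided_ideal_iff)
  then have "ideal_generated path_algebra S \<subseteq> combs"
    using assms unfolding ideal_generated_def by blast
  then show ?thesis
    unfolding two_sided_ideal_iff ideal_generated_def by (auto 0 3 simp: two_sided_ideal_iff)
qed

lemma ideal_generated_superset: "S \<subseteq> ideal_generated path_algebra S"
  unfolding ideal_generated_def by blast

section \<open>Linear functionals that vanish on an ideal\<close>

definition functional :: "(point list \<Rightarrow> 'k) \<Rightarrow> 'k::field comb \<Rightarrow> 'k" where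
  "functional \<phi> f = (\<Sum>u\<in>supp f. pcoeff f u * \<phi> u)"

lemma functional_supset: "finite U \<Longrightarrow> supp f \<subseteq> U \<Longrightarrow> functional \<phi> f = (\<Sum>u\<in>U. pcoeff f u * \<phi> u)"
  unfolding functional_def by (rule sum.mono_neutral_left) (auto simp: in_keys_iff)

lemma functional_add: "functional \<phi> (f + g) = functional \<phi> f + functional \<phi> g"
proof -
  have "supp (f + g) \<subseteq> supp f \<union> supp g" by (rule keys_add)
  then show ?thesis
    by (subst (1 2 3) functional_supset[of "supp f \<union> supp g"])
      (auto simp: lookup_add distrib_right sum.distrib)
qed

lemma functional_zero [simp]: "functional \<phi> 0 = 0"
  by (simp add: functional_def)

lemma functional_scale: "functional \<phi> (scale c f) = c * functional \<phi> f"
  by (subst (1 2) functional_supset[of "supp f"]) (auto simp: supp_scale sum_distrib_left mult.assoc)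

lemma functional_minus: "functional \<phi> (- f) = - functional \<phi> f"
  using functional_scale[of \<phi> "- 1" f] by (simp add: scale_simps)

lemma functional_diff: "functional \<phi> (f - g) = functional \<phi> f - functional \<phi> g"
  using functional_add[of \<phi> f "- g"] by (simp add: functional_minus)

lemma functional_pth [simp]: "functional \<phi> (pth u) = \<phi> u"
  by (simp add: functional_def pth_def)

lemma functional_coeff: "functional (\<lambda>v. if v = u then 1 else 0) f = pcoeff f u"
  by (simp add: functional_def mult_delta_right in_keys_iff)

text \<open>The elements \<open>f\<close> for which the functional vanishes on all products
  \<open>a f b\<close> form a two-sided ideal, and by linearity the generators need only be tested
  between paths.\<close>

lemma functional_ideal:
  assumes S: "S \<subseteq> combs"
    and "\<And>r u v. r \<in> S \<Longrightarrow> u \<in> paths \<Longrightarrow> v \<in> paths \<Longrightarrow>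
      functional \<phi> (path_mult (path_mult (pth u) r) (pth v)) = 0"
    and "f \<in> ideal_generated path_algebra S" "a \<in> combs" "b \<in> combs"
  shows "functional \<phi> (path_mult (path_mult a f) b) = 0"
proof -
  define J where "J = {f \<in> combs. \<forall>a\<in>combs. \<forall>b\<in>combs. functional \<phi> (path_mult (path_mult a f) b) = 0}"
  have "functional \<phi> (path_mult (path_mult a r) b) = 0"
    if "r \<in> S" "a \<in> combs" "b \<in> combs" for r a b
    using that(2,3,1)
  proof (induction a rule: combs_induct)
    case (single u c)
    from single(2,1,3) show ?case
    proof (induction b rule: combs_induct)
      case (single v d)
      then show ?case
        using assms(2)[of r u v] by (simp add: single_eq_scale path_mult_scale functional_scale)
    qed (simp_all add: path_mult_add_right functional_add)
  qed (simp_all add: path_mult_add_left functional_add)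
  then have "S \<subseteq> J" using S unfolding J_def by blast
  moreover have "two_sided_ideal J path_algebra"
    unfolding two_sided_ideal_iff
  proof (intro conjI ballI)
    fix f g :: "'a comb" assume f: "f \<in> J" and g: "g \<in> combs"
    have "functional \<phi> (path_mult (path_mult a (path_mult g f)) b) = 0"
      if "a \<in> combs" "b \<in> combs" for a b
      using f g that path_mult_assoc[of a g f] by (simp add: J_def flip: path_mult_assoc)
    then show "path_mult g f \<in> J" using f g by (simp add: J_def)
    have "functional \<phi> (path_mult (path_mult a (path_mult f g)) b) = 0"
      if "a \<in> combs" "b \<in> combs" for a b
    proof -
      have "path_mult (path_mult a (path_mult f g)) b = path_mult (path_mult a f) (path_mult g b)"
        using f g that by (simp add: J_def path_mult_assoc)
      then show ?thesis using f g that by (simp add: J_def)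
    qed
    then show "path_mult f g \<in> J" using f g by (simp add: J_def)
  qed (auto simp: J_def path_mult_add_right path_mult_add_left functional_add path_mult_minus functional_minus)
  ultimately have "ideal_generated path_algebra S \<subseteq> J"
    unfolding ideal_generated_def by blast
  then show ?thesis using assms(3-5) unfolding J_def by blast
qed

section \<open>Computing with cosets of an ideal\<close>

definition cl :: "'k::field comb set \<Rightarrow> 'k comb \<Rightarrow> 'k comb set" where
  "cl I f = I +>\<^bsub>path_algebra\<^esub> f"

lemma cl_eq: "cl I f = {i + f | i. i \<in> I}"
  by (auto simp: cl_def a_r_coset_def' path_algebra_simps)

context
  fixes I :: "'k::field comb set"
  assumes I: "two_sided_ideal I path_algebra"
begin

lemma I_closed: "I \<subseteq> combs" "0 \<in> I" "f \<in> I \<Longrightarrow> g \<in> I \<Longrightarrow> f + g \<in> I" "f \<in> I \<Longrightarrow> - f \<in> I"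
  "f \<in> I \<Longrightarrow> g \<in> combs \<Longrightarrow> path_mult g f \<in> I" "f \<in> I \<Longrightarrow> g \<in> combs \<Longrightarrow> path_mult f g \<in> I"
  "f \<in> I \<Longrightarrow> g \<in> I \<Longrightarrow> f - g \<in> I"
  using I unfolding two_sided_ideal_iff by (auto simp: diff_conv_add_uminus simp del: add_uminus_conv_diff)

lemma cl_self: "f \<in> cl I f"
  using I_closed(2) unfolding cl_eq by force

lemma cl_iff: "g \<in> cl I f \<longleftrightarrow> g - f \<in> I"
  unfolding cl_eq by (auto intro: exI[of _ "g - f"])

lemma cl_cong: "cl I f = cl I g \<longleftrightarrow> f - g \<in> I"
proof
  assume "cl I f = cl I g"
  then show "f - g \<in> I" using cl_self[of f] cl_iff by blast
next
  assume a: "f - g \<in> I"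
  have "h - f \<in> I \<longleftrightarrow> h - g \<in> I" for h
    using I_closed(3)[OF _ a, of "h - f"] I_closed(7)[OF _ a, of "h - g"] by auto
  then show "cl I f = cl I g" using cl_iff by blast
qed

lemma cl_combs: "f \<in> combs \<Longrightarrow> g \<in> cl I f \<Longrightarrow> g \<in> combs"
  using I_closed(1) combs_closed(2) unfolding cl_eq by blast

lemma quot_simps:
  "carrier (path_algebra Quot I) = cl I ` combs"
  "\<zero>\<^bsub>path_algebra Quot I\<^esub> = cl I 0"
proof -
  have "carrier (path_algebra Quot I) = (\<Union>f\<in>combs. {cl I f})"
    unfolding cl_def by (simp add: FactRing_def A_RCOSETS_def' carrier_path_algebra)
  then show "carrier (path_algebra Quot I) = cl I ` combs" by blast
  show "\<zero>\<^bsub>path_algebra Quot I\<^esub> = cl I 0" by (simp add: FactRing_def cl_eq)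
qed

lemma quot_mult:
  assumes "f \<in> combs" "g \<in> combs"
  shows "cl I f \<otimes>\<^bsub>path_algebra Quot I\<^esub> cl I g = cl I (path_mult f g)"
proof -
  have "cl I (path_mult a b) = cl I (path_mult f g)" if "a \<in> cl I f" "b \<in> cl I g" for a b
  proof -
    have "path_mult a b - path_mult f g = path_mult (a - f) b + path_mult f (b - g)"
      by (simp add: path_mult_diff)
    also have "\<dots> \<in> I"
      using that assms(1) by (intro I_closed(3) I_closed(5,6) cl_combs[OF assms(2) that(2)]) (auto simp: cl_iff)
    finally show ?thesis by (simp add: cl_cong)
  qed
  moreover have "cl I f \<otimes>\<^bsub>path_algebra Quot I\<^esub> cl I g =
      (\<Union>a\<in>cl I f. \<Union>b\<in>cl I g. cl I (path_mult a b))"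
    by (simp add: FactRing_def rcoset_mult_def cl_def path_algebra_simps)
  ultimately have "cl I f \<otimes>\<^bsub>path_algebra Quot I\<^esub> cl I g =
      (\<Union>a\<in>cl I f. \<Union>b\<in>cl I g. cl I (path_mult f g))" by simp
  then show ?thesis using cl_self[of f] cl_self[of g] by auto
qed

lemma quot_add: "cl I f \<oplus>\<^bsub>path_algebra Quot I\<^esub> cl I g = cl I (f + g)"
proof -
  have "cl I f \<oplus>\<^bsub>path_algebra Quot I\<^esub> cl I g = {a + b | a b. a \<in> cl I f \<and> b \<in> cl I g}"
    by (auto simp: FactRing_def set_add_def' path_algebra_simps)
  also have "\<dots> = cl I (f + g)"
  proof (rule subset_antisym; rule subsetI)
    fix x assume "x \<in> {a + b | a b. a \<in> cl I f \<and> b \<in> cl I g}"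
    then obtain a b where x: "x = a + b" "a - f \<in> I" "b - g \<in> I" using cl_iff by blast
    have "x - (f + g) = (a - f) + (b - g)" using x by simp
    then show "x \<in> cl I (f + g)" using x I_closed(3) cl_iff by metis
  next
    fix x assume "x \<in> cl I (f + g)"
    then have "x - g \<in> cl I f" by (simp add: cl_iff algebra_simps)
    then show "x \<in> {a + b | a b. a \<in> cl I f \<and> b \<in> cl I g}" using cl_self[of g] by force
  qed
  finally show ?thesis .
qed

end

section \<open>A functional on closed paths of length four\<close>

text \<open>Inverse to \<open>axis\<close> on the six signed unit vectors, arbitrary
  elsewhere.\<close>

definition dir_of :: "int^3 \<Rightarrow> 3 \<times> int" where
  "dir_of u = (SOME (a, e). e \<in> {1, - 1} \<and> u = axis a e)"

lemma dir_of_axis [simp]: "e \<in> {1, - 1} \<Longrightarrow> dir_of (axis a e) = (a, e)"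
  unfolding dir_of_def by (rule some_equality) (auto simp: axis_eq_iff)

text \<open>Each edge lies in exactly two tiles: if \<open>h\<close> is the height of its lower end,
  the tile on the side of \<open>+a\<close> exists iff \<open>h < weight b\<close>, and the one on
  the side of \<open>-b\<close> iff \<open>weight b \<le> h\<close>; likewise with \<open>a\<close>
  and \<open>b\<close> exchanged.\<close>

lemma square_difference:
  assumes "z \<in> strip" "z + axis c g \<in> strip" "g \<in> {1, - 1}" "a \<noteq> b" "b \<noteq> c" "a \<noteq> c"
  shows "of_bool (square z c g a 1) - of_bool (square z c g a (- 1)) =
    (of_bool (square z c g b 1) - of_bool (square z c g b (- 1)) :: 'k::field)"
proof -
  have w: "weight a + weight b + weight c = 3 + 2 * lam + lam^2"
    using weight_sum assms(4-6) by metis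
  note p = weight_pos[of a] weight_pos[of b] weight_pos[of c]
  define h where "h = ht z + (if g = 1 then 0 else - weight c)"
  have h: "0 \<le> h" "h + weight c < 3 + 2 * lam + lam^2"
    using assms(1-3) unfolding h_def strip_def by (auto simp: ht_add ht_axis)
  have sq: "square z c g x 1 \<longleftrightarrow> h + weight c + weight x < 3 + 2 * lam + lam^2"
    "square z c g x (- 1) \<longleftrightarrow> weight x \<le> h" if "x \<noteq> c" for x
    using assms(1-3) that h weight_pos[of x] p(3)
    unfolding square_def h_def strip_def by (auto simp: ht_add ht_axis)
  have "square z c g a 1 \<longleftrightarrow> \<not> square z c g b (- 1)" "square z c g b 1 \<longleftrightarrow> \<not> square z c g a (- 1)"
    using sq[of a] sq[of b] assms(5,6) w by auto
  then show ?thesis by simp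
qed

lemma no_cube:
  assumes "a \<noteq> b" "b \<noteq> c" "a \<noteq> c" "e \<in> {1, - 1}" "f \<in> {1, - 1}" "g \<in> {1, - 1}"
    and "\<And>e' f' g'. e' \<in> {0, e} \<Longrightarrow> f' \<in> {0, f} \<Longrightarrow> g' \<in> {0, g} \<Longrightarrow>
      p + axis a e' + axis b f' + axis c g' \<in> strip"
  shows False
proof -
  have w: "weight a + weight b + weight c = 3 + 2 * lam + lam^2"
    using weight_sum assms(1-3) by metis
  \<comment> \<open>Whatever the signs are, these select the lowest and the highest corner of the
    cube.\<close>
  define lo hi :: "int \<Rightarrow> int" where "lo x = (if x = 1 then 0 else x)" and "hi x = (if x = 1 then 1 else 0)" for x
  have "lo x \<in> {0, x}" "hi x \<in> {0, x}" "hi x = lo x + 1" if "x \<in> {1, - 1}" for x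
    using that by (auto simp: lo_def hi_def)
  note lh = this[OF assms(4)] this[OF assms(5)] this[OF assms(6)]
  have "p + axis a (lo e) + axis b (lo f) + axis c (lo g) \<in> strip"
    "p + axis a (hi e) + axis b (hi f) + axis c (hi g) \<in> strip"
    using assms(7) lh by blast+
  then show False using w unfolding strip_def lh(3,6,9) by (simp add: ht_add ht_axis algebra_simps)
qed

text \<open>Three unit steps add up to a unit step only if two of them cancel, and as
  \<open>a \<noteq> b\<close>, the first step belongs to the cancelling pair.\<close>

lemma three_steps:
  assumes "axis c g + axis a e + axis b f = axis d h" "a \<noteq> b" "e \<in> {1, - 1}" "f \<in> {1, - 1}" "g \<in> {1, - 1}"
    "h \<in> {1, - 1 :: int}"
  shows "c = a \<and> g = - e \<and> d = b \<and> h = f \<or> c = b \<and> g = - f \<and> d = a \<and> h = e"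
proof -
  have x: "(axis c g + axis a e + axis b f) $ x = axis d h $ x" for x using assms(1) by simp
  have "c = a \<or> c = b"
  proof (rule ccontr)
    assume "\<not> (c = a \<or> c = b)"
    then show False using x[of a] x[of b] x[of c] assms(2-5) by (auto simp: axis_def split: if_splits)
  qed
  then show ?thesis
  proof
    assume "c = a"
    then show ?thesis using x[of a] x[of b] assms(2-6) by (auto simp: axis_def split: if_splits)
  next
    assume "c = b"
    then show ?thesis using x[of a] x[of b] assms(2-6) by (auto simp: axis_def split: if_splits)
  qed
qed

text \<open>\<open>kfield\<close> fixes the field of values, which the other parameters do not
  mention.\<close>

locale rauzy_functional =
  fixes s :: "3 \<Rightarrow> point \<Rightarrow> int" and z :: "int^3" and kfield :: "'k::field itself"
  assumes sign: "sign_choice s" and z: "z \<in> strip"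
begin

definition sg :: "3 \<Rightarrow> 'k" where "sg a = of_int (s a (projZ z))"

lemma sg_cases: "sg a = 1 \<or> sg a = - 1"
proof -
  have "s a (projZ z) \<in> {1, - 1}" using sign z vertices_eq unfolding sign_choice_def by blast
  then show ?thesis unfolding sg_def by auto
qed

lemma sg_sq: "sg a * sg a = 1"
  using sg_cases[of a] by auto

text \<open>The sign of the third direction makes the star relations symmetric: for loops in
  directions \<open>a\<close> and \<open>b\<close> next to a fixed edge in direction
  \<open>c\<close>, both sides acquire the factor \<open>sg a * sg b\<close>, and
  \<open>square_difference\<close> equates what remains.\<close>

definition corner :: "3 \<Rightarrow> int \<Rightarrow> 3 \<Rightarrow> int \<Rightarrow> 'k" where
  "corner a e b f = of_bool (square z a e b f) * sg (THE k. k \<noteq> a \<and> k \<noteq> b)"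

lemma corner_sym: "corner a e b f = corner b f a e"
proof -
  have "square z a e b f \<longleftrightarrow> square z b f a e" using square_swap by blast
  then show ?thesis unfolding corner_def by (simp add: conj_commute)
qed

lemma corner_eq: "a \<noteq> b \<Longrightarrow> b \<noteq> c \<Longrightarrow> a \<noteq> c \<Longrightarrow> corner a e b f = of_bool (square z a e b f) * sg c"
proof -
  assume d: "a \<noteq> b" "b \<noteq> c" "a \<noteq> c"
  have "(THE k. k \<noteq> a \<and> k \<noteq> b) = c"
    by (rule the_equality) (use d third_unique[OF d] in auto)
  then show ?thesis by (simp add: corner_def)
qed

lemma corner_eq_0: "\<not> square z a e b f \<Longrightarrow> corner a e b f = 0"
  by (simp add: corner_def)

text \<open>Forced by the star relations at the two ends of the edge. By \<open>square_difference\<close>, the choice of the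
  transversal direction \<open>c + 1\<close> (modulo 3) is immaterial.\<close>

definition loop_val :: "3 \<Rightarrow> int \<Rightarrow> 'k" where
  "loop_val c g = of_int g * sg 1 * sg 2 * sg 3 *
     (of_bool (square z c g (c + 1) 1) - of_bool (square z c g (c + 1) (- 1)))"

text \<open>The value on the closed path \<open>z, z + u, z + t, z + v, z\<close>.\<close>

definition val :: "int^3 \<Rightarrow> int^3 \<Rightarrow> int^3 \<Rightarrow> 'k" where
  "val u t v = (case (dir_of u, dir_of v, dir_of (t - u)) of ((a, e), (b, f), (c, g)) \<Rightarrow>
     if t = 0 then if u = v then loop_val a e else corner a e b f
     else if v = u \<or> v = t - u then corner a e c g else 0)"

lemma val_loop: "e \<in> {1, - 1} \<Longrightarrow> val (axis a e) 0 (axis a e) = loop_val a e"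
  by (simp add: val_def split: prod.splits)

lemma val_back: "e \<in> {1, - 1} \<Longrightarrow> f \<in> {1, - 1} \<Longrightarrow> axis a e \<noteq> axis b f \<Longrightarrow>
    val (axis a e) 0 (axis b f) = corner a e b f"
  by (simp add: val_def split: prod.splits)

lemma val_far: "e \<in> {1, - 1} \<Longrightarrow> f \<in> {1, - 1} \<Longrightarrow> axis a e + axis b f \<noteq> 0 \<Longrightarrow>
   val (axis a e) (axis a e + axis b f) v = (if v = axis a e \<or> v = axis b f then corner a e b f else 0)"
  by (simp add: val_def split: prod.splits)

lemma sign_product:
  assumes "a \<noteq> b" "b \<noteq> c" "a \<noteq> c"
  shows "sg 1 * sg 2 * sg 3 = sg a * sg b * sg c"
  using assms exhaust_3[of a] exhaust_3[of b] exhaust_3[of c] by (elim disjE; simp)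

text \<open>With \<open>b\<close> the third direction, both sides are \<open>sg a * sg b\<close>
  times the difference of two square indicators; on the right, the squares of \<open>sg c\<close>
  and of the sign \<open>g\<close> drop out.\<close>

lemma loop_identity:
  assumes "z + axis c g \<in> strip" "g \<in> {1, - 1}" "a \<noteq> c"
  shows "sg a * (corner c g a 1 - corner c g a (- 1)) = sg c * (of_int g * loop_val c g)"
proof -
  have gg: "of_int g * of_int g = (1::'k)" using assms(2) by auto
  have c1: "c + 1 \<noteq> c" by simp
  obtain b where b: "b \<noteq> a" "b \<noteq> c" using ex_third assms(3) by metis
  have d: "of_bool (square z c g (c + 1) 1) - of_bool (square z c g (c + 1) (- 1)) =
     (of_bool (square z c g a 1) - of_bool (square z c g a (- 1)) :: 'k)"
  proof (cases "c + 1 = a")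
    case False
    then show ?thesis using square_difference[OF z assms(1,2), of "c + 1" a] assms(3) c1 by blast
  qed simp
  have cor: "corner c g a e = of_bool (square z c g a e) * sg b" for e
    using corner_eq[of c a b] assms(3) b by metis
  have pr: "sg 1 * sg 2 * sg 3 = sg a * sg b * sg c"
    using sign_product assms(3) b by metis
  define q :: 'k where "q = of_bool (square z c g a 1) - of_bool (square z c g a (- 1))"
  have "sg c * (of_int g * loop_val c g) = (of_int g * of_int g) * (sg c * sg c) * sg a * sg b * q"
    unfolding loop_val_def d q_def[symmetric] using pr by (simp add: algebra_simps)
  also have "\<dots> = sg a * (corner c g a 1 - corner c g a (- 1))"
    unfolding cor q_def gg sg_sq by (simp add: algebra_simps)
  finally show ?thesis by simp
qed

definition at_start :: "3 \<Rightarrow> int \<Rightarrow> int^3 \<Rightarrow> 'k" where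
  "at_start a e v = (if z + axis a e \<in> strip then val (axis a e) 0 v else 0)"

text \<open>The right-hand side is independent of \<open>a\<close>, and this is the star relation at
  \<open>z\<close> in front of a loop along the edge \<open>(c, g)\<close>. For \<open>a = c\<close>
  only the loop along this same edge counts, because opposite steps span no square.\<close>

lemma start_star:
  assumes "z + axis c g \<in> strip" "g \<in> {1, - 1}"
  shows "sg a * (at_start a 1 (axis c g) - at_start a (- 1) (axis c g)) = sg c * (of_int g * loop_val c g)"
proof (cases "a = c")
  case True
  have ng: "- g \<in> {1, - 1}" "axis c (- g) \<noteq> axis c g" using assms(2) by (auto simp: axis_eq_iff)
  have "at_start c (- g) (axis c g) = 0"
    using val_back[OF ng(1) assms(2) ng(2)] by (simp add: at_start_def corner_eq_0 square_def)
  moreover have "at_start c g (axis c g) = loop_val c g"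
    using assms by (simp add: at_start_def val_loop)
  ultimately show ?thesis using assms(2) True by auto
next
  case False
  have "at_start a e (axis c g) = corner c g a e" if "e \<in> {1, - 1}" for e
    using that assms False
    by (auto simp: at_start_def val_back axis_eq_iff corner_sym[of a] corner_eq_0 square_def)
  then show ?thesis using loop_identity[OF assms False] by simp
qed

definition at_middle :: "3 \<Rightarrow> int \<Rightarrow> int^3 \<Rightarrow> 'k" where
  "at_middle a e u = (if z + u + axis a e \<in> strip then val u (u + axis a e) u else 0)"

text \<open>The star relation at the far end of the edge. The sign of direction \<open>c\<close> is
  reversed there, but so is the direction in which the loop back to \<open>z\<close> counts, so the
  value of \<open>start_star\<close> reappears.\<close>

lemma middle_star:
  assumes "z + axis c g \<in> strip" "g \<in> {1, - 1}"
  shows "of_int (s a (projZ (z + axis c g))) * (at_middle a 1 (axis c g) - at_middle a (- 1) (axis c g))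
     = sg c * (of_int g * loop_val c g)"
proof (cases "a = c")
  case True
  have g: "axis c g + axis c g \<noteq> 0" using assms(2) by (auto simp: axis_add axis_eq_0_iff)
  have "at_middle c g (axis c g) = 0"
    using val_far[OF assms(2,2) g] by (simp add: at_middle_def corner_eq_0 square_def)
  moreover have "axis c g + axis c (- g) = 0" by (simp add: axis_add)
  then have "at_middle c (- g) (axis c g) = loop_val c g"
    using assms z by (simp add: at_middle_def val_loop add.assoc)
  moreover have "of_int (s c (projZ (z + axis c g))) = - sg c"
    using sign_choice_lift(1)[OF sign z assms] by (simp add: sg_def)
  ultimately show ?thesis using assms(2) True by auto
next
  case False
  have "at_middle a e (axis c g) = corner c g a e" if e: "e \<in> {1, - 1}" for e
  proof -
    have "axis c g + axis a e \<noteq> 0" using False e by (intro axis_add_nonzero) auto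
    then show ?thesis using e assms by (auto simp: at_middle_def val_far corner_eq_0 square_def)
  qed
  moreover have "of_int (s a (projZ (z + axis c g))) = sg a"
    using sign_choice_lift(2)[OF sign z assms False] by (simp add: sg_def)
  ultimately show ?thesis using loop_identity[OF assms False] by simp
qed

lemma start_zero:
  assumes "e \<in> {1, - 1}" "f \<in> {1, - 1}" "axis a e + axis b f \<noteq> 0" "\<not> square z a e b f"
  shows "val (axis a e) (axis a e + axis b f) v = 0"
  using assms by (simp add: val_far corner_eq_0)

lemma start_square:
  assumes "square z a e b f"
  shows "val (axis a e) (axis a e + axis b f) v = val (axis b f) (axis a e + axis b f) v"
proof -
  have ab: "a \<noteq> b" and ef: "e \<in> {1, - 1}" "f \<in> {1, - 1}" using assms unfolding square_def by blast+
  have ne: "axis a e + axis b f \<noteq> 0" using ab ef by (intro axis_add_nonzero) auto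
  then have ne': "axis b f + axis a e \<noteq> 0" by (simp add: add.commute)
  show ?thesis
    using val_far[OF ef ne, of v] val_far[OF ef(2,1) ne', of v] corner_sym[of a e b f]
    by (auto simp: add.commute)
qed

text \<open>A path of nonzero value stays on one edge or one square at \<open>z\<close>, so its
  middle turn is a return or a turn inside that square. The assumptions \<open>ne\<close> and
  \<open>n\<close> exclude both.\<close>

lemma middle_zero:
  assumes ef: "e \<in> {1, - 1}" "f \<in> {1, - 1}" and ne: "axis a e + axis b f \<noteq> 0"
    and g: "g \<in> {1, - 1}" "z + axis c g \<in> strip" and h: "h \<in> {1, - 1}"
    and v: "axis d h = axis c g + axis a e + axis b f"
    and n: "\<not> (a \<noteq> b \<and> z + axis c g + axis b f \<in> strip)"
  shows "val (axis c g) (axis c g + axis a e) (axis d h) = 0"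
proof (cases "axis c g + axis a e = 0")
  case True
  have "axis d h \<noteq> axis c g"
  proof
    assume "axis d h = axis c g"
    then show False using v ne by (simp add: add.assoc)
  qed
  moreover have "axis d h = axis b f" using v True by simp
  then have dh: "d = b" "h = f" using h axis_eq_iff[of h d b f] by auto
  have "axis c g = axis a (- e)" using True axis_neg[of a e] by (metis eq_neg_iff_add_eq_0)
  then have "c = a" "g = - e" using g axis_eq_iff[of g c a "- e"] by auto
  then have "\<not> square z c g d h" using n dh by (auto simp: square_def)
  ultimately show ?thesis using True val_back[OF g(1) h, of c d] corner_eq_0 by simp
next
  case False
  have "corner c g a e = 0" if "axis d h = axis c g \<or> axis d h = axis a e"
    using that
  proof
    assume "axis d h = axis c g"
    then show ?thesis using v ne by (simp add: add.assoc)
  next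
    assume "axis d h = axis a e"
    then have "axis c g + axis b f = 0" using v by (simp add: algebra_simps)
    then have b: "z + axis c g + axis b f \<in> strip" "axis c g = axis b (- f)"
      using z axis_neg[of b f] eq_neg_iff_add_eq_0[of "axis c g" "axis b f"] by (simp_all add: add.assoc)
    then have "c = b" using g axis_eq_iff[of g c b "- f"] by auto
    then show ?thesis using b n by (intro corner_eq_0) (auto simp: square_def)
  qed
  then show ?thesis using val_far[OF g(1) ef(1) False] by simp
qed

text \<open>By \<open>three_steps\<close> one of the two middle vertices is \<open>z\<close> itself
  and the other is opposite to it, so a value from \<open>val_back\<close> is compared with one from
  \<open>val_far\<close>; both are the same corner value.\<close>

lemma middle_square:
  assumes sq: "square (z + axis c g) a e b f" and g: "g \<in> {1, - 1}" and h: "h \<in> {1, - 1}"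
    and v: "axis d h = axis c g + axis a e + axis b f"
  shows "val (axis c g) (axis c g + axis a e) (axis d h) = val (axis c g) (axis c g + axis b f) (axis d h)"
proof -
  have main: "val (axis c g) (axis c g + axis a e) (axis d h) = val (axis c g) (axis c g + axis b f) (axis d h)"
    if sq: "square (z + axis c g) a e b f" and "c = a" "g = - e" "d = b" "h = f" for a e b f
  proof -
    have ab: "a \<noteq> b" and ef: "e \<in> {1, - 1}" "f \<in> {1, - 1}" "- e \<in> {1, - 1}"
      using sq unfolding square_def by auto
    have "axis a (- e) + axis a e = 0" by (simp add: axis_add)
    moreover have ne: "axis a (- e) + axis b f \<noteq> 0"
      using ab ef by (intro axis_add_nonzero) auto
    moreover have "axis a (- e) \<noteq> axis b f" using ab ef by (auto simp: axis_eq_iff)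
    ultimately show ?thesis
      using that val_back[OF ef(3,2), of a b] val_far[OF ef(3,2) ne] by simp
  qed
  have ab: "a \<noteq> b" and ef: "e \<in> {1, - 1}" "f \<in> {1, - 1}" using sq unfolding square_def by blast+
  from three_steps[OF v[symmetric] ab ef g h] show ?thesis
    using main[OF sq] main[OF square_swap[OF sq]] by metis
qed

text \<open>Invariance under reversal reduces the relations at the end of a closed path to those at
  its start.\<close>

lemma val_sym:
  assumes "e \<in> {1, - 1}" "f \<in> {1, - 1}" "e' \<in> {1, - 1}" "f' \<in> {1, - 1}"
    "axis a e + axis b f = axis a' e' + axis b' f'"
  shows "val (axis a e) (axis a e + axis b f) (axis a' e') = val (axis a' e') (axis a e + axis b f) (axis a e)"
proof (cases "axis a e + axis b f = 0")
  case True
  show ?thesis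
    using val_back[OF assms(1,3), of a a'] val_back[OF assms(3,1), of a' a] corner_sym[of a e]
    unfolding True by (cases "axis a e = axis a' e'") auto
next
  case False
  have 1: "val (axis a e) (axis a e + axis b f) (axis a' e') =
     (if axis a' e' = axis a e \<or> axis a' e' = axis b f then corner a e b f else 0)"
    by (rule val_far[OF assms(1,2) False])
  have 2: "val (axis a' e') (axis a e + axis b f) (axis a e) =
     (if axis a e = axis a' e' \<or> axis a e = axis b' f' then corner a' e' b' f' else 0)"
    unfolding assms(5) by (rule val_far[OF assms(3,4)]) (use False assms(5) in simp)
  have nz: "e \<noteq> 0" "f \<noteq> 0" "e' \<noteq> 0" "f' \<noteq> 0" using assms(1-4) by auto
  consider "axis a' e' = axis a e" | "axis a' e' \<noteq> axis a e" "axis a' e' = axis b f"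
    | "axis a' e' \<noteq> axis a e" "axis a' e' \<noteq> axis b f" by blast
  then show ?thesis
  proof cases
    case 1
    then show ?thesis by simp
  next
    case 2
    then have "axis a e = axis b' f'" using assms(5) by (simp add: algebra_simps)
    then have "a' = b" "e' = f" "a = b'" "e = f'" using 2 nz axis_eq_iff by metis+
    then show ?thesis using 1 \<open>val (axis a' e') _ (axis a e) = _\<close> corner_sym[of a e] by simp
  next
    case 3
    then have "axis a e \<noteq> axis b' f'" using assms(5) by (auto simp: algebra_simps)
    then show ?thesis using 1 \<open>val (axis a' e') _ (axis a e) = _\<close> 3 by auto
  qed
qed

end

section \<open>Rauzy relations inside longer paths\<close>

lemma pe_shift: "projZ p + pe a = projZ (p + axis a 1)" "projZ p - pe a = projZ (p + axis a (- 1))"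
  by (simp_all add: projZ_add projZ_axis projZ_axis_neg)

lemma arrow_pe_iff:
  assumes "p \<in> strip"
  shows "arrow (projZ p) (projZ (p + axis a 1)) \<longleftrightarrow> p + axis a 1 \<in> strip"
    "arrow (projZ p) (projZ (p + axis a (- 1))) \<longleftrightarrow> p + axis a (- 1) \<in> strip"
  using arrow_pe[OF assms, of 1 a] arrow_pe[OF assms, of "- 1" a]
  by (simp_all add: projZ_add projZ_axis projZ_axis_neg)

lemma path_length_two: "[x, y, w] \<in> paths \<longleftrightarrow> arrow x y \<and> arrow y w"
  using arrow_vertices by (auto simp: paths_def)

lemma paths_Cons: "x # y # u \<in> paths \<longleftrightarrow> arrow x y \<and> y # u \<in> paths"
  using arrow_vertices by (auto simp: paths_def)

lemma paths_single: "[x] \<in> paths \<longleftrightarrow> x \<in> vertices"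
  by (auto simp: paths_def)

lemma rhombus_arrows: "rhombus z x y x' \<Longrightarrow> arrow z x \<and> arrow x y \<and> arrow z x' \<and> arrow x' y"
  unfolding rhombus_def arrow_def edges_def by (auto simp: insert_commute)

lemma relations_combs: "rauzy_relations s \<subseteq> (combs :: 'k::field comb set)"
proof -
  have l: "(loop z x :: 'k comb) \<in> combs" for z x
    using path_length_two[of z x z] arrow_sym[of x z] by (simp add: loop_def)
  have "(D a z :: 'k comb) \<in> combs" for a z by (simp add: D_def l)
  moreover have "(pth [x, y, w] :: 'k comb) \<in> combs" if "arrow x y" "arrow y w" for x y w
    using that path_length_two by simp
  ultimately show ?thesis
    unfolding rauzy_relations_def
    by (auto dest!: rhombus_arrows simp: arrow_def[symmetric])
qed

lemma two_sided_rauzy_ideal: "two_sided_ideal (rauzy_ideal s) path_algebra"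
  unfolding rauzy_ideal_def by (rule two_sided_ideal_generated[OF relations_combs])

lemma path_mult_between: "path_mult (path_mult (pth (xs @ [x'])) (pth [x, y, w])) (pth (w' # ys)) =
   (if x' = x \<and> w' = w then pth (xs @ [x, y, w] @ ys) else 0)"
  by (simp add: pth_mult)

text \<open>A function on paths descends to the quotient when it respects each relation inside every path.\<close>

lemma functional_rauzy_ideal:
  fixes \<phi> :: "point list \<Rightarrow> 'k::field"
  assumes straight: "\<And>xs x y w ys. xs @ [x] \<in> paths \<Longrightarrow> w # ys \<in> paths \<Longrightarrow> arrow x y \<Longrightarrow> arrow y w \<Longrightarrow>
      x \<noteq> w \<Longrightarrow> \<not> (\<exists>t\<in>rauzy_tiling. {x, y} \<in> sides t \<and> {y, w} \<in> sides t) \<Longrightarrow> \<phi> (xs @ [x, y, w] @ ys) = 0"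
    and rhomb: "\<And>xs x y w y' ys. xs @ [x] \<in> paths \<Longrightarrow> w # ys \<in> paths \<Longrightarrow> rhombus x y w y' \<Longrightarrow>
      \<phi> (xs @ [x, y, w] @ ys) = \<phi> (xs @ [x, y', w] @ ys)"
    and star: "\<And>xs x ys a b. xs @ [x] \<in> paths \<Longrightarrow> x # ys \<in> paths \<Longrightarrow>
      of_int (s a x) * ((if arrow x (x + pe a) then \<phi> (xs @ [x, x + pe a, x] @ ys) else 0) -
        (if arrow x (x - pe a) then \<phi> (xs @ [x, x - pe a, x] @ ys) else 0)) =
      of_int (s b x) * ((if arrow x (x + pe b) then \<phi> (xs @ [x, x + pe b, x] @ ys) else 0) -
        (if arrow x (x - pe b) then \<phi> (xs @ [x, x - pe b, x] @ ys) else 0))"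
    and f: "f \<in> rauzy_ideal s" "a \<in> combs" "b \<in> combs"
  shows "functional \<phi> (path_mult (path_mult a f) b) = 0"
proof (rule functional_ideal[OF relations_combs _ f[unfolded rauzy_ideal_def]])
  fix r :: "'k comb" and u v assume r: "r \<in> rauzy_relations s" and u: "u \<in> paths" and v: "v \<in> paths"
  obtain xs x' where u': "u = xs @ [x']" using paths_nonempty[OF u] by (metis rev_exhaust)
  obtain w' ys where v': "v = w' # ys" using paths_nonempty[OF v] by (metis list.exhaust)
  define F where "F r = functional \<phi> (path_mult (path_mult (pth u) r) (pth v))" for r
  have F: "F (pth [x, y, w]) = (if x' = x \<and> w' = w then \<phi> (xs @ [x, y, w] @ ys) else 0)" for x y w
    unfolding F_def u' v' path_mult_between by simp
  have Fd: "F (f - g) = F f - F g" "F (scale c f) = c * F f" "F 0 = 0" for f g c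
    by (simp_all add: F_def path_mult_diff functional_diff path_mult_scale functional_scale)
  have Fl: "F (loop z y) = (if x' = z \<and> w' = z then if arrow z y then \<phi> (xs @ [z, y, z] @ ys) else 0 else 0)" for z y
    by (simp add: loop_def F Fd)
  from r show "functional \<phi> (path_mult (path_mult (pth u) r) (pth v)) = 0"
    unfolding rauzy_relations_def F_def[symmetric]
  proof (elim UnE CollectE exE conjE)
    fix x y w assume "r = pth [x, y, w]" "{x, y} \<in> edges" "{y, w} \<in> edges" "{x, y} \<noteq> {y, w}"
      "\<not> (\<exists>t\<in>rauzy_tiling. {x, y} \<in> sides t \<and> {y, w} \<in> sides t)"
    then show "F r = 0"
      using straight[of xs x w ys y] u v unfolding u' v' by (auto simp: F arrow_def insert_commute)
  next
    fix z x y x2 assume "r = pth [z, x, y] - pth [z, x2, y]" "rhombus z x y x2"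
    then show "F r = 0" using rhomb[of xs z y ys x x2] u v unfolding u' v' by (auto simp: F Fd)
  next
    fix a b z assume "r = scale (of_int (s a z)) (D a z) - scale (of_int (s b z)) (D b z)"
    then show "F r = 0" using star[of xs z ys a b] u v unfolding u' v' by (auto simp: D_def Fd Fl)
  qed
qed

lemma path_mult_trivial_left: "f \<in> combs \<Longrightarrow> pcoeff (path_mult (pth [x]) f) u = (if hd u = x then pcoeff f u else 0)"
proof (induction f rule: combs_induct)
  case (single v a)
  then show ?case using paths_nonempty[OF single]
    by (cases v) (auto simp: pth_def path_mult_single lookup_single when_def)
qed (auto simp: path_mult_add_right lookup_add)

lemma path_mult_trivial_right: "f \<in> combs \<Longrightarrow> pcoeff (path_mult f (pth [x])) u = (if last u = x then pcoeff f u else 0)"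
proof (induction f rule: combs_induct)
  case (single v a)
  then show ?case by (auto simp: pth_def path_mult_single lookup_single when_def)
qed (auto simp: path_mult_add_left lookup_add)

lemma rauzy_ideal_combs: "f \<in> rauzy_ideal s \<Longrightarrow> f \<in> combs"
  using I_closed(1)[OF two_sided_rauzy_ideal] by blast

text \<open>A relation inside a longer path involves only lists of at least three vertices, so the
  coefficient at a shorter list is a functional that vanishes on the ideal. The trivial paths at the
  two ends stand in for a unit.\<close>

lemma rauzy_ideal_short:
  fixes f :: "'k::field comb"
  assumes "f \<in> rauzy_ideal s" "length u \<le> 2"
  shows "pcoeff f u = 0"
proof (cases "u \<in> paths")
  case False
  then show ?thesis using rauzy_ideal_combs[OF assms(1)] by (simp add: combs_iff)
next
  case True
  have e: "(pth [hd u] :: 'k comb) \<in> combs" "(pth [last u] :: 'k comb) \<in> combs"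
    using True paths_nonempty[OF True] by (auto simp: paths_single paths_def subset_iff)
  have "functional (\<lambda>v. if v = u then 1 else 0)
      (path_mult (path_mult (pth [hd u]) f) (pth [last u])) = 0"
    by (rule functional_rauzy_ideal[OF _ _ _ assms(1) e]) (use assms(2) in auto)
  then show ?thesis
    using rauzy_ideal_combs[OF assms(1)] e
    by (simp add: functional_coeff path_mult_trivial_left path_mult_trivial_right)
qed

section \<open>The functional on paths in the plane\<close>

context rauzy_functional
begin

definition lift :: "point \<Rightarrow> int^3" where "lift = inv_into strip projZ"

lemma lift [simp]: "p \<in> strip \<Longrightarrow> lift (projZ p) = p"
  by (simp add: lift_def inj_on_projZ)

abbreviation "Z \<equiv> projZ z"

definition pval :: "point \<Rightarrow> point \<Rightarrow> point \<Rightarrow> 'k" where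
  "pval x y w = val (lift x - z) (lift y - z) (lift w - z)"

text \<open>Five vertices make a path of length four.\<close>

definition phi :: "point list \<Rightarrow> 'k" where
  "phi u = (if length u = 5 \<and> hd u = Z \<and> last u = Z then pval (u ! 1) (u ! 2) (u ! 3) else 0)"

lemma phi_simps:
  "phi [a, b, c, d, e] = (if a = Z \<and> e = Z then pval b c d else 0)"
  by (simp add: phi_def numeral_eq_Suc)

text \<open>A relation of length two leaves room for two more vertices of a closed path of length
  four: both after it, one on each side, or both before it.\<close>

lemma phi_context:
  obtains (start) v l where "xs = []" "ys = [v, l]"
  | (middle) f l where "xs = [f]" "ys = [l]"
  | (final) f u where "xs = [f, u]" "ys = []"
  | (zero) "\<And>x y w. phi (xs @ [x, y, w] @ ys) = 0"
proof (cases "length xs + length ys = 2")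
  case True
  then consider "length xs = 0" "length ys = Suc (Suc 0)" | "length xs = Suc 0" "length ys = Suc 0"
    | "length xs = Suc (Suc 0)" "length ys = 0"
    by linarith
  then show thesis by cases (auto simp: length_Suc_conv intro: start middle final)
next
  case False
  then show thesis by (intro zero) (auto simp: phi_def)
qed

lemma closed_path_lift:
  assumes "arrow Z u" "arrow u x" "arrow x y" "arrow y Z"
  obtains a e b f a' e' b' f' where "e \<in> {1, - 1}" "f \<in> {1, - 1}" "e' \<in> {1, - 1}" "f' \<in> {1, - 1}"
    "z + axis a e \<in> strip" "z + axis a' e' \<in> strip" "z + axis a e + axis b f \<in> strip"
    "u = projZ (z + axis a e)" "y = projZ (z + axis a' e')" "x = projZ (z + axis a e + axis b f)"
    "axis a e + axis b f = axis a' e' + axis b' f'"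
proof -
  obtain a e where 1: "e \<in> {1, - 1}" "z + axis a e \<in> strip" "u = projZ (z + axis a e)"
    using arrow_lift[OF z assms(1)] .
  obtain b f where 2: "f \<in> {1, - 1}" "z + axis a e + axis b f \<in> strip" "x = projZ (z + axis a e + axis b f)"
    using arrow_lift[OF 1(2)] assms(2) unfolding 1(3) .
  obtain a' e' where 3: "e' \<in> {1, - 1}" "z + axis a' e' \<in> strip" "y = projZ (z + axis a' e')"
    using arrow_lift[OF z] assms(4) arrow_sym by metis
  obtain b' f' where 4: "f' \<in> {1, - 1}" "z + axis a' e' + axis b' f' \<in> strip"
    "x = projZ (z + axis a' e' + axis b' f')"
    using arrow_lift[OF 3(2)] assms(3) arrow_sym unfolding 3(3) by metis
  have "axis a e + axis b f = axis a' e' + axis b' f'"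
    using 2(2,3) 4(2,3) by (simp add: add.assoc)
  then show thesis using that 1 2 3 4 by metis
qed

lemma pval_sym: "arrow Z u \<Longrightarrow> arrow u x \<Longrightarrow> arrow x y \<Longrightarrow> arrow y Z \<Longrightarrow> pval u x y = pval y x u"
proof (elim closed_path_lift)
  fix a e b f a' e' b' f'
  assume 1: "e \<in> {1, - 1}" "f \<in> {1, - 1}" "e' \<in> {1, - 1}" "f' \<in> {1, - 1}"
    and 2: "z + axis a e \<in> strip" "z + axis a' e' \<in> strip" "z + axis a e + axis b f \<in> strip"
    and 3: "u = projZ (z + axis a e)" "y = projZ (z + axis a' e')" "x = projZ (z + axis a e + axis b f)"
    and 4: "axis a e + axis b f = axis a' e' + axis b' f'"
  have "lift u - z = axis a e" "lift y - z = axis a' e'" "lift x - z = axis a e + axis b f"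
    using 2 unfolding 3 by (simp_all add: add.assoc)
  then show "pval u x y = pval y x u" using val_sym[OF 1 4] unfolding pval_def by simp
qed

lemma pval_straight_start:
  assumes "arrow Z y" "arrow y w" "Z \<noteq> w"
    and n: "\<not> (\<exists>t\<in>rauzy_tiling. {Z, y} \<in> sides t \<and> {y, w} \<in> sides t)"
  shows "pval y w v = 0"
proof -
  obtain a e where 1: "e \<in> {1, - 1}" "z + axis a e \<in> strip" "y = projZ (z + axis a e)"
    using arrow_lift[OF z assms(1)] .
  obtain b f where 2: "f \<in> {1, - 1}" "z + axis a e + axis b f \<in> strip" "w = projZ (z + axis a e + axis b f)"
    using arrow_lift[OF 1(2)] assms(2) unfolding 1(3) .
  have ne: "axis a e + axis b f \<noteq> 0" using assms(3) 2(3) by (auto simp: add.assoc)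
  have "\<not> square z a e b f"
    using common_tile_iff[OF z 1(2) 2(2) 1(1) 2(1) ne] n 1(3) 2(3) unfolding square_def by blast
  then show ?thesis
    using start_zero[OF 1(1) 2(1) ne] 1 2 by (simp add: pval_def add.assoc)
qed

lemma pval_straight_middle:
  assumes "arrow Z x" "arrow w Z" "arrow x y" "arrow y w" "x \<noteq> w"
    and n: "\<not> (\<exists>t\<in>rauzy_tiling. {x, y} \<in> sides t \<and> {y, w} \<in> sides t)"
  shows "pval x y w = 0"
proof -
  obtain c g where 1: "g \<in> {1, - 1}" "z + axis c g \<in> strip" "x = projZ (z + axis c g)"
    using arrow_lift[OF z assms(1)] .
  obtain a e where 2: "e \<in> {1, - 1}" "z + axis c g + axis a e \<in> strip" "y = projZ (z + axis c g + axis a e)"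
    using arrow_lift[OF 1(2)] assms(3) unfolding 1(3) .
  obtain b f where 3: "f \<in> {1, - 1}" "z + axis c g + axis a e + axis b f \<in> strip"
      "w = projZ (z + axis c g + axis a e + axis b f)"
    using arrow_lift[OF 2(2)] assms(4) unfolding 2(3) .
  obtain d h where 4: "h \<in> {1, - 1}" "z + axis d h \<in> strip" "w = projZ (z + axis d h)"
    using arrow_lift[OF z] assms(2) arrow_sym by metis
  have v: "axis d h = axis c g + axis a e + axis b f" using 3(2,3) 4(2,3) by (simp add: add.assoc)
  have ne: "axis a e + axis b f \<noteq> 0" using assms(5) 1(3) 3(3) by (auto simp: add.assoc)
  have "\<not> (a \<noteq> b \<and> z + axis c g + axis b f \<in> strip)"
    using common_tile_iff[OF 1(2) 2(2) 3(2) 2(1) 3(1) ne] n 1(3) 2(3) 3(3) by blast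
  from middle_zero[OF 2(1) 3(1) ne 1(1,2) 4(1) v this]
  show ?thesis using 1 2 4 by (simp add: pval_def add.assoc)
qed

lemma pval_rhombus_start:
  assumes "rhombus Z y w y'"
  shows "pval y w v = pval y' w v"
proof -
  obtain p a e b f where sq: "square p a e b f" "Z = projZ p" "y = projZ (p + axis a e)"
    "w = projZ (p + axis a e + axis b f)" "y' = projZ (p + axis b f)"
    using assms unfolding rhombus_iff_lattice lattice_rhombus_def by blast
  have p: "p = z" using sq(1,2) z unfolding square_def by simp
  have "lift y - z = axis a e" "lift w - z = axis a e + axis b f" "lift y' - z = axis b f"
    using sq(1) unfolding sq(3-5) p square_def by (simp_all add: add.assoc)
  then show ?thesis using start_square sq(1) unfolding pval_def p by simp
qed

lemma pval_rhombus_middle: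
  assumes "arrow Z x" "arrow w Z" "rhombus x y w y'"
  shows "pval x y w = pval x y' w"
proof -
  obtain p a e b f where sq: "square p a e b f" "x = projZ p" "y = projZ (p + axis a e)"
    "w = projZ (p + axis a e + axis b f)" "y' = projZ (p + axis b f)"
    using assms(3) unfolding rhombus_iff_lattice lattice_rhombus_def by blast
  obtain c g where 1: "g \<in> {1, - 1}" "z + axis c g \<in> strip" "x = projZ (z + axis c g)"
    using arrow_lift[OF z assms(1)] .
  have p: "p = z + axis c g" using sq(1,2) 1 unfolding square_def by simp
  obtain d h where 4: "h \<in> {1, - 1}" "z + axis d h \<in> strip" "w = projZ (z + axis d h)"
    using arrow_lift[OF z] assms(2) arrow_sym by metis
  have st: "z + axis c g + axis a e \<in> strip" "z + axis c g + axis b f \<in> strip"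
    "z + axis c g + axis a e + axis b f \<in> strip" using sq(1) unfolding square_def p by blast+
  have v: "axis d h = axis c g + axis a e + axis b f"
    using sq(4) st 4 unfolding p by (simp add: add.assoc)
  have "lift x - z = axis c g" "lift y - z = axis c g + axis a e" "lift w - z = axis d h"
     "lift y' - z = axis c g + axis b f"
    using st 1 4 unfolding sq(3,5) p by (simp_all add: add.assoc)
  then show ?thesis using middle_square[OF sq(1)[unfolded p] 1(1) 4(1) v] unfolding pval_def by simp
qed

lemma pval_star_start:
  assumes "arrow Z v"
  shows "of_int (s a Z) * ((if arrow Z (Z + pe a) then pval (Z + pe a) Z v else 0) -
        (if arrow Z (Z - pe a) then pval (Z - pe a) Z v else 0)) =
      of_int (s b Z) * ((if arrow Z (Z + pe b) then pval (Z + pe b) Z v else 0) -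
        (if arrow Z (Z - pe b) then pval (Z - pe b) Z v else 0))"
proof -
  obtain c g where 1: "g \<in> {1, - 1}" "z + axis c g \<in> strip" "v = projZ (z + axis c g)"
    using arrow_lift[OF z assms(1)] .
  have "(if arrow Z (Z + pe a) then pval (Z + pe a) Z v else 0) = at_start a 1 (axis c g)"
    "(if arrow Z (Z - pe a) then pval (Z - pe a) Z v else 0) = at_start a (- 1) (axis c g)" for a
    using z 1(2) by (simp_all add: pe_shift arrow_pe_iff at_start_def pval_def 1(3))
  then show ?thesis using start_star[OF 1(2,1), of a] start_star[OF 1(2,1), of b] by (simp add: sg_def)
qed

lemma pval_star_middle:
  assumes "arrow Z x"
  shows "of_int (s a x) * ((if arrow x (x + pe a) then pval x (x + pe a) x else 0) -
        (if arrow x (x - pe a) then pval x (x - pe a) x else 0)) =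
      of_int (s b x) * ((if arrow x (x + pe b) then pval x (x + pe b) x else 0) -
        (if arrow x (x - pe b) then pval x (x - pe b) x else 0))"
proof -
  obtain c g where 1: "g \<in> {1, - 1}" "z + axis c g \<in> strip" "x = projZ (z + axis c g)"
    using arrow_lift[OF z assms(1)] .
  have "(if arrow x (x + pe a) then pval x (x + pe a) x else 0) = at_middle a 1 (axis c g)"
    "(if arrow x (x - pe a) then pval x (x - pe a) x else 0) = at_middle a (- 1) (axis c g)" for a
    unfolding pe_shift 1(3) arrow_pe_iff[OF 1(2)] at_middle_def pval_def
    using 1(2) by (auto simp: add.assoc)
  then show ?thesis using middle_star[OF 1(2,1), of a] middle_star[OF 1(2,1), of b] by (simp add: 1(3))
qed

lemma phi_rauzy_ideal:
  assumes "f \<in> rauzy_ideal s" "a \<in> combs" "b \<in> combs"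
  shows "functional phi (path_mult (path_mult a f) b) = 0"
proof (rule functional_rauzy_ideal[OF _ _ _ assms])
  fix xs x y w ys
  assume p: "xs @ [x] \<in> paths" "w # ys \<in> paths" and a: "arrow x y" "arrow y w" "x \<noteq> w"
    and n: "\<not> (\<exists>t\<in>rauzy_tiling. {x, y} \<in> sides t \<and> {y, w} \<in> sides t)"
  show "phi (xs @ [x, y, w] @ ys) = 0"
  proof (cases rule: phi_context[of xs ys])
    case (start v l)
    then show ?thesis using pval_straight_start[of y w v] a n by (auto simp: phi_simps)
  next
    case (middle f l)
    then show ?thesis using pval_straight_middle[of x w y] a n p by (auto simp: phi_simps paths_Cons)
  next
    case (final f u)
    show ?thesis
    proof (cases "f = Z \<and> w = Z")
      case True
      have ar: "arrow Z u" "arrow u x" "arrow Z y" "arrow y x" "arrow y Z"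
        using p a True final arrow_sym by (auto simp: paths_Cons)
      \<comment> \<open>Read backwards, the closed path has the straight turn at its start.\<close>
      have "pval u x y = pval y x u" using pval_sym ar a by blast
      also have "\<dots> = 0"
        using pval_straight_start[OF ar(3,4), of u] True a(3) n by (auto simp: insert_commute)
      finally show ?thesis using final by (simp add: phi_simps)
    qed (use final in \<open>auto simp: phi_simps\<close>)
  next
    case zero
    then show ?thesis by blast
  qed
next
  fix xs x y w y' ys
  assume p: "xs @ [x] \<in> paths" "w # ys \<in> paths" and r: "rhombus x y w y'"
  show "phi (xs @ [x, y, w] @ ys) = phi (xs @ [x, y', w] @ ys)"
  proof (cases rule: phi_context[of xs ys])
    case (start v l)
    then show ?thesis using pval_rhombus_start[of y w y' v] r by (auto simp: phi_simps)
  next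
    case (middle f l)
    then show ?thesis using pval_rhombus_middle[of x w y y'] r p by (auto simp: phi_simps paths_Cons)
  next
    case (final f u)
    show ?thesis
    proof (cases "f = Z \<and> w = Z")
      case True
      have ar: "arrow Z u" "arrow u x" "arrow x y" "arrow y Z" "arrow x y'" "arrow y' Z"
        using p True final rhombus_arrows[OF r] by (auto simp: paths_Cons)
      have "rhombus Z y x y'" using rhombus_flip[OF rhombus_swap[OF rhombus_flip[OF r]]] True by simp
      then have "pval u x y = pval u x y'"
        using pval_rhombus_start[of y x y' u] pval_sym ar by metis
      then show ?thesis using final by (simp add: phi_simps)
    qed (use final in \<open>auto simp: phi_simps\<close>)
  next
    case zero
    then show ?thesis by simp
  qed
next
  fix xs x ys a b
  assume p: "xs @ [x] \<in> paths" "x # ys \<in> paths"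
  show "of_int (s a x) * ((if arrow x (x + pe a) then phi (xs @ [x, x + pe a, x] @ ys) else 0) -
        (if arrow x (x - pe a) then phi (xs @ [x, x - pe a, x] @ ys) else 0)) =
      of_int (s b x) * ((if arrow x (x + pe b) then phi (xs @ [x, x + pe b, x] @ ys) else 0) -
        (if arrow x (x - pe b) then phi (xs @ [x, x - pe b, x] @ ys) else 0))"
  proof (cases rule: phi_context[of xs ys])
    case (start v l)
    show ?thesis
    proof (cases "x = Z \<and> l = Z")
      case True
      then have "arrow Z v" using p start by (simp add: paths_Cons)
      then show ?thesis using pval_star_start[of v a b] start True
        by (simp add: phi_simps split del: if_split cong: if_cong)
    qed (use start in \<open>auto simp: phi_simps\<close>)
  next
    case (middle f l)
    show ?thesis
    proof (cases "f = Z \<and> l = Z")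
      case True
      then have "arrow Z x" using p middle by (simp add: paths_Cons)
      then show ?thesis using pval_star_middle[of x a b] middle True
        by (simp add: phi_simps split del: if_split cong: if_cong)
    qed (use middle in \<open>auto simp: phi_simps\<close>)
  next
    case (final f u)
    show ?thesis
    proof (cases "f = Z \<and> x = Z")
      case True
      then have u: "arrow Z u" "arrow u Z" using p final by (simp_all add: paths_Cons)
      have "(if arrow Z q then pval u Z q else 0) = (if arrow Z q then pval q Z u else 0)" for q
        using pval_sym[of u Z q] u arrow_sym[of q Z] by simp
      then show ?thesis using pval_star_start[OF u(1), of a b] final True
        by (simp add: phi_simps split del: if_split cong: if_cong)
    qed (use final in \<open>auto simp: phi_simps\<close>)
  next
    case zero
    then show ?thesis by simp
  qed
qed

text \<open>The functional takes the sign of the third direction on this path, and 1 and -1 are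
  nonzero in every field.\<close>

lemma rhombus_cycle_not_in_ideal:
  assumes sq: "square z a e b f"
  defines "x \<equiv> projZ (z + axis a e)" and "y \<equiv> projZ (z + axis a e + axis b f)"
  shows "(pth [Z, x, y, x, Z] :: 'k comb) \<notin> rauzy_ideal s"
proof
  assume i: "(pth [Z, x, y, x, Z] :: 'k comb) \<in> rauzy_ideal s"
  have "Z \<in> vertices" using z vertices_eq by blast
  then have Zc: "(pth [Z] :: 'k comb) \<in> combs" by (simp add: paths_single)
  have ab: "a \<noteq> b" and ef: "e \<in> {1, - 1}" "f \<in> {1, - 1}" using sq unfolding square_def by blast+
  have ne: "axis a e + axis b f \<noteq> 0" using ab ef by (intro axis_add_nonzero) auto
  obtain c where c: "b \<noteq> c" "a \<noteq> c" using ex_third ab by metis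
  have "functional phi (path_mult (path_mult (pth [Z]) (pth [Z, x, y, x, Z])) (pth [Z])) = 0"
    by (rule phi_rauzy_ideal[OF i Zc Zc])
  then have "pval x y x = 0" by (simp add: pth_mult phi_simps)
  moreover have "pval x y x = corner a e b f"
    using sq val_far[OF ef ne] unfolding pval_def x_def y_def square_def by (simp add: add.assoc)
  moreover have "corner a e b f = sg c" using corner_eq[OF ab c] sq by simp
  ultimately show False using sg_cases[of c] by auto
qed

end

section \<open>Paths leaving a rhombus\<close>

context
  fixes s :: "3 \<Rightarrow> point \<Rightarrow> int" and I :: "'k::field comb set"
  assumes sign: "sign_choice s" and I_def: "I = rauzy_ideal s"
begin

lemmas ideal_closed = I_closed[OF two_sided_rauzy_ideal[of s, where 'a='k], folded I_def]

lemma ideal_cong: "f - g \<in> I \<Longrightarrow> f \<in> I \<longleftrightarrow> g \<in> I"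
  using ideal_closed(3)[of "f - g" g] ideal_closed(7)[of f "f - g"] by auto

lemma relation_context:
  "r \<in> rauzy_relations s \<Longrightarrow> u \<in> paths \<Longrightarrow> v \<in> paths \<Longrightarrow>
    path_mult (path_mult (pth u) r) (pth v) \<in> I"
  using ideal_generated_superset[of "rauzy_relations s"] unfolding I_def rauzy_ideal_def[symmetric]
  by (metis I_def combs_closed(6) ideal_closed(5,6) subsetD)

lemma straight_path:
  assumes "xs @ [x] \<in> paths" "w # ys \<in> paths" "arrow x y" "arrow y w" "x \<noteq> w"
    "\<not> (\<exists>t\<in>rauzy_tiling. {x, y} \<in> sides t \<and> {y, w} \<in> sides t)"
  shows "pth (xs @ [x, y, w] @ ys) \<in> I"
proof -
  have "{x, y} \<noteq> {y, w}" using assms(5) by (auto simp: doubleton_eq_iff)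
  then have "(pth [x, y, w] :: 'k comb) \<in> rauzy_relations s"
    using assms unfolding rauzy_relations_def arrow_def by blast
  from relation_context[OF this assms(1,2)] show ?thesis by (simp add: path_mult_between)
qed

lemma rhombus_path:
  assumes "xs @ [x] \<in> paths" "w # ys \<in> paths" "rhombus x y w y'"
  shows "pth (xs @ [x, y, w] @ ys) - pth (xs @ [x, y', w] @ ys) \<in> I"
proof -
  have "(pth [x, y, w] - pth [x, y', w] :: 'k comb) \<in> rauzy_relations s"
    using assms(3) unfolding rauzy_relations_def by blast
  from relation_context[OF this assms(1,2)] show ?thesis
    by (simp add: path_mult_diff path_mult_between)
qed

lemma extend_path: "pth (xs @ [x]) \<in> I \<Longrightarrow> x # ys \<in> paths \<Longrightarrow> pth (xs @ x # ys) \<in> I"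
  using ideal_closed(6)[of "pth (xs @ [x])" "pth (x # ys)"] by (simp add: pth_mult)

text \<open>The rewriting step behind all vanishing results below: a turn is either zero in the
  algebra or can be pushed across the square on which it lies.\<close>

lemma turn:
  assumes st: "q \<in> strip" "q + axis a e \<in> strip" "q + axis a e + axis b f \<in> strip"
    and ef: "e \<in> {1, - 1}" "f \<in> {1, - 1}" and ne: "axis a e + axis b f \<noteq> 0"
    and p: "xs @ [projZ q] \<in> paths" "projZ (q + axis a e + axis b f) # ys \<in> paths"
  shows "pth (xs @ [projZ q, projZ (q + axis a e), projZ (q + axis a e + axis b f)] @ ys) \<in> I \<or>
    square q a e b f \<and> pth (xs @ [projZ q, projZ (q + axis a e), projZ (q + axis a e + axis b f)] @ ys)
      - pth (xs @ [projZ q, projZ (q + axis b f), projZ (q + axis a e + axis b f)] @ ys) \<in> I"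
proof (cases "square q a e b f")
  case True
  then show ?thesis using rhombus_path[OF p square_rhombus] by blast
next
  case False
  have ne': "projZ q \<noteq> projZ (q + axis a e + axis b f)" using st ne by (simp add: add.assoc)
  have "\<not> (\<exists>t\<in>rauzy_tiling. {projZ q, projZ (q + axis a e)} \<in> sides t \<and>
      {projZ (q + axis a e), projZ (q + axis a e + axis b f)} \<in> sides t)"
    using common_tile_iff[OF st ef ne] False st ef unfolding square_def by blast
  then show ?thesis
    using straight_path[OF p arrow_axis[OF st(1,2) ef(1)] arrow_axis[OF st(2,3) ef(2)] ne'] by blast
qed

text \<open>The star relation trades a detour in direction \<open>- e\<close> for those in directions \<open>e\<close> and \<open>\<plusminus> c\<close>.\<close>

lemma loop_path:
  assumes p: "xs @ [projZ q] \<in> paths" and q: "q \<in> strip" and e: "e \<in> {1, - 1}"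
    and c: "\<And>g. g \<in> {1, - 1} \<Longrightarrow> q + axis c g \<in> strip \<Longrightarrow> pth (xs @ [projZ q, projZ (q + axis c g)]) \<in> I"
    and a: "q + axis a e \<in> strip \<Longrightarrow> pth (xs @ [projZ q, projZ (q + axis a e)]) \<in> I"
    and st: "q + axis a (- e) \<in> strip"
  shows "pth (xs @ [projZ q, projZ (q + axis a (- e)), projZ q]) \<in> I"
proof -
  let ?Q = "projZ q"
  define L :: "point \<Rightarrow> 'k comb" where "L x = (if arrow ?Q x then pth (xs @ [?Q, x, ?Q]) else 0)" for x
  have Q: "?Q \<in> vertices" using q vertices_eq by blast
  have sQ: "of_int (s a ?Q) \<in> {1, - 1 :: 'k}" "of_int (s c ?Q) \<in> {1, - 1 :: 'k}"
  proof -
    have "s a ?Q \<in> {1, - 1}" "s c ?Q \<in> {1, - 1}"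
      using sign Q unfolding sign_choice_def by blast+
    then show "of_int (s a ?Q) \<in> {1, - 1 :: 'k}" "of_int (s c ?Q) \<in> {1, - 1 :: 'k}" by auto
  qed
  have r: "(scale (of_int (s a ?Q)) (D a ?Q) - scale (of_int (s c ?Q)) (D c ?Q) :: 'k comb) \<in> rauzy_relations s"
    using Q unfolding rauzy_relations_def by blast
  have l: "path_mult (path_mult (pth (xs @ [?Q])) (loop ?Q x)) (pth [?Q]) = L x" for x
    using path_mult_between[of xs ?Q ?Q x ?Q ?Q "[]", where ?'a='k] by (simp add: loop_def L_def)
  have "[?Q] \<in> paths" using Q by (simp add: paths_single)
  from relation_context[OF r p this]
  have rel: "scale (of_int (s a ?Q)) (L (?Q + pe a) - L (?Q - pe a)) -
     scale (of_int (s c ?Q)) (L (?Q + pe c) - L (?Q - pe c)) \<in> I"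
    by (simp only: path_mult_diff path_mult_scale D_def l)
  have Lz: "L (projZ (q + axis x h)) \<in> I"
    if "h \<in> {1, - 1}" "q + axis x h \<in> strip \<Longrightarrow> pth (xs @ [?Q, projZ (q + axis x h)]) \<in> I" for x h
  proof (cases "arrow ?Q (projZ (q + axis x h))")
    case True
    then have "q + axis x h \<in> strip" using arrow_pe_iff[OF q] that(1) by auto
    then have "pth ((xs @ [?Q]) @ [projZ (q + axis x h)]) \<in> I" using that(2) by simp
    moreover have "[projZ (q + axis x h), ?Q] \<in> paths"
      using True arrow_sym Q by (simp add: paths_Cons paths_single)
    ultimately show ?thesis using extend_path[of "xs @ [?Q]"] True by (simp add: L_def)
  next
    case False
    then show ?thesis using ideal_closed(2) by (simp add: L_def)
  qed
  have neg: "scale k f \<in> I" if "k \<in> {1, - 1}" "f \<in> I" for k f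
    using that ideal_closed(4) by (auto simp: scale_simps)
  have "L (?Q + pe c) - L (?Q - pe c) \<in> I"
    using Lz[OF _ c] by (intro ideal_closed(7)) (auto simp: pe_shift)
  then have "scale (of_int (s a ?Q)) (L (?Q + pe a) - L (?Q - pe a)) \<in> I"
    using neg[OF sQ(2)] ideal_cong[OF rel] by blast
  from neg[OF sQ(1) this] have "L (?Q + pe a) - L (?Q - pe a) \<in> I"
    using sQ(1) by (auto simp: scale_simps)
  then have d: "L (projZ (q + axis a 1)) - L (projZ (q + axis a (- 1))) \<in> I" by (simp add: pe_shift)
  have "L (projZ (q + axis a e)) \<in> I" using Lz[OF e a] .
  then have "L (projZ (q + axis a (- e))) \<in> I" using ideal_cong[OF d] e by auto
  moreover have "arrow ?Q (projZ (q + axis a (- e)))" using arrow_axis[OF q st] e by auto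
  ultimately show ?thesis by (simp add: L_def)
qed

section \<open>Walks that start along two sides of a rhombus\<close>

context
  fixes p :: "int^3" and a b :: 3 and e f :: int and Z X\<^sub>1 X\<^sub>2 Y :: point
  assumes sq: "square p a e b f" and ZXY: "Z = projZ p" "X\<^sub>1 = projZ (p + axis a e)"
    "Y = projZ (p + axis a e + axis b f)" "X\<^sub>2 = projZ (p + axis b f)"
begin

lemma square_facts: "a \<noteq> b" "e \<in> {1, - 1}" "f \<in> {1, - 1}" "- e \<in> {1, - 1}" "- f \<in> {1, - 1}"
  "p \<in> strip" "p + axis a e \<in> strip" "p + axis b f \<in> strip" "p + axis a e + axis b f \<in> strip"
  "p + axis a e + axis b f + axis b (- f) = p + axis a e"
  "p + axis a e + axis a (- e) = p"
  using sq unfolding square_def by (auto simp: add.assoc axis_add)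

lemma square_arrows: "arrow Z X\<^sub>1" "arrow X\<^sub>1 Z" "arrow X\<^sub>1 Y" "arrow Y X\<^sub>1" "arrow Z X\<^sub>2" "arrow X\<^sub>2 Z"
  "arrow X\<^sub>2 Y" "arrow Y X\<^sub>2"
  using rhombus_arrows[OF square_rhombus[OF sq]] arrow_sym unfolding ZXY by blast+

lemma square_vertices: "Z \<in> vertices" "X\<^sub>1 \<in> vertices" "X\<^sub>2 \<in> vertices" "Y \<in> vertices"
  using arrow_vertices square_arrows by blast+

lemmas square_path_simps = square_arrows square_vertices paths_Cons paths_single

lemma square_rhombus_from_Y: "rhombus Y X\<^sub>1 Z X\<^sub>2"
  using rhombus_flip[OF rhombus_swap[OF rhombus_flip[OF square_rhombus[OF sq]]]] unfolding ZXY .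

lemma cycle_cong: "pth [Z, X\<^sub>1, Y, X\<^sub>1, Z] - pth [Z, X\<^sub>1, Y, X\<^sub>2, Z] \<in> I"
  using rhombus_path[of "[Z, X\<^sub>1]" Y Z "[]", OF _ _ square_rhombus_from_Y]
  by (simp add: square_path_simps)

lemma side_cong: "Y # ys \<in> paths \<Longrightarrow> pth (Z # X\<^sub>1 # Y # ys) - pth (Z # X\<^sub>2 # Y # ys) \<in> I"
  using rhombus_path[of "[]" Z Y ys, OF _ _ square_rhombus[OF sq, folded ZXY]]
  by (simp add: square_path_simps)

text \<open>Two equal steps in a row span no square, which leaves only the first alternative of
  \<open>turn\<close>.\<close>

lemma continue_straight:
  assumes "p + axis a e + axis b f + axis b f \<in> strip"
  shows "pth [Z, X\<^sub>1, Y, projZ (p + axis a e + axis b f + axis b f)] \<in> I"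
proof -
  have "axis b f + axis b f \<noteq> 0" using square_facts(3) by (auto simp: axis_add axis_eq_0_iff)
  moreover have "projZ (p + axis a e + axis b f + axis b f) \<in> vertices" using assms vertices_eq by blast
  moreover have "\<not> square (p + axis a e) b f b f" by (simp add: square_def)
  moreover have "[Z] @ [projZ (p + axis a e)] \<in> paths"
    unfolding ZXY(2)[symmetric] by (simp add: square_path_simps)
  ultimately have "pth ([Z] @ [projZ (p + axis a e), projZ (p + axis a e + axis b f),
      projZ (p + axis a e + axis b f + axis b f)] @ []) \<in> I"
    using turn[of "p + axis a e" b f b f "[Z]" "[]"] assms square_facts(3,7,9)
    by (simp only: paths_single) blast
  then show ?thesis by (simp add: ZXY(2,3))
qed

end

text \<open>In direction \<open>a\<close> or \<open>b\<close> the walk goes straight on after one of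
  the two routes to \<open>Y\<close>, which are equal by \<open>side_cong\<close>. In the third
  direction, a walk that survived along both routes would complete a unit cube.\<close>

lemma leave_rhombus:
  assumes sq: "square p a e b f" and ZXY: "Z = projZ p" "X\<^sub>1 = projZ (p + axis a e)"
    "Y = projZ (p + axis a e + axis b f)"
    and g: "g \<in> {1, - 1}" "p + axis a e + axis b f + axis c g \<in> strip"
    and ne: "(c, g) \<noteq> (b, - f)" "(c, g) \<noteq> (a, - e)"
  shows "pth [Z, X\<^sub>1, Y, projZ (p + axis a e + axis b f + axis c g)] \<in> I" (is "pth [Z, X\<^sub>1, Y, ?w] \<in> I")
proof -
  define X\<^sub>2 where "X\<^sub>2 = projZ (p + axis b f)"
  note ZXY' = ZXY X\<^sub>2_def
  note sf = square_facts[OF sq ZXY'] and sp = square_path_simps[OF sq ZXY']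
  have Y': "Y = projZ (p + axis b f + axis a e)" unfolding ZXY by (simp add: add_ac)
  note ZXY'' = ZXY'(1,4) Y' ZXY'(2)
  have wv: "?w \<in> vertices" using g vertices_eq by blast
  have Yw: "arrow Y ?w" using arrow_axis[OF sf(9) g(2,1)] ZXY by simp
  have X12: "pth [Z, X\<^sub>1, Y, ?w] - pth [Z, X\<^sub>2, Y, ?w] \<in> I"
    using side_cong[OF sq ZXY', of "[?w]"] Yw wv by (simp add: sp)
  consider "c = b" | "c = a" | "c \<noteq> a" "c \<noteq> b" by blast
  then show ?thesis
  proof cases
    case 1
    then have "g = f" using ne(1) g(1) sf(3) by auto
    then show ?thesis using continue_straight[OF sq ZXY'] g(2) 1 by simp
  next
    case 2
    then have ge: "g = e" using ne(2) g(1) sf(2) by auto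
    have "p + axis b f + axis a e + axis a e = p + axis a e + axis b f + axis a e" by (simp add: add_ac)
    then have "pth [Z, X\<^sub>2, Y, ?w] \<in> I"
      using continue_straight[OF square_swap[OF sq] ZXY''] g(2) 2 ge by simp
    then show ?thesis using ideal_cong[OF X12] by blast
  next
    case 3
    have ne: "axis x h + axis c g \<noteq> 0" if "x \<noteq> c" for x h
      using that g(1) by (intro axis_add_nonzero) auto
    have wpath: "[?w] \<in> paths" using wv by (simp add: paths_single)
    \<comment> \<open>Push the step \<open>c\<close> backwards along the route to \<open>Y\<close>:
      first across the square at \<open>X\<close>, then across the one at \<open>p\<close>.\<close>
    have main: "pth [Z, X, Y, ?w] \<in> I \<or> square p x h c g \<and> square (p + axis x h) x' h' c g"
      if sq': "square p x h x' h'" and X: "X = projZ (p + axis x h)"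
        and y: "p + axis x h + axis x' h' = p + axis a e + axis b f" and xc: "x \<noteq> c" "x' \<noteq> c"
      for X x h x' h'
    proof -
      have y': "Y = projZ (p + axis x h + axis x' h')" by (simp only: ZXY(3) y)
      note sf' = square_facts[OF sq' ZXY(1) X y' refl] and sp' = square_path_simps[OF sq' ZXY(1) X y' refl]
      have w: "?w = projZ (p + axis x h + axis x' h' + axis c g)" by (simp only: y)
      have gs: "p + axis x h + axis x' h' + axis c g \<in> strip" using g(2) by (simp only: y)
      have "[Z] @ [X] \<in> paths" by (simp add: sp')
      with turn[of "p + axis x h" x' h' c g "[Z]" "[]"] sf' gs g(1) ne[OF xc(2)] wpath
      have 1: "pth [Z, X, Y, ?w] \<in> I \<or> square (p + axis x h) x' h' c g \<and>
          pth [Z, X, Y, ?w] - pth [Z, X, projZ (p + axis x h + axis c g), ?w] \<in> I"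
        by (simp add: w X[symmetric] y'[symmetric])
      show ?thesis
      proof (cases "square (p + axis x h) x' h' c g")
        case True
        then have st: "p + axis x h + axis c g \<in> strip" unfolding square_def by blast
        have eq: "p + axis x h + axis c g + axis x' h' = p + axis x h + axis x' h' + axis c g"
          by (simp only: add_ac)
        have "arrow (projZ (p + axis x h + axis c g)) ?w"
          unfolding w using arrow_axis[OF st, of x' h', unfolded eq, OF gs sf'(3)] .
        then have "[projZ (p + axis x h + axis c g), ?w] \<in> paths"
          using wpath by (simp add: paths_Cons)
        moreover have "[] @ [Z] \<in> paths" by (simp add: sp')
        ultimately have "pth [Z, X, projZ (p + axis x h + axis c g), ?w] \<in> I \<or> square p x h c g"
          using turn[of p x h c g "[]" "[?w]"] sf' st g(1) ne[OF xc(1)]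
          by (auto simp: X[symmetric] ZXY(1)[symmetric])
        then show ?thesis using 1 True ideal_cong by blast
      qed (use 1 in blast)
    qed
    have "pth [Z, X\<^sub>1, Y, ?w] \<in> I \<or> square p a e c g \<and> square (p + axis a e) b f c g"
      by (rule main[OF sq ZXY(2) refl]) (use 3 in auto)
    moreover have "pth [Z, X\<^sub>2, Y, ?w] \<in> I \<or> square p b f c g \<and> square (p + axis b f) a e c g"
      by (rule main[OF square_swap[OF sq] X\<^sub>2_def]) (use 3 in \<open>auto simp: add_ac\<close>)
    \<comment> \<open>The squares obtained from the two routes together contain all eight corners of
      a cube at \<open>p\<close>.\<close>
    moreover have False if sq2: "square p a e c g" "square (p + axis a e) b f c g"
        "square (p + axis b f) a e c g"
    proof -
      have st: "p + axis c g \<in> strip" "p + axis a e + axis c g \<in> strip"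
        "p + axis b f + axis c g \<in> strip"
        using sq2 unfolding square_def by blast+
      show False
        by (rule no_cube[of a b c e f g p]) (use 3 sf g st in auto)
    qed
    ultimately show ?thesis using ideal_cong[OF X12] by blast
  qed
qed

context
  fixes p :: "int^3" and a b :: 3 and e f :: int and Z X\<^sub>1 X\<^sub>2 Y :: point
  assumes sq: "square p a e b f" and ZXY: "Z = projZ p" "X\<^sub>1 = projZ (p + axis a e)"
    "Y = projZ (p + axis a e + axis b f)" "X\<^sub>2 = projZ (p + axis b f)"
begin

lemmas sf = square_facts[OF sq ZXY]
lemmas sp = square_path_simps[OF sq ZXY]

text \<open>A step back to \<open>Y\<close> is removed by the star relation at \<open>Y\<close>. Any
  other turn at \<open>X\<^sub>1\<close> is zero or can be pushed across a square, and then the walk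
  leaves the rhombus at \<open>Y\<close>.\<close>

lemma return_side:
  assumes g: "g \<in> {1, - 1}" "p + axis a e + axis c g \<in> strip" "(c, g) \<noteq> (a, - e)"
  shows "pth [Z, X\<^sub>1, Y, X\<^sub>1, projZ (p + axis a e + axis c g)] \<in> I"
proof (cases "(c, g) = (b, f)")
  case True
  \<comment> \<open>Comparing with direction \<open>a\<close> instead would bring in the loop
    through \<open>X\<^sub>2\<close>, which does not leave the rhombus.\<close>
  obtain c' where c': "c' \<noteq> a" "c' \<noteq> b" using ex_third sf(1) by metis
  have "pth ([Z, X\<^sub>1] @ [projZ (p + axis a e + axis b f),
     projZ (p + axis a e + axis b f + axis b (- f)), projZ (p + axis a e + axis b f)]) \<in> I"
  proof (rule loop_path[of _ _ f c' b])
    show "[Z, X\<^sub>1] @ [projZ (p + axis a e + axis b f)] \<in> paths"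
      unfolding ZXY(3)[symmetric] by (simp add: sp)
    fix g assume "g \<in> {1, - 1}" "p + axis a e + axis b f + axis c' g \<in> strip"
    from leave_rhombus[OF sq ZXY(1-3) this] c'
    show "pth ([Z, X\<^sub>1] @ [projZ (p + axis a e + axis b f), projZ (p + axis a e + axis b f + axis c' g)]) \<in> I"
      by (simp add: ZXY(3))
  next
    assume "p + axis a e + axis b f + axis b f \<in> strip"
    from leave_rhombus[OF sq ZXY(1-3) sf(3) this] sf(1,3)
    show "pth ([Z, X\<^sub>1] @ [projZ (p + axis a e + axis b f), projZ (p + axis a e + axis b f + axis b f)]) \<in> I"
      by (auto simp: ZXY(3))
  next
    show "p + axis a e + axis b f + axis b (- f) \<in> strip" unfolding sf(10) by (rule sf(7))
  qed (rule sf)+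
  then show ?thesis using True sf(10) ZXY by simp
next
  case False
  then have ne: "axis b (- f) + axis c g \<noteq> 0" using g(1) by (intro axis_add_nonzero) auto
  let ?w = "projZ (p + axis a e + axis c g)"
  have w: "[?w] \<in> paths" using g(2) unfolding paths_single vertices_eq by blast
  have "[Z, X\<^sub>1] @ [Y] \<in> paths" by (simp add: sp)
  with turn[of "p + axis a e + axis b f" b "- f" c g "[Z, X\<^sub>1]" "[]"] sf g(1,2) ne w
  have "pth [Z, X\<^sub>1, Y, X\<^sub>1, ?w] \<in> I \<or> square (p + axis a e + axis b f) b (- f) c g \<and>
     pth [Z, X\<^sub>1, Y, X\<^sub>1, ?w] - pth [Z, X\<^sub>1, Y, projZ (p + axis a e + axis b f + axis c g), ?w] \<in> I"
    by (simp add: ZXY[symmetric])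
  moreover have "pth [Z, X\<^sub>1, Y, projZ (p + axis a e + axis b f + axis c g), ?w] \<in> I"
    if s2: "square (p + axis a e + axis b f) b (- f) c g"
  proof -
    have bc: "b \<noteq> c" and st: "p + axis a e + axis b f + axis c g \<in> strip"
      using s2 unfolding square_def by blast+
    have "pth [Z, X\<^sub>1, Y, projZ (p + axis a e + axis b f + axis c g)] \<in> I"
      using leave_rhombus[OF sq ZXY(1-3) g(1) st] bc g(3) by blast
    moreover have eq: "p + axis a e + axis b f + axis c g + axis b (- f) = p + axis a e + axis c g"
      by (simp add: algebra_simps axis_neg[symmetric])
    have "arrow (projZ (p + axis a e + axis b f + axis c g)) ?w"
      using arrow_axis[OF st, of b "- f", unfolded eq, OF g(2) sf(5)] .
    then have "[projZ (p + axis a e + axis b f + axis c g), ?w] \<in> paths"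
      using w by (simp add: paths_Cons)
    ultimately show ?thesis
      using extend_path[of "[Z, X\<^sub>1, Y]" "projZ (p + axis a e + axis b f + axis c g)" "[?w]"] by simp
  qed
  ultimately show ?thesis using ideal_cong by blast
qed

text \<open>The argument of \<open>return_side\<close> one step further. A return to
  \<open>X\<^sub>1\<close> is removed by the star relation there; its other loops vanish by
  \<open>return_side\<close>, now including those in direction \<open>b\<close>.\<close>

lemma leave_cycle:
  assumes g: "g \<in> {1, - 1}" "p + axis c g \<in> strip"
  shows "pth [Z, X\<^sub>1, Y, X\<^sub>1, Z, projZ (p + axis c g)] \<in> I"
proof (cases "(c, g) = (a, e)")
  case True
  have "pth ([Z, X\<^sub>1, Y] @ [projZ (p + axis a e), projZ (p + axis a e + axis a (- e)), projZ (p + axis a e)]) \<in> I"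
  proof (rule loop_path[of _ _ e b a])
    show "[Z, X\<^sub>1, Y] @ [projZ (p + axis a e)] \<in> paths"
      unfolding ZXY(2)[symmetric] by (simp add: sp)
    fix g assume "g \<in> {1, - 1}" "p + axis a e + axis b g \<in> strip"
    from return_side[OF this] sf(1)
    show "pth ([Z, X\<^sub>1, Y] @ [projZ (p + axis a e), projZ (p + axis a e + axis b g)]) \<in> I"
      by (simp add: ZXY(2))
  next
    assume "p + axis a e + axis a e \<in> strip"
    from return_side[OF sf(2) this] sf(2)
    show "pth ([Z, X\<^sub>1, Y] @ [projZ (p + axis a e), projZ (p + axis a e + axis a e)]) \<in> I"
      by (auto simp: ZXY(2))
  next
    show "p + axis a e + axis a (- e) \<in> strip" unfolding sf(11) by (rule sf(6))
  qed (rule sf)+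
  then show ?thesis using True sf(11) ZXY by simp
next
  case False
  then have ne: "axis a (- e) + axis c g \<noteq> 0" using g(1) by (intro axis_add_nonzero) auto
  let ?w = "projZ (p + axis c g)"
  have w: "[?w] \<in> paths" using g(2) unfolding paths_single vertices_eq by blast
  have "[Z, X\<^sub>1, Y] @ [X\<^sub>1] \<in> paths" by (simp add: sp)
  with turn[of "p + axis a e" a "- e" c g "[Z, X\<^sub>1, Y]" "[]"] sf g(1,2) ne w
  have "pth [Z, X\<^sub>1, Y, X\<^sub>1, Z, ?w] \<in> I \<or> square (p + axis a e) a (- e) c g \<and>
     pth [Z, X\<^sub>1, Y, X\<^sub>1, Z, ?w] - pth [Z, X\<^sub>1, Y, X\<^sub>1, projZ (p + axis a e + axis c g), ?w] \<in> I"
    by (simp add: ZXY[symmetric])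
  moreover have "pth [Z, X\<^sub>1, Y, X\<^sub>1, projZ (p + axis a e + axis c g), ?w] \<in> I"
    if s2: "square (p + axis a e) a (- e) c g"
  proof -
    have bc: "a \<noteq> c" and st: "p + axis a e + axis c g \<in> strip"
      using s2 unfolding square_def by blast+
    have "pth [Z, X\<^sub>1, Y, X\<^sub>1, projZ (p + axis a e + axis c g)] \<in> I"
      using return_side[OF g(1) st] bc by blast
    moreover have eq: "p + axis a e + axis c g + axis a (- e) = p + axis c g"
      by (simp add: algebra_simps axis_neg[symmetric])
    have "arrow (projZ (p + axis a e + axis c g)) ?w"
      using arrow_axis[OF st, of a "- e", unfolded eq, OF g(2) sf(4)] .
    then have "[projZ (p + axis a e + axis c g), ?w] \<in> paths"
      using w by (simp add: paths_Cons)
    ultimately show ?thesis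
      using extend_path[of "[Z, X\<^sub>1, Y, X\<^sub>1]" "projZ (p + axis a e + axis c g)" "[?w]"] by simp
  qed
  ultimately show ?thesis using ideal_cong by blast
qed

end

text \<open>All that the modules need to know about the ideal. The claim on a return to
  \<open>x'\<close> is that on a return to \<open>x\<close> in the mirrored square, transported by
  \<open>side_cong\<close>.\<close>

lemma rhombus_paths:
  assumes r: "rhombus z x y x'"
  shows "pth [z, x, y] - pth [z, x', y] \<in> I"
    and "arrow y w \<Longrightarrow> w \<noteq> x \<Longrightarrow> w \<noteq> x' \<Longrightarrow> pth [z, x, y, w] \<in> I"
    and "arrow x w \<Longrightarrow> w \<noteq> z \<Longrightarrow> pth [z, x, y, x, w] \<in> I"
    and "arrow x' w \<Longrightarrow> w \<noteq> z \<Longrightarrow> pth [z, x, y, x', w] \<in> I"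
    and "pth [z, x, y, x, z] - pth [z, x, y, x', z] \<in> I"
    and "arrow z w \<Longrightarrow> pth [z, x, y, x, z, w] \<in> I"
    and "pth [z, x, y, x, z] \<notin> I"
proof -
  obtain p a e b f where sq: "square p a e b f" and Z: "z = projZ p" "x = projZ (p + axis a e)"
    "y = projZ (p + axis a e + axis b f)" "x' = projZ (p + axis b f)"
    using r unfolding rhombus_iff_lattice lattice_rhombus_def by blast
  note sf = square_facts[OF sq Z] and sp = square_path_simps[OF sq Z]
  have Y': "y = projZ (p + axis b f + axis a e)" unfolding Z by (simp add: add_ac)
  note Z' = Z(1,4) Y' Z(2)
  show "pth [z, x, y] - pth [z, x', y] \<in> I" using side_cong[OF sq Z, of "[]"] by (simp add: sp)
  show "pth [z, x, y, x, z] - pth [z, x, y, x', z] \<in> I" using cycle_cong[OF sq Z] .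
  show "pth [z, x, y, w] \<in> I" if w: "arrow y w" "w \<noteq> x" "w \<noteq> x'"
  proof -
    obtain c g where c: "g \<in> {1, - 1}" "p + axis a e + axis b f + axis c g \<in> strip"
      "w = projZ (p + axis a e + axis b f + axis c g)"
      using arrow_lift[OF sf(9)] w(1) unfolding Z(3) by metis
    have "(c, g) \<noteq> (b, - f)"
    proof
      assume "(c, g) = (b, - f)"
      then have "c = b" "g = - f" by simp_all
      then have "w = x" unfolding c(3) Z(2) by (simp only: sf(10))
      then show False using w(2) by blast
    qed
    moreover have x': "p + axis a e + axis b f + axis a (- e) = p + axis b f"
      by (simp add: algebra_simps axis_neg[symmetric])
    have "(c, g) \<noteq> (a, - e)"
    proof
      assume "(c, g) = (a, - e)"
      then have "c = a" "g = - e" by simp_all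
      then have "w = x'" unfolding c(3) Z(4) by (simp only: x')
      then show False using w(3) by blast
    qed
    ultimately show ?thesis using leave_rhombus[OF sq Z(1-3) c(1,2)] c(3) by simp
  qed
  have side: "pth [z, x, y, x, w] \<in> I" if w: "arrow x w" "w \<noteq> z"
      and sq: "square p a e b f" and Z: "z = projZ p" "x = projZ (p + axis a e)"
      "y = projZ (p + axis a e + axis b f)" "x' = projZ (p + axis b f)" for w x x' a e b f
  proof -
    note sf = square_facts[OF sq Z]
    obtain c g where c: "g \<in> {1, - 1}" "p + axis a e + axis c g \<in> strip"
      "w = projZ (p + axis a e + axis c g)"
      using arrow_lift[OF sf(7)] w(1) unfolding Z(2) by metis
    have "(c, g) \<noteq> (a, - e)"
    proof
      assume "(c, g) = (a, - e)"
      then have "c = a" "g = - e" by simp_all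
      then have "w = z" unfolding c(3) Z(1) by (simp only: sf(11))
      then show False using w(2) by blast
    qed
    then show ?thesis using return_side[OF sq Z c(1,2)] c(3) by simp
  qed
  show "pth [z, x, y, x, w] \<in> I" if "arrow x w" "w \<noteq> z" using side[OF that sq Z] .
  show "pth [z, x, y, x', w] \<in> I" if w: "arrow x' w" "w \<noteq> z"
  proof -
    have "pth [z, x', y, x', w] \<in> I" using side[OF w square_swap[OF sq] Z'] .
    moreover have "[y, x', w] \<in> paths" using w(1) arrow_vertices[OF w(1)] by (simp add: sp)
    ultimately show ?thesis using side_cong[OF sq Z] ideal_cong by blast
  qed
  show "pth [z, x, y, x, z, w] \<in> I" if w: "arrow z w"
  proof -
    obtain c g where c: "g \<in> {1, - 1}" "p + axis c g \<in> strip" "w = projZ (p + axis c g)"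
      using arrow_lift[OF sf(6)] w(1) unfolding Z(1) by metis
    show ?thesis using leave_cycle[OF sq Z c(1,2)] c(3) by simp
  qed
  interpret rauzy_functional s p "TYPE('k)" by unfold_locales (use sign sf in auto)
  show "pth [z, x, y, x, z] \<notin> I"
    using rhombus_cycle_not_in_ideal[OF sq] unfolding Z I_def .
qed

end

section \<open>Submodules and quotient modules\<close>

text \<open>What is left of \<open>right_module\<close> without the laws for sums and products in
  the algebra and without \<open>M A = M\<close>. It passes to submodules at once and suffices for
  quotients.\<close>

definition linear_module :: "('a, 'c) ring_scheme \<Rightarrow> ('a, 'm) module \<Rightarrow> bool" where
  "linear_module A M \<longleftrightarrow> abelian_group M \<and>
     (\<forall>a\<in>carrier A. \<forall>m\<in>carrier M. a \<odot>\<^bsub>M\<^esub> m \<in> carrier M) \<and>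
     (\<forall>a\<in>carrier A. \<forall>m\<in>carrier M. \<forall>n\<in>carrier M.
        a \<odot>\<^bsub>M\<^esub> (m \<oplus>\<^bsub>M\<^esub> n) = a \<odot>\<^bsub>M\<^esub> m \<oplus>\<^bsub>M\<^esub> a \<odot>\<^bsub>M\<^esub> n)"

text \<open>A homomorphism onto \<open>T\<close> with kernel \<open>N\<close>, the form of an
  isomorphism from \<open>M / N\<close> to \<open>T\<close> without cosets.\<close>

definition linear_onto :: "('a, 'c) ring_scheme \<Rightarrow> ('a, 'm) module \<Rightarrow> 'm set \<Rightarrow> ('a, 'n) module \<Rightarrow> ('m \<Rightarrow> 'n) \<Rightarrow> bool" where
  "linear_onto A M N T h \<longleftrightarrow> h ` carrier M = carrier T \<and>
     (\<forall>m\<in>carrier M. \<forall>n\<in>carrier M. h (m \<oplus>\<^bsub>M\<^esub> n) = h m \<oplus>\<^bsub>T\<^esub> h n) \<and>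
     (\<forall>a\<in>carrier A. \<forall>m\<in>carrier M. h (a \<odot>\<^bsub>M\<^esub> m) = a \<odot>\<^bsub>T\<^esub> h m) \<and>
     (\<forall>m\<in>carrier M. h m = \<zero>\<^bsub>T\<^esub> \<longleftrightarrow> m \<in> N)"

lemma linear_module_smult:
  assumes "linear_module A M" "a \<in> carrier A"
  shows "a \<odot>\<^bsub>M\<^esub> \<zero>\<^bsub>M\<^esub> = \<zero>\<^bsub>M\<^esub>"
    and "m \<in> carrier M \<Longrightarrow> a \<odot>\<^bsub>M\<^esub> (\<ominus>\<^bsub>M\<^esub> m) = \<ominus>\<^bsub>M\<^esub> (a \<odot>\<^bsub>M\<^esub> m)"
proof -
  interpret abelian_group M using assms(1) unfolding linear_module_def by blast
  have c: "a \<odot>\<^bsub>M\<^esub> m \<in> carrier M" if "m \<in> carrier M" for m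
    using assms that unfolding linear_module_def by blast
  have d: "a \<odot>\<^bsub>M\<^esub> (m \<oplus>\<^bsub>M\<^esub> n) = a \<odot>\<^bsub>M\<^esub> m \<oplus>\<^bsub>M\<^esub> a \<odot>\<^bsub>M\<^esub> n" if "m \<in> carrier M" "n \<in> carrier M" for m n
    using assms that unfolding linear_module_def by blast
  show 0: "a \<odot>\<^bsub>M\<^esub> \<zero>\<^bsub>M\<^esub> = \<zero>\<^bsub>M\<^esub>"
    using d[of "\<zero>\<^bsub>M\<^esub>" "\<zero>\<^bsub>M\<^esub>"] c[of "\<zero>\<^bsub>M\<^esub>"] add.l_cancel_one by simp
  show "a \<odot>\<^bsub>M\<^esub> (\<ominus>\<^bsub>M\<^esub> m) = \<ominus>\<^bsub>M\<^esub> (a \<odot>\<^bsub>M\<^esub> m)" if m: "m \<in> carrier M"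
    using d[of "\<ominus>\<^bsub>M\<^esub> m" m] m c 0 by (simp add: l_neg minus_equality[symmetric])
qed

lemma submodule_iff:
  assumes "linear_module A M"
  shows "submodule N A M \<longleftrightarrow> N \<subseteq> carrier M \<and> \<zero>\<^bsub>M\<^esub> \<in> N \<and> (\<forall>m\<in>N. \<forall>n\<in>N. m \<oplus>\<^bsub>M\<^esub> n \<in> N) \<and>
    (\<forall>m\<in>N. \<ominus>\<^bsub>M\<^esub> m \<in> N) \<and> (\<forall>a\<in>carrier A. \<forall>m\<in>N. a \<odot>\<^bsub>M\<^esub> m \<in> N)"
proof -
  interpret abelian_group M using assms(1) unfolding linear_module_def by blast
  show ?thesis
    unfolding submodule_def submodule_axioms_def subgroup_def a_inv_def by auto
qed

lemma linear_module_restrict: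
  assumes M: "linear_module A M" and N: "submodule N A M"
  shows "linear_module A (restrict_module M N)"
proof -
  interpret abelian_group M using assms(1) unfolding linear_module_def by blast
  have "abelian_group (restrict_module M N)"
  proof (rule abelian_groupI)
    fix m assume "m \<in> carrier (restrict_module M N)"
    then show "\<exists>n\<in>carrier (restrict_module M N). n \<oplus>\<^bsub>restrict_module M N\<^esub> m = \<zero>\<^bsub>restrict_module M N\<^esub>"
      using N unfolding submodule_iff[OF M] restrict_module_def
      by (intro bexI[of _ "\<ominus>\<^bsub>M\<^esub> m"]) (auto intro: l_neg)
  qed (use N in \<open>auto simp: submodule_iff[OF M] restrict_module_def a_ac subset_iff\<close>)
  then show ?thesis using M N
    unfolding linear_module_def submodule_iff[OF M] by (auto simp: restrict_module_def subset_iff)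
qed

lemma submodule_restrict:
  assumes M: "linear_module A M" and N: "submodule N A M" and L: "submodule L A M" "L \<subseteq> N"
  shows "submodule L A (restrict_module M N)"
proof -
  interpret abelian_group M using assms(1) unfolding linear_module_def by blast
  have "subgroup N (add_monoid M)" "subgroup L (add_monoid M)"
    using N L(1) unfolding submodule_def by blast+
  then have "subgroup L ((add_monoid M)\<lparr>carrier := N\<rparr>)"
    using L(2) group.subgroup_incl[OF a_group] by blast
  then show ?thesis using L(1) unfolding submodule_def submodule_axioms_def restrict_module_def by simp
qed

text \<open>The homomorphism theorem and its converse, by which the tops and middle layers below are
  handled without cosets of submodules.\<close>

lemma quotient_iso_iff:
  assumes M: "linear_module A M" and N: "submodule N A M" and T: "abelian_group T"
  shows "module_iso A (quotient_module M N) T \<longleftrightarrow> (\<exists>h. linear_onto A M N T h)"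
proof -
  interpret abelian_group M using assms(1) unfolding linear_module_def by blast
  interpret T: abelian_group T by (rule T)
  note Ns = N[unfolded submodule_iff[OF M]]
  have G: "abelian_group M" using assms(1) unfolding linear_module_def by blast
  have sub: "subgroup N (add_monoid M)" using N unfolding submodule_def by blast
  then interpret N: additive_subgroup N M by (rule additive_subgroupI)
  interpret N: abelian_subgroup N M by (rule abelian_subgroupI3[OF N.additive_subgroup_axioms G])
  let ?Q = "quotient_module M N"
  define q where "q m = N +>\<^bsub>M\<^esub> m" for m
  have car: "carrier ?Q = q ` carrier M"
    unfolding quotient_module_def q_def by (auto simp: A_RCOSETS_def')
  have mem: "n \<in> q m \<longleftrightarrow> n \<ominus>\<^bsub>M\<^esub> m \<in> N" if "m \<in> carrier M" "n \<in> carrier M" for m n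
  proof
    assume "n \<in> q m"
    then obtain k where k: "k \<in> N" "n = k \<oplus>\<^bsub>M\<^esub> m" unfolding q_def a_r_coset_def' by blast
    then have "n \<ominus>\<^bsub>M\<^esub> m = k" using that Ns by (auto simp: a_minus_def a_assoc r_neg)
    then show "n \<ominus>\<^bsub>M\<^esub> m \<in> N" using k by simp
  next
    assume "n \<ominus>\<^bsub>M\<^esub> m \<in> N"
    moreover have "n = (n \<ominus>\<^bsub>M\<^esub> m) \<oplus>\<^bsub>M\<^esub> m" using that by (simp add: a_minus_def a_assoc l_neg)
    ultimately show "n \<in> q m" unfolding q_def a_r_coset_def' by blast
  qed
  have qsub: "n \<in> carrier M" if "m \<in> carrier M" "n \<in> q m" for m n
    using N.a_elemrcos_carrier that unfolding q_def by blast
  have self: "m \<in> q m" if "m \<in> carrier M" for m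
    unfolding q_def using N.a_rcos_self that by blast
  have eq: "q m = q n \<longleftrightarrow> m \<ominus>\<^bsub>M\<^esub> n \<in> N" if "m \<in> carrier M" "n \<in> carrier M" for m n
  proof -
    have "m \<in> q n \<Longrightarrow> q n = q m"
      using a_repr_independence'[of m N n, OF _ that(2) sub] unfolding q_def a_r_coset_def .
    then show ?thesis using mem[OF that(2,1)] self[OF that(1)] by blast
  qed
  have add: "q m \<oplus>\<^bsub>?Q\<^esub> q n = q (m \<oplus>\<^bsub>M\<^esub> n)" if "m \<in> carrier M" "n \<in> carrier M" for m n
    using that N.a_rcos_sum unfolding q_def quotient_module_def by simp
  have ac: "a \<odot>\<^bsub>M\<^esub> m \<in> carrier M" if "a \<in> carrier A" "m \<in> carrier M" for a m
    using M that unfolding linear_module_def by blast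
  have ad: "a \<odot>\<^bsub>M\<^esub> (m \<oplus>\<^bsub>M\<^esub> n) = a \<odot>\<^bsub>M\<^esub> m \<oplus>\<^bsub>M\<^esub> a \<odot>\<^bsub>M\<^esub> n"
    if "a \<in> carrier A" "m \<in> carrier M" "n \<in> carrier M" for a m n
    using M that unfolding linear_module_def by blast
  have am: "a \<odot>\<^bsub>M\<^esub> (m \<ominus>\<^bsub>M\<^esub> n) = a \<odot>\<^bsub>M\<^esub> m \<ominus>\<^bsub>M\<^esub> a \<odot>\<^bsub>M\<^esub> n"
    if "a \<in> carrier A" "m \<in> carrier M" "n \<in> carrier M" for a m n
    using ad[of a m "\<ominus>\<^bsub>M\<^esub> n"] linear_module_smult(2)[OF M] that by (simp add: a_minus_def)
  have smult: "a \<odot>\<^bsub>?Q\<^esub> q m = q (a \<odot>\<^bsub>M\<^esub> m)" if a: "a \<in> carrier A" and m: "m \<in> carrier M" for a m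
  proof -
    have "q (a \<odot>\<^bsub>M\<^esub> n) = q (a \<odot>\<^bsub>M\<^esub> m)" if n: "n \<in> q m" for n
    proof -
      have nc: "n \<in> carrier M" using qsub[OF m n] .
      have "n \<ominus>\<^bsub>M\<^esub> m \<in> N" using mem[OF m nc] n by blast
      then have "a \<odot>\<^bsub>M\<^esub> n \<ominus>\<^bsub>M\<^esub> a \<odot>\<^bsub>M\<^esub> m \<in> N" using Ns a am[OF a nc m] by metis
      then show ?thesis using eq ac a nc m by blast
    qed
    then have "(\<Union>n\<in>q m. q (a \<odot>\<^bsub>M\<^esub> n)) = q (a \<odot>\<^bsub>M\<^esub> m)" using self[OF m] by blast
    then show ?thesis unfolding quotient_module_def q_def by simp
  qed
  have qz: "q m = q \<zero>\<^bsub>M\<^esub> \<longleftrightarrow> m \<in> N" if "m \<in> carrier M" for m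
  proof -
    have z: "\<ominus>\<^bsub>M\<^esub> \<zero>\<^bsub>M\<^esub> = \<zero>\<^bsub>M\<^esub>" by (rule minus_equality) simp_all
    have "m \<ominus>\<^bsub>M\<^esub> \<zero>\<^bsub>M\<^esub> = m" unfolding a_minus_def z using that by (rule r_zero)
    then show ?thesis using eq[OF that zero_closed] by simp
  qed
  show ?thesis
  proof
    assume "module_iso A ?Q T"
    then obtain h where h': "bij_betw h (carrier ?Q) (carrier T)"
      "\<forall>x\<in>carrier ?Q. \<forall>y\<in>carrier ?Q. h (x \<oplus>\<^bsub>?Q\<^esub> y) = h x \<oplus>\<^bsub>T\<^esub> h y"
      "\<forall>a\<in>carrier A. \<forall>x\<in>carrier ?Q. h (a \<odot>\<^bsub>?Q\<^esub> x) = a \<odot>\<^bsub>T\<^esub> h x"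
      unfolding module_iso_def by (elim exE conjE) (rule that)
    note h = h'(1) bspec[OF bspec[OF h'(2)]] bspec[OF bspec[OF h'(3)]]
    have hc: "h (q m) \<in> carrier T" if "m \<in> carrier M" for m
      using h(1) that unfolding bij_betw_def car by blast
    have "h (q \<zero>\<^bsub>M\<^esub>) = h (q \<zero>\<^bsub>M\<^esub>) \<oplus>\<^bsub>T\<^esub> h (q \<zero>\<^bsub>M\<^esub>)"
      using h(2)[of "q \<zero>\<^bsub>M\<^esub>" "q \<zero>\<^bsub>M\<^esub>"] add[of "\<zero>\<^bsub>M\<^esub>" "\<zero>\<^bsub>M\<^esub>"] by (simp add: car)
    then have h0: "h (q \<zero>\<^bsub>M\<^esub>) = \<zero>\<^bsub>T\<^esub>"
      using T.add.l_cancel_one'[of "h (q \<zero>\<^bsub>M\<^esub>)" "h (q \<zero>\<^bsub>M\<^esub>)"] hc[OF zero_closed] by simp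
    have "h (q m) = \<zero>\<^bsub>T\<^esub> \<longleftrightarrow> m \<in> N" if "m \<in> carrier M" for m
    proof -
      have "h (q m) = h (q \<zero>\<^bsub>M\<^esub>) \<longleftrightarrow> q m = q \<zero>\<^bsub>M\<^esub>"
        using inj_on_eq_iff[of h "q ` carrier M" "q m" "q \<zero>\<^bsub>M\<^esub>"] h(1) that
        unfolding bij_betw_def car by simp
      then show ?thesis using h0 qz[OF that] by simp
    qed
    moreover have "(\<lambda>m. h (q m)) ` carrier M = carrier T"
      using h(1) unfolding bij_betw_def car by (simp add: image_image)
    moreover have "h (q (m \<oplus>\<^bsub>M\<^esub> n)) = h (q m) \<oplus>\<^bsub>T\<^esub> h (q n)" if "m \<in> carrier M" "n \<in> carrier M" for m n
      using h(2)[of "q m" "q n"] add[OF that] that by (simp add: car)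
    moreover have "h (q (a \<odot>\<^bsub>M\<^esub> m)) = a \<odot>\<^bsub>T\<^esub> h (q m)" if "a \<in> carrier A" "m \<in> carrier M" for a m
      using h(3)[of a "q m"] smult[OF that] that by (simp add: car)
    ultimately have "linear_onto A M N T (\<lambda>m. h (q m))"
      unfolding linear_onto_def by blast
    then show "\<exists>h. linear_onto A M N T h" by blast
  next
    assume "\<exists>h. linear_onto A M N T h"
    then obtain h where h: "h ` carrier M = carrier T"
      "\<And>m n. m \<in> carrier M \<Longrightarrow> n \<in> carrier M \<Longrightarrow> h (m \<oplus>\<^bsub>M\<^esub> n) = h m \<oplus>\<^bsub>T\<^esub> h n"
      "\<And>a m. a \<in> carrier A \<Longrightarrow> m \<in> carrier M \<Longrightarrow> h (a \<odot>\<^bsub>M\<^esub> m) = a \<odot>\<^bsub>T\<^esub> h m"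
      "\<And>m. m \<in> carrier M \<Longrightarrow> h m = \<zero>\<^bsub>T\<^esub> \<longleftrightarrow> m \<in> N"
      unfolding linear_onto_def by (elim exE conjE) (rule that; blast)
    have hc: "h m \<in> carrier T" if "m \<in> carrier M" for m using h(1) that by blast
    have heq: "h m = h n \<longleftrightarrow> q m = q n" if "m \<in> carrier M" "n \<in> carrier M" for m n
    proof -
      have "h m = h (m \<ominus>\<^bsub>M\<^esub> n) \<oplus>\<^bsub>T\<^esub> h n"
        using h(2)[of "m \<ominus>\<^bsub>M\<^esub> n" n] that by (simp add: a_minus_def a_assoc l_neg)
      then have "h m = h n \<longleftrightarrow> h (m \<ominus>\<^bsub>M\<^esub> n) = \<zero>\<^bsub>T\<^esub>"
        using T.add.r_cancel_one[of "h n" "h (m \<ominus>\<^bsub>M\<^esub> n)"] hc that by simp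
      then show ?thesis using h(4) eq that by simp
    qed
    \<comment> \<open>By \<open>heq\<close> the value does not depend on the chosen
      representative.\<close>
    define g where "g X = h (SOME m. m \<in> carrier M \<and> q m = X)" for X
    have g: "g (q m) = h m" if "m \<in> carrier M" for m
    proof -
      have "(SOME n. n \<in> carrier M \<and> q n = q m) \<in> carrier M \<and> q (SOME n. n \<in> carrier M \<and> q n = q m) = q m"
        by (rule someI[of _ m]) (use that in simp)
      then show ?thesis unfolding g_def using heq that by blast
    qed
    have "bij_betw g (carrier ?Q) (carrier T)"
      unfolding bij_betw_def car
    proof
      show "inj_on g (q ` carrier M)" by (rule inj_onI) (auto simp: g heq)
      show "g ` q ` carrier M = carrier T" using h(1) g by (simp add: image_image cong: image_cong)
    qed
    moreover have "g (q m \<oplus>\<^bsub>?Q\<^esub> q n) = g (q m) \<oplus>\<^bsub>T\<^esub> g (q n)" if "m \<in> carrier M" "n \<in> carrier M" for m n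
      using that by (simp add: add g h(2))
    moreover have "g (a \<odot>\<^bsub>?Q\<^esub> q m) = a \<odot>\<^bsub>T\<^esub> g (q m)" if "a \<in> carrier A" "m \<in> carrier M" for a m
      using that ac by (simp add: smult g h(3))
    ultimately show "module_iso A ?Q T" unfolding module_iso_def car by blast
  qed
qed

lemma submodule_carrier: "linear_module A M \<Longrightarrow> submodule (carrier M) A M"
proof -
  assume M: "linear_module A M"
  interpret abelian_group M using M unfolding linear_module_def by blast
  show ?thesis unfolding submodule_iff[OF M] using M unfolding linear_module_def by auto
qed

lemma rad_submodule:
  assumes M: "linear_module A M"
  shows "submodule (rad A M) A M"
proof -
  interpret abelian_group M using M unfolding linear_module_def by blast
  have "submodule N A M" if "maximal_submodule A M N" for N
    using that unfolding maximal_submodule_def by blast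
  then show ?thesis
    using submodule_carrier[OF M] unfolding submodule_iff[OF M] rad_def by auto
qed

lemma soc_submodule:
  assumes M: "linear_module A M"
  shows "submodule (soc A M) A M"
proof -
  interpret abelian_group M using M unfolding linear_module_def by blast
  let ?S = "\<Union>{N. simple_submodule A M N}"
  have s: "submodule N A M" if "simple_submodule A M N" for N
    using that unfolding simple_submodule_def by blast
  then have sub: "?S \<subseteq> carrier M" unfolding submodule_iff[OF M] by blast
  have g: "subgroup (soc A M) (add_monoid M)"
    unfolding soc_def using add.generate_is_subgroup[of ?S] sub by simp
  have "a \<odot>\<^bsub>M\<^esub> m \<in> soc A M" if a: "a \<in> carrier A" and "m \<in> soc A M" for a m
    using that(2) unfolding soc_def
  proof (induction m rule: generate.induct)
    case one
    then show ?case using linear_module_smult(1)[OF M a] generate.one[of "add_monoid M"] by simp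
  next
    case (incl m)
    then have "a \<odot>\<^bsub>M\<^esub> m \<in> ?S" using s a unfolding submodule_iff[OF M] by blast
    then show ?case by (rule generate.incl)
  next
    case (inv m)
    then have "a \<odot>\<^bsub>M\<^esub> m \<in> ?S" using s a unfolding submodule_iff[OF M] by blast
    moreover have "m \<in> carrier M" using inv sub by blast
    ultimately show ?case
      using generate.inv[of "a \<odot>\<^bsub>M\<^esub> m" ?S "add_monoid M"] linear_module_smult(2)[OF M a]
      by (simp add: a_inv_def)
  next
    case (eng m n)
    have "m \<in> carrier M" "n \<in> carrier M"
      using eng(1,2) add.generate_incl[of ?S] sub by auto
    then show ?case
      using generate.eng[OF eng(3,4)] M a unfolding linear_module_def by simp
  qed
  then show ?thesis using g unfolding submodule_def submodule_axioms_def by blast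
qed

lemma simple_in_soc: "simple_submodule A M N \<Longrightarrow> N \<subseteq> soc A M"
  unfolding soc_def by (auto intro: generate.incl)

lemma generate_subgroup:
  assumes "abelian_group M" "subgroup N (add_monoid M)"
  shows "generate (add_monoid M) N = N"
proof -
  interpret abelian_group M by (rule assms(1))
  show ?thesis using add.generate_subgroup_incl[of N N] assms(2) by (auto intro: generate.incl)
qed

section \<open>Modules generated at the vertex opposite to the socle\<close>

text \<open>The action \<open>m f\<close> pulled back to the path algebra, so that paths themselves
  act on modules.\<close>

definition act :: "(3 \<Rightarrow> point \<Rightarrow> int) \<Rightarrow> ('k::field comb set, 'm) module \<Rightarrow> 'm \<Rightarrow> 'k comb \<Rightarrow> 'm" where
  "act s M m f = cl (rauzy_ideal s) f \<odot>\<^bsub>M\<^esub> m"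

lemma rauzy_algebra_carrier: "carrier (rauzy_algebra s) = cl (rauzy_ideal s) ` combs"
  unfolding rauzy_algebra_def by (rule quot_simps(1)[OF two_sided_rauzy_ideal])

text \<open>Elements of the ideal have coefficient zero at trivial paths, so the coefficient is
  constant on a coset.\<close>

lemma trivial_coeff_cl:
  fixes f :: "'k::field comb"
  assumes "f \<in> combs"
  shows "trivial_coeff p (cl (rauzy_ideal s) f) = pcoeff f [p]"
  unfolding trivial_coeff_def
proof (rule the_equality)
  show "\<forall>g\<in>cl (rauzy_ideal s) f. pcoeff g [p] = pcoeff f [p]"
  proof
    fix g assume "g \<in> cl (rauzy_ideal s) f"
    then have "g - f \<in> rauzy_ideal s" using cl_iff[OF two_sided_rauzy_ideal] by blast
    from rauzy_ideal_short[OF this, of "[p]"] show "pcoeff g [p] = pcoeff f [p]"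
      by (simp add: lookup_minus)
  qed
  fix c assume "\<forall>g\<in>cl (rauzy_ideal s) f. pcoeff g [p] = c"
  from bspec[OF this cl_self[OF two_sided_rauzy_ideal]] show "c = pcoeff f [p]" by (rule sym)
qed

lemma smult_simple:
  "g \<in> combs \<Longrightarrow> cl (rauzy_ideal s) g \<odot>\<^bsub>simple_at p\<^esub> c = c * pcoeff g [p]"
  by (simp add: simple_at_def trivial_coeff_cl)

lemma abelian_group_simple_at: "abelian_group (simple_at p :: ('k::field comb set, 'k) module)"
proof (rule abelian_groupI)
  fix c :: 'k
  show "\<exists>d\<in>carrier (simple_at p). d \<oplus>\<^bsub>simple_at p\<^esub> c = \<zero>\<^bsub>simple_at p\<^esub>"
    by (rule bexI[of _ "- c"]) (simp_all add: simple_at_def)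
qed (simp_all add: simple_at_def add_ac)

lemma abelian_group_direct_sum:
  assumes "abelian_group M" "abelian_group N"
  shows "abelian_group (direct_sum M N)"
proof -
  interpret M: abelian_group M by (rule assms(1))
  interpret N: abelian_group N by (rule assms(2))
  show ?thesis
  proof (rule abelian_groupI)
    fix u assume "u \<in> carrier (direct_sum M N)"
    then show "\<exists>v\<in>carrier (direct_sum M N). v \<oplus>\<^bsub>direct_sum M N\<^esub> u = \<zero>\<^bsub>direct_sum M N\<^esub>"
      by (intro bexI[of _ "(\<ominus>\<^bsub>M\<^esub> fst u, \<ominus>\<^bsub>N\<^esub> snd u)"]) (auto simp: direct_sum_def M.l_neg N.l_neg)
  qed (auto simp: direct_sum_def M.a_ac N.a_ac)
qed

lemma pcoeff_single_mult:
  assumes "g \<in> combs" "u \<noteq> []"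
  shows "pcoeff (path_mult (single u a) g) w =
    (if take (length u) w = u then a * pcoeff g (last u # drop (length u) w) else 0)"
  using assms(1)
proof (induction g rule: combs_induct)
  case (single v b)
  obtain h t where v: "v = h # t" using paths_nonempty[OF single] by (metis list.exhaust)
  have "u @ t = w \<longleftrightarrow> take (length u) w = u \<and> drop (length u) w = t"
    by (metis append_eq_conv_conj)
  then show ?case by (auto simp: v path_mult_single lookup_single when_def)
qed (auto simp: path_mult_add_right lookup_add distrib_left)

text \<open>Opposite corners differ by two unit steps in different directions, which neither cancel
  nor can be undone by a single step.\<close>

lemma rhombus_distinct:
  assumes "rhombus z x y x'"
  shows "distinct [z, x, y, x']" "\<not> arrow y z"
proof -
  obtain p a e b f where sq: "square p a e b f" and Z: "z = projZ p" "x = projZ (p + axis a e)"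
    "y = projZ (p + axis a e + axis b f)" "x' = projZ (p + axis b f)"
    using assms unfolding rhombus_iff_lattice lattice_rhombus_def by blast
  have ab: "a \<noteq> b" and ef: "e \<noteq> 0" "f \<noteq> 0" and st: "p \<in> strip" "p + axis a e \<in> strip"
    "p + axis b f \<in> strip" "p + axis a e + axis b f \<in> strip"
    using sq unfolding square_def by auto
  have "(axis a e + axis b f) $ a = e" "(axis a e + axis b f) $ b = f" using ab by (simp_all add: axis_def)
  then have "axis a e + axis b f \<noteq> 0" using ef by (metis zero_index)
  moreover have "axis a e \<noteq> (0 :: int^3)" "axis b f \<noteq> (0 :: int^3)" "axis a e \<noteq> axis b f"
    using ef ab by (simp_all add: axis_eq_0_iff axis_eq_iff)
  ultimately show "distinct [z, x, y, x']" using st unfolding Z by (auto simp: add.assoc)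
  show "\<not> arrow y z"
  proof
    assume "arrow y z"
    then obtain c g where c: "p + axis a e + axis b f + axis c g \<in> strip" "z = projZ (p + axis a e + axis b f + axis c g)"
      using arrow_lift[OF st(4)] unfolding Z(3) by metis
    then have 0: "axis a e + axis b f + axis c g = 0" using st(1) Z(1) by (simp add: add.assoc)
    have "(axis a e + axis b f + axis c g) $ a = 0" "(axis a e + axis b f + axis c g) $ b = 0"
      unfolding 0 by simp_all
    then show False using ab ef by (auto simp: axis_def split: if_splits)
  qed
qed

section \<open>Paths acting on a right module\<close>

locale rauzy_module =
  fixes s :: "3 \<Rightarrow> point \<Rightarrow> int" and M :: "('k::field comb set, 'm) module"
  assumes M: "right_module (rauzy_algebra s) M"
begin

lemma linear: "linear_module (rauzy_algebra s) M"
  using M unfolding right_module_def linear_module_def by blast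

sublocale abelian_group M
  using M unfolding right_module_def by blast

lemma cl_carrier: "f \<in> combs \<Longrightarrow> cl (rauzy_ideal s) f \<in> carrier (rauzy_algebra s)"
  by (simp add: rauzy_algebra_carrier)

lemma smult_add:
  "a \<in> carrier (rauzy_algebra s) \<Longrightarrow> b \<in> carrier (rauzy_algebra s) \<Longrightarrow> m \<in> carrier M \<Longrightarrow>
    (a \<oplus>\<^bsub>rauzy_algebra s\<^esub> b) \<odot>\<^bsub>M\<^esub> m = a \<odot>\<^bsub>M\<^esub> m \<oplus>\<^bsub>M\<^esub> b \<odot>\<^bsub>M\<^esub> m"
  using M unfolding right_module_def by blast

lemma smult_mult:
  "a \<in> carrier (rauzy_algebra s) \<Longrightarrow> b \<in> carrier (rauzy_algebra s) \<Longrightarrow> m \<in> carrier M \<Longrightarrow>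
    (a \<otimes>\<^bsub>rauzy_algebra s\<^esub> b) \<odot>\<^bsub>M\<^esub> m = b \<odot>\<^bsub>M\<^esub> (a \<odot>\<^bsub>M\<^esub> m)"
  using M unfolding right_module_def by blast

lemma act_closed [simp]: "m \<in> carrier M \<Longrightarrow> f \<in> combs \<Longrightarrow> act s M m f \<in> carrier M"
  using M cl_carrier unfolding act_def right_module_def by blast

lemma act_add:
  assumes "m \<in> carrier M" "f \<in> combs" "g \<in> combs"
  shows "act s M m (f + g) = act s M m f \<oplus>\<^bsub>M\<^esub> act s M m g"
proof -
  have "cl (rauzy_ideal s) (f + g) = cl (rauzy_ideal s) f \<oplus>\<^bsub>rauzy_algebra s\<^esub> cl (rauzy_ideal s) g"
    unfolding rauzy_algebra_def by (rule quot_add[OF two_sided_rauzy_ideal, symmetric])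
  then show ?thesis using smult_add[OF cl_carrier[OF assms(2)] cl_carrier[OF assms(3)] assms(1)]
    unfolding act_def by simp
qed

lemma act_mult:
  assumes "m \<in> carrier M" "f \<in> combs" "g \<in> combs"
  shows "act s M m (path_mult f g) = act s M (act s M m f) g"
proof -
  have "cl (rauzy_ideal s) (path_mult f g) = cl (rauzy_ideal s) f \<otimes>\<^bsub>rauzy_algebra s\<^esub> cl (rauzy_ideal s) g"
    unfolding rauzy_algebra_def by (rule quot_mult[OF two_sided_rauzy_ideal assms(2,3), symmetric])
  then show ?thesis using smult_mult[OF cl_carrier[OF assms(2)] cl_carrier[OF assms(3)] assms(1)]
    unfolding act_def by simp
qed

lemma act_zero [simp]: "m \<in> carrier M \<Longrightarrow> act s M m 0 = \<zero>\<^bsub>M\<^esub>"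
proof -
  assume m: "m \<in> carrier M"
  have "act s M m 0 = act s M m 0 \<oplus>\<^bsub>M\<^esub> act s M m 0" using act_add[OF m, of 0 0] by simp
  then show ?thesis using add.l_cancel_one'[of "act s M m 0" "act s M m 0"] m by simp
qed

lemma act_zero_left [simp]: "f \<in> combs \<Longrightarrow> act s M \<zero>\<^bsub>M\<^esub> f = \<zero>\<^bsub>M\<^esub>"
  using linear_module_smult(1)[OF linear cl_carrier] by (simp add: act_def)

lemma act_cong: "f - g \<in> rauzy_ideal s \<Longrightarrow> act s M m f = act s M m g"
  using cl_cong[OF two_sided_rauzy_ideal] unfolding act_def by metis

lemma act_diff:
  assumes "m \<in> carrier M" "f \<in> combs" "g \<in> combs"
  shows "act s M m f = act s M m g \<longleftrightarrow> act s M m (f - g) = \<zero>\<^bsub>M\<^esub>"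
  using act_add[OF assms(1), of "f - g" g] assms by (simp add: add.r_cancel_one)

lemma act_prefix:
  assumes "m \<in> carrier M" "act s M m (pth u) = \<zero>\<^bsub>M\<^esub>" "u \<in> paths" "last u # v \<in> paths"
  shows "act s M m (single (u @ v) a) = \<zero>\<^bsub>M\<^esub>"
proof -
  have "single (u @ v) a = path_mult (pth u) (single (last u # v) a)"
    by (simp add: pth_def path_mult_single)
  then show ?thesis using assms act_mult by simp
qed

text \<open>Multiplying by the trivial path at the end of \<open>u\<close>, scaled by
  \<open>1 / a\<close>, amounts to dividing by \<open>a\<close>.\<close>

lemma act_scale_cancel:
  assumes "m \<in> carrier M" "u \<in> paths" "act s M m (pth u) \<noteq> \<zero>\<^bsub>M\<^esub>"
    "act s M m (single u a) = \<zero>\<^bsub>M\<^esub>"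
  shows "a = 0"
proof (rule ccontr)
  assume a: "a \<noteq> 0"
  have l: "[last u] \<in> paths" by (rule paths_last[OF assms(2)])
  have "pth u = path_mult (single u a) (single [last u] (1 / a))"
    using a by (simp add: pth_def path_mult_single)
  then have "act s M m (pth u) = \<zero>\<^bsub>M\<^esub>" using assms l by (simp add: act_mult)
  then show False using assms(3) by blast
qed

text \<open>Killed by all arrows, \<open>n\<close> spans a one-dimensional submodule, which is
  therefore simple.\<close>

lemma simple_span:
  assumes n: "n \<in> carrier M" "n \<noteq> \<zero>\<^bsub>M\<^esub>" and p: "p \<in> vertices" "act s M n (pth [p]) = n"
    and ar: "\<And>w. arrow p w \<Longrightarrow> act s M n (pth [p, w]) = \<zero>\<^bsub>M\<^esub>"
  shows "n \<in> soc (rauzy_algebra s) M"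
proof -
  define S where "S = act s M n ` combs"
  have P: "[p] \<in> paths" using p by (simp add: paths_single)
  \<comment> \<open>Only the trivial path at \<open>p\<close> contributes: every other path starts
    elsewhere or begins with an arrow from \<open>p\<close>.\<close>
  have scalar: "act s M n f = act s M n (single [p] (pcoeff f [p]))" if "f \<in> combs" for f
    using that
  proof (induction f rule: combs_induct)
    case zero
    then show ?case by simp
  next
    case (add f g)
    then show ?case using n P by (simp add: act_add lookup_add single_add)
  next
    case (single u a)
    consider "hd u \<noteq> p" | "u = [p]" | w v where "u = p # w # v"
      using paths_nonempty[OF single] by (cases u; cases "tl u") auto
    then show ?case
    proof cases
      case 1
      have "act s M n (single u a) = act s M (act s M n (pth [p])) (single u a)"
        using p by simp
      also have "\<dots> = act s M n (path_mult (pth [p]) (single u a))"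
        using n P single by (simp add: act_mult)
      also have "\<dots> = \<zero>\<^bsub>M\<^esub>" using 1 n by (simp add: pth_def path_mult_single)
      finally show ?thesis using 1 n by (auto simp: lookup_single when_def)
    next
      case 2
      then show ?thesis by simp
    next
      case 3
      then have "arrow p w" "w # v \<in> paths" "[p, w] \<in> paths"
        using single arrow_vertices[of p w] by (auto simp: paths_Cons paths_single)
      then have "act s M n (single ([p, w] @ v) a) = \<zero>\<^bsub>M\<^esub>"
        using act_prefix[OF n(1) ar, of w v a] by simp
      then show ?thesis using 3 n by (simp add: lookup_single)
    qed
  qed
  have Ssub: "submodule S (rauzy_algebra s) M"
    unfolding submodule_iff[OF linear]
  proof (intro conjI ballI)
    show "S \<subseteq> carrier M" using n unfolding S_def by auto
    show "\<zero>\<^bsub>M\<^esub> \<in> S" using n unfolding S_def by (auto intro: image_eqI[of _ _ 0])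
    fix m m' assume "m \<in> S" "m' \<in> S"
    then obtain f g where "f \<in> combs" "g \<in> combs" "m = act s M n f" "m' = act s M n g" unfolding S_def by blast
    then show "m \<oplus>\<^bsub>M\<^esub> m' \<in> S" using n unfolding S_def by (auto intro: image_eqI[of _ _ "f + g"] simp: act_add)
  next
    fix m assume "m \<in> S"
    then obtain f where f: "f \<in> combs" "m = act s M n f" unfolding S_def by blast
    have "act s M n (- f) \<oplus>\<^bsub>M\<^esub> act s M n f = \<zero>\<^bsub>M\<^esub>" using f n act_add[of n "- f" f] by simp
    then have "\<ominus>\<^bsub>M\<^esub> m = act s M n (- f)" using f n by (intro minus_equality) auto
    then show "\<ominus>\<^bsub>M\<^esub> m \<in> S" using f unfolding S_def by auto
  next
    fix a :: "'k comb set" and m assume "a \<in> carrier (rauzy_algebra s)" "m \<in> S"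
    then obtain f g where "f \<in> combs" "g \<in> combs" "m = act s M n f" "a = cl (rauzy_ideal s) g"
      unfolding S_def rauzy_algebra_carrier by blast
    then have "a \<odot>\<^bsub>M\<^esub> m = act s M n (path_mult f g)" using n by (simp add: act_mult) (simp add: act_def)
    then show "a \<odot>\<^bsub>M\<^esub> m \<in> S" using \<open>f \<in> combs\<close> \<open>g \<in> combs\<close> unfolding S_def by auto
  qed
  have nS: "n \<in> S" unfolding S_def using p P by (auto intro: image_eqI[of _ _ "pth [p]"])
  have "L = {\<zero>\<^bsub>M\<^esub>} \<or> L = S" if L: "submodule L (rauzy_algebra s) M" "L \<subseteq> S" for L
  proof (cases "L = {\<zero>\<^bsub>M\<^esub>}")
    case False
    note Ls = L(1)[unfolded submodule_iff[OF linear]]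
    obtain m where m: "m \<in> L" "m \<noteq> \<zero>\<^bsub>M\<^esub>" using False Ls by blast
    then obtain f where f: "f \<in> combs" "m = act s M n f" using L(2) unfolding S_def by blast
    define c where "c = pcoeff f [p]"
    have mc: "m = act s M n (single [p] c)" using f scalar unfolding c_def by blast
    then have c: "c \<noteq> 0" using m n by auto
    have Lact: "act s M l g \<in> L" if "l \<in> L" "g \<in> combs" for l g
      using Ls that cl_carrier unfolding act_def by blast
    have "act s M m (single [p] (1 / c)) = n"
      unfolding mc using n P c p(2) by (simp add: act_mult[symmetric] path_mult_single pth_def)
    then have "n \<in> L" using Lact[OF m(1), of "single [p] (1 / c)"] P by simp
    then have "S \<subseteq> L" using Lact unfolding S_def by blast
    then show ?thesis using L(2) by blast
  qed blast
  then have "simple_submodule (rauzy_algebra s) M S"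
    unfolding simple_submodule_def using Ssub nS n(2) by blast
  then show ?thesis using simple_in_soc nS by blast
qed

end

text \<open>Coordinates of \<open>n f\<close> with respect to the basis \<open>n, n [y, x], n [y, x'], n [y, x, z]\<close> of a module with
  generator \<open>n\<close>, in which \<open>n [y, x', z] = n [y, x, z]\<close>.\<close>

definition coefs :: "point \<Rightarrow> point \<Rightarrow> point \<Rightarrow> point \<Rightarrow> 'k::field comb \<Rightarrow> 'k \<times> 'k \<times> 'k \<times> 'k" where
  "coefs z x y x' f = (pcoeff f [y], pcoeff f [y, x], pcoeff f [y, x'], pcoeff f [y, x, z] + pcoeff f [y, x', z])"

text \<open>A section of \<open>coefs\<close>: the representative of given coordinates that takes
  the route through \<open>x\<close>.\<close>

definition nf :: "point \<Rightarrow> point \<Rightarrow> point \<Rightarrow> point \<Rightarrow> 'k \<times> 'k \<times> 'k \<times> 'k \<Rightarrow> 'k::field comb" where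
  "nf z x y x' = (\<lambda>(\<alpha>, \<beta>, \<gamma>, \<delta>). single [y] \<alpha> + single [y, x] \<beta> +
     single [y, x'] \<gamma> + single [y, x, z] \<delta>)"

text \<open>Only the shortest paths acting as zero are listed; \<open>act_prefix\<close> extends
  this to all paths that begin with them.\<close>

definition generator :: "(3 \<Rightarrow> point \<Rightarrow> int) \<Rightarrow> point \<Rightarrow> point \<Rightarrow> point \<Rightarrow> point \<Rightarrow>
    ('k::field comb set, 'm) module \<Rightarrow> 'm \<Rightarrow> bool" where
  "generator s z x y x' M n \<longleftrightarrow> n \<in> carrier M \<and> act s M n (pth [y]) = n \<and>
     (\<forall>w. arrow y w \<and> w \<noteq> x \<and> w \<noteq> x' \<longrightarrow> act s M n (pth [y, w]) = \<zero>\<^bsub>M\<^esub>) \<and>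
     (\<forall>w\<in>{x, x'}. \<forall>v. arrow w v \<and> v \<noteq> z \<longrightarrow> act s M n (pth [y, w, v]) = \<zero>\<^bsub>M\<^esub>) \<and>
     (\<forall>w. arrow z w \<longrightarrow> act s M n (pth [y, x, z, w]) = \<zero>\<^bsub>M\<^esub>) \<and>
     act s M n (pth [y, x, z]) \<noteq> \<zero>\<^bsub>M\<^esub> \<and> carrier M = act s M n ` combs"

section \<open>Coordinates on a module with a generator\<close>

locale rauzy_rhombus =
  fixes s :: "3 \<Rightarrow> point \<Rightarrow> int" and z x y x' :: point
  assumes sign: "sign_choice s" and r: "rhombus z x y x'"
begin

lemma distinct: "z \<noteq> x" "z \<noteq> y" "z \<noteq> x'" "x \<noteq> y" "x \<noteq> x'" "y \<noteq> x'"
   "x \<noteq> z" "y \<noteq> z" "x' \<noteq> z" "y \<noteq> x" "x' \<noteq> x" "x' \<noteq> y"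
  using rhombus_distinct(1)[OF r] by auto

lemma arrows: "arrow z x" "arrow x z" "arrow x y" "arrow y x" "arrow z x'" "arrow x' z" "arrow x' y" "arrow y x'"
  using rhombus_arrows[OF r] arrow_sym by blast+

lemma vertices: "z \<in> vertices" "x \<in> vertices" "y \<in> vertices" "x' \<in> vertices"
  using arrows arrow_vertices by blast+

lemmas path_simps = arrows vertices paths_Cons paths_single

lemma backwards: "rhombus y x z x'"
  using rhombus_flip[OF rhombus_swap[OF rhombus_flip[OF r]]] .

lemma two_ways: "z # ys \<in> paths \<Longrightarrow> (pth (y # x # z # ys) - pth (y # x' # z # ys) :: 'k::field comb) \<in> rauzy_ideal s"
  using rhombus_path[OF sign refl, of "[]" y z ys, OF _ _ backwards, where 'k='k] by (simp add: path_simps)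

abbreviation "co \<equiv> coefs z x y x'"
abbreviation "nform \<equiv> nf z x y x'"

lemma co_add: "co (f + g) = co f + co g"
  by (simp add: coefs_def lookup_add algebra_simps)

lemma co_diff: "co (f - g) = co f - co g"
  by (simp add: coefs_def lookup_minus algebra_simps)

lemma co_zero [simp]: "co 0 = 0"
  by (simp add: coefs_def zero_prod_def)

lemma nform_add: "nform (t + u) = nform t + nform u"
  by (cases t; cases u) (simp add: nf_def single_add algebra_simps)

lemma nform_zero [simp]: "nform 0 = 0"
  by (simp add: nf_def zero_prod_def)

lemma nform_combs [simp]: "nform t \<in> combs"
  by (cases t) (simp add: nf_def path_simps)

lemma co_nform [simp]: "co (nform t) = t"
  using distinct by (cases t) (simp add: nf_def coefs_def lookup_add lookup_single when_def)

lemma co_mult: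
  assumes "g \<in> combs"
  shows "co (path_mult (nform (\<alpha>, \<beta>, \<gamma>, \<delta>)) g) = (\<alpha> * pcoeff g [y],
    \<alpha> * pcoeff g [y, x] + \<beta> * pcoeff g [x], \<alpha> * pcoeff g [y, x'] + \<gamma> * pcoeff g [x'],
    \<alpha> * (pcoeff g [y, x, z] + pcoeff g [y, x', z]) + \<beta> * pcoeff g [x, z] + \<gamma> * pcoeff g [x', z] + \<delta> * pcoeff g [z])"
  using assms distinct
  by (simp add: nf_def coefs_def path_mult_add_left lookup_add pcoeff_single_mult algebra_simps)

end

locale rauzy_rhombus_generator = rauzy_rhombus s z x y x' + rauzy_module s M
  for s z x y x' and M :: "('k::field comb set, 'm) module" +
  fixes n
  assumes gen: "generator s z x y x' M n"
begin

lemma n: "n \<in> carrier M" "act s M n (pth [y]) = n" "act s M n (pth [y, x, z]) \<noteq> \<zero>\<^bsub>M\<^esub>"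
    "carrier M = act s M n ` combs"
  using gen unfolding generator_def by blast+

lemma act_two_ways: "z # ys \<in> paths \<Longrightarrow> act s M n (pth (y # x' # z # ys)) = act s M n (pth (y # x # z # ys))"
  using act_cong[OF two_ways] by metis

lemma act_two_ways_single: "act s M n (single [y, x', z] a) = act s M n (single [y, x, z] a)"
proof -
  have "act s M n (path_mult (pth [y, x', z]) (single [z] a)) =
      act s M n (path_mult (pth [y, x, z]) (single [z] a))"
    using n(1) act_two_ways[of "[]"] by (simp add: act_mult path_simps)
  then show ?thesis by (simp add: pth_def path_mult_single)
qed

text \<open>Such a path starts elsewhere than at \<open>y\<close>, or one of the killed paths in
  \<open>generator\<close> is an initial segment of it.\<close>

lemma act_other:
  assumes u: "u \<in> paths" "u \<notin> {[y], [y, x], [y, x'], [y, x, z], [y, x', z]}"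
  shows "act s M n (single u a) = \<zero>\<^bsub>M\<^esub>"
proof (cases "hd u = y")
  case False
  have "act s M n (single u a) = act s M (act s M n (pth [y])) (single u a)"
    using n by simp
  also have "\<dots> = act s M n (path_mult (pth [y]) (single u a))"
    using n(1) u path_simps by (simp add: act_mult)
  also have "\<dots> = \<zero>\<^bsub>M\<^esub>" using False n(1) by (simp add: pth_def path_mult_single)
  finally show ?thesis .
next
  case True
  then obtain u1 where u1: "u = y # u1" using paths_nonempty[OF u(1)] by (metis list.collapse)
  then obtain w u2 where u2: "u1 = w # u2" using u(2) by (cases u1) auto
  have w: "arrow y w" "w # u2 \<in> paths" "w \<in> vertices"
    using u(1) arrow_vertices unfolding u1 u2 by (auto simp: paths_Cons)
  show ?thesis
  proof (cases "w \<in> {x, x'}")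
    case False
    then have "act s M n (pth [y, w]) = \<zero>\<^bsub>M\<^esub>" using gen w(1) unfolding generator_def by blast
    from act_prefix[OF n(1) this, of u2 a] show ?thesis
      unfolding u1 u2 using w by (simp add: path_simps)
  next
    case wx: True
    then obtain v u3 where u3: "u2 = v # u3" using u(2) unfolding u1 u2 by (cases u2) auto
    have v: "arrow w v" "v # u3 \<in> paths" "v \<in> vertices"
      using w(2) arrow_vertices unfolding u3 by (auto simp: paths_Cons)
    show ?thesis
    proof (cases "v = z")
      case False
      then have "act s M n (pth [y, w, v]) = \<zero>\<^bsub>M\<^esub>" using gen v(1) wx unfolding generator_def by blast
      from act_prefix[OF n(1) this, of u3 a] show ?thesis
        unfolding u1 u2 u3 using w v by (simp add: path_simps)
    next
      case vz: True
      then obtain v' u4 where u4: "u3 = v' # u4" using u(2) wx unfolding u1 u2 u3 by (cases u3) auto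
      have v': "arrow z v'" "v' # u4 \<in> paths" "v' \<in> vertices"
        using v(2) arrow_vertices unfolding u4 vz by (auto simp: paths_Cons)
      \<comment> \<open>The condition in \<open>generator\<close> concerns the route through
        \<open>x\<close>; the other route acts in the same way.\<close>
      have "act s M n (pth [y, x, z, v']) = \<zero>\<^bsub>M\<^esub>" using gen v'(1) unfolding generator_def by blast
      then have "act s M n (pth [y, w, z, v']) = \<zero>\<^bsub>M\<^esub>"
        using wx act_two_ways[of "[v']"] v' by (auto simp: path_simps)
      from act_prefix[OF n(1) this, of u4 a] show ?thesis
        unfolding u1 u2 u3 u4 vz using w v v' vz by (simp add: path_simps)
    qed
  qed
qed

lemma act_nform: "f \<in> combs \<Longrightarrow> act s M n f = act s M n (nform (co f))"
proof (induction f rule: combs_induct)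
  case zero
  then show ?case by simp
next
  case (add f g)
  then show ?case using n(1) by (simp add: co_add nform_add act_add)
next
  case (single u a)
  show ?case
  proof (cases "u \<in> {[y], [y, x], [y, x'], [y, x, z], [y, x', z]}")
    case True
    then show ?thesis
      using distinct act_two_ways_single by (auto simp: coefs_def nf_def lookup_single when_def)
  next
    case False
    then have "co (single u a) = 0"
      by (auto simp: coefs_def lookup_single when_def zero_prod_def)
    then show ?thesis using act_other[OF single False] n(1) by simp
  qed
qed

text \<open>Multiplication by the rest of a path to \<open>z\<close> isolates one coordinate in
  front of the nonzero element \<open>n [y, x, z]\<close>: \<open>[y, x, z]\<close> isolates
  \<alpha>, then \<open>[x, z]\<close> isolates \<beta> and \<open>[x', z]\<close> isolates
  \<gamma>.\<close>

lemma act_nform_zero: "act s M n (nform t) = \<zero>\<^bsub>M\<^esub> \<Longrightarrow> t = 0"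
proof -
  assume 0: "act s M n (nform t) = \<zero>\<^bsub>M\<^esub>"
  obtain \<alpha> \<beta> \<gamma> \<delta> where t: "t = (\<alpha>, \<beta>, \<gamma>, \<delta>)" by (metis prod.exhaust)
  have mult: "act s M n (path_mult (nform t) g) = \<zero>\<^bsub>M\<^esub>" if "g \<in> combs" for g
    using that 0 n(1) by (simp add: act_mult)
  have P: "[y, x, z] \<in> paths" "[x, z] \<in> paths" "[x', z] \<in> paths" by (simp_all add: path_simps)
  note cancel = act_scale_cancel[OF n(1) P(1) n(3)]
  have "path_mult (nform t) (pth [y, x, z]) = single [y, x, z] \<alpha>"
    using distinct by (simp add: t nf_def pth_def path_mult_add_left path_mult_single)
  then have a: "\<alpha> = 0" using mult[of "pth [y, x, z]"] P cancel by simp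
  have "path_mult (nform t) (pth [x, z]) = single [y, x, z] \<beta>"
    using distinct by (simp add: t nf_def pth_def path_mult_add_left path_mult_single)
  then have b: "\<beta> = 0" using mult[of "pth [x, z]"] P cancel by simp
  have "path_mult (nform t) (pth [x', z]) = single [y, x', z] \<gamma>"
    using distinct by (simp add: t nf_def pth_def path_mult_add_left path_mult_single)
  then have c: "\<gamma> = 0" using mult[of "pth [x', z]"] P cancel act_two_ways_single by simp
  have "\<delta> = 0" using 0 cancel a b c by (simp add: t nf_def)
  then show ?thesis using a b c t by (simp add: zero_prod_def)
qed

lemma act_eq_iff: "f \<in> combs \<Longrightarrow> g \<in> combs \<Longrightarrow> act s M n f = act s M n g \<longleftrightarrow> co f = co g"
proof -
  assume f: "f \<in> combs" "g \<in> combs"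
  have "act s M n f = act s M n g \<longleftrightarrow> act s M n (nform (co (f - g))) = \<zero>\<^bsub>M\<^esub>"
    using act_diff[OF n(1) f] act_nform[of "f - g"] f by simp
  also have "\<dots> \<longleftrightarrow> co (f - g) = 0" using act_nform_zero[of "co (f - g)"] n(1) by auto
  also have "\<dots> \<longleftrightarrow> co f = co g" by (simp add: co_diff)
  finally show ?thesis .
qed

definition coord :: "'m \<Rightarrow> 'k \<times> 'k \<times> 'k \<times> 'k" where
  "coord m = co (SOME f. f \<in> combs \<and> m = act s M n f)"

lemma coord_act: "f \<in> combs \<Longrightarrow> coord (act s M n f) = co f"
proof -
  assume f: "f \<in> combs"
  have "(SOME g. g \<in> combs \<and> act s M n f = act s M n g) \<in> combs \<and>
      act s M n f = act s M n (SOME g. g \<in> combs \<and> act s M n f = act s M n g)"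
    by (rule someI[of _ f]) (use f in simp)
  then show ?thesis unfolding coord_def using act_eq_iff[OF f] by metis
qed

definition elt :: "'k \<times> 'k \<times> 'k \<times> 'k \<Rightarrow> 'm" where
  "elt t = act s M n (nform t)"

lemma elt_closed [simp]: "elt t \<in> carrier M"
  using n(1) by (simp add: elt_def)

lemma coord_elt [simp]: "coord (elt t) = t"
  by (simp add: elt_def coord_act)

lemma elt_coord: "m \<in> carrier M \<Longrightarrow> elt (coord m) = m"
proof -
  assume "m \<in> carrier M"
  then obtain f where "f \<in> combs" "m = act s M n f" using n(4) by blast
  then show ?thesis using act_nform[of f] by (simp add: coord_act elt_def)
qed

lemma coord_inj: "m \<in> carrier M \<Longrightarrow> m' \<in> carrier M \<Longrightarrow> coord m = coord m' \<Longrightarrow> m = m'"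
  by (metis elt_coord)

lemma coord_add: "m \<in> carrier M \<Longrightarrow> m' \<in> carrier M \<Longrightarrow> coord (m \<oplus>\<^bsub>M\<^esub> m') = coord m + coord m'"
proof -
  assume m: "m \<in> carrier M" "m' \<in> carrier M"
  have "m \<oplus>\<^bsub>M\<^esub> m' = act s M n (nform (coord m) + nform (coord m'))"
    using n(1) elt_coord[OF m(1)] elt_coord[OF m(2)] by (simp add: act_add elt_def)
  then show ?thesis by (simp add: coord_act co_add)
qed

lemma coord_zero: "coord \<zero>\<^bsub>M\<^esub> = 0"
  using coord_act[of 0] n(1) by simp

lemma coord_eq_zero: "m \<in> carrier M \<Longrightarrow> coord m = 0 \<longleftrightarrow> m = \<zero>\<^bsub>M\<^esub>"
  using coord_inj[of m "\<zero>\<^bsub>M\<^esub>"] coord_zero by auto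

lemma coord_minus: "m \<in> carrier M \<Longrightarrow> coord (\<ominus>\<^bsub>M\<^esub> m) = - coord m"
  using coord_add[of "\<ominus>\<^bsub>M\<^esub> m" m] coord_zero by (simp add: l_neg eq_neg_iff_add_eq_0)

lemma coord_mult:
  assumes "m \<in> carrier M" "g \<in> combs" "coord m = (\<alpha>, \<beta>, \<gamma>, \<delta>)"
  shows "coord (act s M m g) = (\<alpha> * pcoeff g [y],
    \<alpha> * pcoeff g [y, x] + \<beta> * pcoeff g [x], \<alpha> * pcoeff g [y, x'] + \<gamma> * pcoeff g [x'],
    \<alpha> * (pcoeff g [y, x, z] + pcoeff g [y, x', z]) + \<beta> * pcoeff g [x, z] + \<gamma> * pcoeff g [x', z] + \<delta> * pcoeff g [z])"
proof -
  have "act s M m g = act s M n (path_mult (nform (\<alpha>, \<beta>, \<gamma>, \<delta>)) g)"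
    using elt_coord[OF assms(1)] assms n(1) by (simp add: act_mult elt_def)
  then show ?thesis using assms(2) by (simp add: coord_act co_mult)
qed

lemma submodule_act:
  "submodule L (rauzy_algebra s) M \<Longrightarrow> l \<in> L \<Longrightarrow> g \<in> combs \<Longrightarrow> act s M l g \<in> L"
  using cl_carrier unfolding submodule_iff[OF linear] act_def by blast

section \<open>Radical, socle and the layer between them\<close>

definition Rd :: "'m set" where "Rd = {m \<in> carrier M. fst (coord m) = 0}"
definition Sc :: "'m set" where "Sc = {m \<in> carrier M. \<exists>\<delta>. coord m = (0, 0, 0, \<delta>)}"

lemma Rd_submodule: "submodule Rd (rauzy_algebra s) M"
  unfolding submodule_iff[OF linear]
proof (intro conjI ballI)
  fix a :: "'k comb set" and m assume a: "a \<in> carrier (rauzy_algebra s)" and m: "m \<in> Rd"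
  obtain g where g: "g \<in> combs" "a \<odot>\<^bsub>M\<^esub> m = act s M m g"
    using a unfolding rauzy_algebra_carrier act_def by blast
  obtain \<alpha> \<beta> \<gamma> \<delta> where c: "coord m = (\<alpha>, \<beta>, \<gamma>, \<delta>)" by (metis prod.exhaust)
  then show "a \<odot>\<^bsub>M\<^esub> m \<in> Rd" using m g coord_mult[OF _ g(1) c] unfolding Rd_def by auto
qed (auto simp: Rd_def coord_zero coord_add coord_minus)

lemma Sc_submodule: "submodule Sc (rauzy_algebra s) M"
  unfolding submodule_iff[OF linear]
proof (intro conjI ballI)
  fix a :: "'k comb set" and m assume a: "a \<in> carrier (rauzy_algebra s)" and m: "m \<in> Sc"
  obtain g where g: "g \<in> combs" "a \<odot>\<^bsub>M\<^esub> m = act s M m g"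
    using a unfolding rauzy_algebra_carrier act_def by blast
  obtain \<delta> where c: "coord m = (0, 0, 0, \<delta>)" using m unfolding Sc_def by blast
  then show "a \<odot>\<^bsub>M\<^esub> m \<in> Sc" using m g coord_mult[OF _ g(1) c] unfolding Sc_def by auto
qed (auto simp: Sc_def coord_zero coord_add coord_minus zero_prod_def)

lemma generator_in: "submodule L (rauzy_algebra s) M \<Longrightarrow> n \<in> L \<Longrightarrow> L = carrier M"
proof -
  assume L: "submodule L (rauzy_algebra s) M" "n \<in> L"
  then have "carrier M \<subseteq> L" unfolding n(4) using submodule_act by blast
  then show ?thesis using L(1) unfolding submodule_iff[OF linear] by blast
qed

text \<open>If the first coordinate \<alpha> is nonzero, the trivial path at \<open>y\<close>,
  scaled by \<open>1 / \<alpha>\<close>, turns \<open>m\<close> into \<open>n\<close> itself,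
  because the other basis elements end elsewhere.\<close>

lemma not_in_Rd:
  assumes L: "submodule L (rauzy_algebra s) M" and m: "m \<in> L" "m \<notin> Rd"
  shows "L = carrier M"
proof -
  have mc: "m \<in> carrier M" using L m unfolding submodule_iff[OF linear] by blast
  obtain \<alpha> \<beta> \<gamma> \<delta> where c: "coord m = (\<alpha>, \<beta>, \<gamma>, \<delta>)" by (metis prod.exhaust)
  have a: "\<alpha> \<noteq> 0" using m(2) mc c unfolding Rd_def by simp
  have P: "(single [y] (1 / \<alpha>)) \<in> combs" by (simp add: path_simps)
  have "coord (act s M m (single [y] (1 / \<alpha>))) = (1, 0, 0, 0)"
    using a distinct coord_mult[OF mc P c] by (simp add: lookup_single when_def)
  moreover have "coord n = (1, 0, 0, 0)"
    using n(2) coord_act[of "pth [y]"] by (simp add: path_simps coefs_def pth_def lookup_single)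
  ultimately have "act s M m (single [y] (1 / \<alpha>)) = n"
    using mc P n(1) by (intro coord_inj) auto
  then have "n \<in> L" using submodule_act[OF L m(1) P] by simp
  then show ?thesis using generator_in[OF L] by blast
qed

text \<open>From a nonzero coordinate, the remaining path to \<open>z\<close>, suitably scaled,
  reaches any given element of the socle. Taking the coordinates in order, the earlier ones already
  vanish.\<close>

lemma Sc_le:
  assumes L: "submodule L (rauzy_algebra s) M" "L \<noteq> {\<zero>\<^bsub>M\<^esub>}"
  shows "Sc \<subseteq> L"
proof -
  note Ls = L(1)[unfolded submodule_iff[OF linear]]
  obtain m where m: "m \<in> L" "m \<noteq> \<zero>\<^bsub>M\<^esub>" using Ls L(2) by blast
  have mc: "m \<in> carrier M" using Ls m by blast
  obtain \<alpha> \<beta> \<gamma> \<delta> where c: "coord m = (\<alpha>, \<beta>, \<gamma>, \<delta>)" by (metis prod.exhaust)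
  have P: "[y, x, z] \<in> paths" "[x, z] \<in> paths" "[x', z] \<in> paths" "[z] \<in> paths" by (simp_all add: path_simps)
  have in_L: "elt (0, 0, 0, \<epsilon>) \<in> L" for \<epsilon>
  proof (rule ccontr)
    assume no: "elt (0, 0, 0, \<epsilon>) \<notin> L"
    have *: "coord (act s M m g) \<noteq> (0, 0, 0, \<epsilon>)" if "g \<in> combs" for g
      using no submodule_act[OF L(1) m(1) that] elt_coord[of "act s M m g"] mc that by auto
    note ** = *[unfolded coord_mult[OF mc _ c]]
    have a: "\<alpha> = 0"
    proof (rule ccontr)
      assume "\<alpha> \<noteq> 0"
      then show False
        using *[of "single [y, x, z] (\<epsilon> / \<alpha>)"]
          coord_mult[OF mc _ c, of "single [y, x, z] (\<epsilon> / \<alpha>)"] P distinct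
        by (simp add: lookup_single when_def)
    qed
    have b: "\<beta> = 0"
    proof (rule ccontr)
      assume "\<beta> \<noteq> 0"
      then show False
        using *[of "single [x, z] (\<epsilon> / \<beta>)"]
          coord_mult[OF mc _ c, of "single [x, z] (\<epsilon> / \<beta>)"] P distinct a
        by (simp add: lookup_single when_def)
    qed
    have g: "\<gamma> = 0"
    proof (rule ccontr)
      assume "\<gamma> \<noteq> 0"
      then show False
        using *[of "single [x', z] (\<epsilon> / \<gamma>)"]
          coord_mult[OF mc _ c, of "single [x', z] (\<epsilon> / \<gamma>)"] P distinct a b
        by (simp add: lookup_single when_def)
    qed
    have "\<delta> = 0"
    proof (rule ccontr)
      assume "\<delta> \<noteq> 0"
      then show False
        using *[of "single [z] (\<epsilon> / \<delta>)"]
          coord_mult[OF mc _ c, of "single [z] (\<epsilon> / \<delta>)"] P distinct a b g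
        by (simp add: lookup_single when_def)
    qed
    then have "coord m = 0" using a b g c by (simp add: zero_prod_def)
    then show False using coord_eq_zero[OF mc] m(2) by blast
  qed
  show ?thesis
  proof
    fix m' assume "m' \<in> Sc"
    then obtain \<epsilon> where "m' \<in> carrier M" "coord m' = (0, 0, 0, \<epsilon>)" unfolding Sc_def by blast
    then have "m' = elt (0, 0, 0, \<epsilon>)" using elt_coord[of m'] by simp
    then show "m' \<in> L" using in_L by simp
  qed
qed

text \<open>By \<open>not_in_Rd\<close> every proper submodule lies in \<open>Rd\<close>, which
  makes it the only maximal one.\<close>

lemma rad_eq: "rad (rauzy_algebra s) M = Rd"
proof -
  have "elt (1, 0, 0, 0) \<in> carrier M" "elt (1, 0, 0, 0) \<notin> Rd" unfolding Rd_def by simp_all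
  then have ne: "Rd \<noteq> carrier M" by blast
  have lt: "N \<subseteq> Rd" if "submodule N (rauzy_algebra s) M" "N \<noteq> carrier M" for N
    using not_in_Rd[OF that(1)] that(2) by blast
  have "maximal_submodule (rauzy_algebra s) M Rd"
    unfolding maximal_submodule_def using Rd_submodule ne lt by blast
  moreover have "N = Rd" if "maximal_submodule (rauzy_algebra s) M N" for N
  proof -
    have "submodule N (rauzy_algebra s) M" "N \<noteq> carrier M" using that unfolding maximal_submodule_def by blast+
    then show ?thesis using that lt Rd_submodule ne unfolding maximal_submodule_def by metis
  qed
  ultimately have "{N. maximal_submodule (rauzy_algebra s) M N} = {Rd}" by blast
  then show ?thesis unfolding rad_def by (auto simp: Rd_def)
qed

text \<open>Dually, \<open>Sc_le\<close> makes \<open>Sc\<close> the only simple submodule.\<close>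

lemma soc_eq: "soc (rauzy_algebra s) M = Sc"
proof -
  have "elt (0, 0, 0, 1) \<in> Sc" unfolding Sc_def by simp
  moreover have "elt (0, 0, 0, 1) \<noteq> \<zero>\<^bsub>M\<^esub>"
  proof
    assume "elt (0, 0, 0, 1) = \<zero>\<^bsub>M\<^esub>"
    then have "coord (elt (0, 0, 0, 1)) = 0" by (simp only: coord_zero)
    then show False by (simp add: zero_prod_def)
  qed
  ultimately have ne: "Sc \<noteq> {\<zero>\<^bsub>M\<^esub>}" by blast
  have "simple_submodule (rauzy_algebra s) M Sc"
    unfolding simple_submodule_def using Sc_submodule ne Sc_le by blast
  moreover have "N = Sc" if N: "simple_submodule (rauzy_algebra s) M N" for N
  proof -
    have "Sc \<subseteq> N" using N Sc_le unfolding simple_submodule_def by blast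
    then show ?thesis using N Sc_submodule ne unfolding simple_submodule_def by metis
  qed
  ultimately have "{N. simple_submodule (rauzy_algebra s) M N} = {Sc}" by blast
  moreover have "generate (add_monoid M) Sc = Sc"
    using generate_subgroup[OF abelian_group_axioms] Sc_submodule unfolding submodule_def by blast
  ultimately show ?thesis unfolding soc_def by simp
qed

text \<open>The three isomorphisms are induced by coordinates: the first one for the top, the last
  one for the socle, the two middle ones for the layer between.\<close>

theorem rhombus_module: "rhombus_module (rauzy_algebra s) z x y x' M"
  unfolding rhombus_module_def rad_eq soc_eq
proof (intro conjI)
  show "right_module (rauzy_algebra s) M" by (rule M)
  show sub: "Sc \<subseteq> Rd" unfolding Sc_def Rd_def by auto
  have smult: "\<exists>g\<in>combs. a = cl (rauzy_ideal s) g" if "a \<in> carrier (rauzy_algebra s)" for a :: "'k comb set"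
    using that unfolding rauzy_algebra_carrier by blast
  have "linear_onto (rauzy_algebra s) M Rd (simple_at y) (\<lambda>m. fst (coord m))"
    unfolding linear_onto_def
  proof (intro conjI ballI)
    have "c \<in> (\<lambda>m. fst (coord m)) ` carrier M" for c
      by (rule image_eqI[of _ _ "elt (c, 0, 0, 0)"]) simp_all
    then show "(\<lambda>m. fst (coord m)) ` carrier M = carrier (simple_at y)"
      by (auto simp: simple_at_def)
    fix a :: "'k comb set" and m assume a: "a \<in> carrier (rauzy_algebra s)" and m: "m \<in> carrier M"
    obtain g where g: "g \<in> combs" "a = cl (rauzy_ideal s) g" using smult[OF a] by blast
    obtain \<alpha> \<beta> \<gamma> \<delta> where c: "coord m = (\<alpha>, \<beta>, \<gamma>, \<delta>)" by (metis prod.exhaust)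
    show "fst (coord (a \<odot>\<^bsub>M\<^esub> m)) = a \<odot>\<^bsub>simple_at y\<^esub> fst (coord m)"
      using coord_mult[OF m g(1) c] c unfolding g(2) smult_simple[OF g(1)] by (simp add: act_def)
  qed (auto simp: simple_at_def coord_add Rd_def)
  then show "module_iso (rauzy_algebra s) (quotient_module M Rd) (simple_at y)"
    by (intro iffD2[OF quotient_iso_iff[OF linear Rd_submodule abelian_group_simple_at]] exI)
  define h4 :: "'k \<times> 'k \<times> 'k \<times> 'k \<Rightarrow> 'k" where "h4 t = snd (snd (snd t))" for t
  show "module_iso (rauzy_algebra s) (restrict_module M Sc) (simple_at z)"
    unfolding module_iso_def
  proof (intro exI[of _ "\<lambda>m. h4 (coord m)"] conjI ballI)
    have "inj_on (\<lambda>m. h4 (coord m)) Sc"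
      by (rule inj_onI) (auto simp: Sc_def h4_def intro: coord_inj)
    moreover have "c \<in> (\<lambda>m. h4 (coord m)) ` Sc" for c
      by (rule image_eqI[of _ _ "elt (0, 0, 0, c)"]) (simp_all add: Sc_def h4_def)
    ultimately show "bij_betw (\<lambda>m. h4 (coord m)) (carrier (restrict_module M Sc)) (carrier (simple_at z))"
      unfolding bij_betw_def by (auto simp: simple_at_def restrict_module_def)
    fix a :: "'k comb set" and m assume a: "a \<in> carrier (rauzy_algebra s)" and "m \<in> carrier (restrict_module M Sc)"
    then obtain \<delta> where m: "m \<in> carrier M" and c: "coord m = (0, 0, 0, \<delta>)"
      unfolding restrict_module_def Sc_def by auto
    obtain g where g: "g \<in> combs" "a = cl (rauzy_ideal s) g" using smult[OF a] by blast
    show "h4 (coord (a \<odot>\<^bsub>restrict_module M Sc\<^esub> m)) = a \<odot>\<^bsub>simple_at z\<^esub> h4 (coord m)"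
      using coord_mult[OF m g(1) c] c unfolding g(2) smult_simple[OF g(1)]
      by (simp add: act_def restrict_module_def h4_def)
  qed (auto simp: simple_at_def restrict_module_def coord_add Sc_def h4_def)
  define h :: "'k \<times> 'k \<times> 'k \<times> 'k \<Rightarrow> 'k \<times> 'k" where "h t = (fst (snd t), fst (snd (snd t)))" for t
  let ?R = "restrict_module M Rd" and ?T = "direct_sum (simple_at x) (simple_at x')"
  have R: "carrier ?R = Rd" "add ?R = add M" "smult ?R = smult M"
    by (simp_all add: restrict_module_def)
  have "linear_onto (rauzy_algebra s) ?R Sc ?T (\<lambda>m. h (coord m))"
    unfolding linear_onto_def R
  proof (intro conjI ballI)
    have "c \<in> (\<lambda>m. h (coord m)) ` Rd" for c
      by (rule image_eqI[of _ _ "elt (0, fst c, snd c, 0)"]) (simp_all add: Rd_def h_def)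
    then show "(\<lambda>m. h (coord m)) ` Rd = carrier ?T"
      by (auto simp: direct_sum_def simple_at_def)
  next
    fix m m' assume "m \<in> Rd" "m' \<in> Rd"
    then show "h (coord (m \<oplus>\<^bsub>M\<^esub> m')) = h (coord m) \<oplus>\<^bsub>?T\<^esub> h (coord m')"
      by (simp add: direct_sum_def simple_at_def coord_add Rd_def h_def)
  next
    fix a :: "'k comb set" and m assume a: "a \<in> carrier (rauzy_algebra s)" and mR: "m \<in> Rd"
    obtain g where g: "g \<in> combs" "a = cl (rauzy_ideal s) g" using smult[OF a] by blast
    obtain \<alpha> \<beta> \<gamma> \<delta> where c: "coord m = (\<alpha>, \<beta>, \<gamma>, \<delta>)" by (metis prod.exhaust)
    have m: "m \<in> carrier M" and a0: "\<alpha> = 0" using mR c unfolding Rd_def by auto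
    have "a \<odot>\<^bsub>?T\<^esub> (\<beta>, \<gamma>) = (\<beta> * pcoeff g [x], \<gamma> * pcoeff g [x'])"
      unfolding direct_sum_def g(2) by (simp add: smult_simple[OF g(1)])
    then show "h (coord (a \<odot>\<^bsub>M\<^esub> m)) = a \<odot>\<^bsub>?T\<^esub> h (coord m)"
      using coord_mult[OF m g(1) c] c a0 g(2) by (simp add: act_def h_def)
  next
    fix m assume "m \<in> Rd"
    then show "h (coord m) = \<zero>\<^bsub>?T\<^esub> \<longleftrightarrow> m \<in> Sc"
      by (cases "coord m") (auto simp: direct_sum_def simple_at_def Sc_def Rd_def h_def)
  qed
  then show "module_iso (rauzy_algebra s) (quotient_module ?R Sc) ?T"
    by (intro iffD2[OF quotient_iso_iff[OF linear_module_restrict[OF linear Rd_submodule]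
        submodule_restrict[OF linear Rd_submodule Sc_submodule sub]
        abelian_group_direct_sum[OF abelian_group_simple_at abelian_group_simple_at]]] exI)
qed

end

text \<open>By \<open>coord_mult\<close> the action is given by the same formula in both modules, so
  matching coordinates is an isomorphism.\<close>

lemma generator_iso:
  fixes M :: "('k::field comb set, 'm) module" and M' :: "('k comb set, 'n) module"
  assumes "rauzy_rhombus_generator s z x y x' M n" "rauzy_rhombus_generator s z x y x' M' n'"
  shows "module_iso (rauzy_algebra s) M M'"
proof -
  interpret M: rauzy_rhombus_generator s z x y x' M n by (rule assms(1))
  interpret M': rauzy_rhombus_generator s z x y x' M' n' by (rule assms(2))
  define h where "h m = M'.elt (M.coord m)" for m
  have h: "M'.coord (h m) = M.coord m" "h m \<in> carrier M'" for m
    by (simp_all add: h_def)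
  show ?thesis
    unfolding module_iso_def
  proof (intro exI[of _ h] conjI ballI)
    show "bij_betw h (carrier M) (carrier M')"
      by (rule bij_betw_byWitness[where f' = "\<lambda>m. M.elt (M'.coord m)"])
        (auto simp: h_def M.elt_coord M'.elt_coord)
    fix m assume m: "m \<in> carrier M"
    show "h (m \<oplus>\<^bsub>M\<^esub> m') = h m \<oplus>\<^bsub>M'\<^esub> h m'" if "m' \<in> carrier M" for m'
      using that m h by (intro M'.coord_inj) (simp_all add: M'.coord_add M.coord_add)
    show "h (a \<odot>\<^bsub>M\<^esub> m) = a \<odot>\<^bsub>M'\<^esub> h m" if a: "a \<in> carrier (rauzy_algebra s)" for a :: "'k comb set"
    proof -
      obtain g where g: "g \<in> combs" "a = cl (rauzy_ideal s) g"
        using a unfolding rauzy_algebra_carrier by blast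
      obtain \<alpha> \<beta> \<gamma> \<delta> where c: "M.coord m = (\<alpha>, \<beta>, \<gamma>, \<delta>)" by (metis prod.exhaust)
      then have c': "M'.coord (h m) = (\<alpha>, \<beta>, \<gamma>, \<delta>)" using h by simp
      have "h (act s M m g) = act s M' (h m) g"
        using h M'.act_closed[OF h(2) g(1)] M.coord_mult[OF m g(1) c] M'.coord_mult[OF h(2) g(1) c']
        by (intro M'.coord_inj) simp_all
      then show ?thesis by (simp add: act_def g(2))
    qed
  qed
qed

section \<open>Uniqueness of the rhombus module\<close>

locale rauzy_rhombus_module = rauzy_rhombus s z x y x' + rauzy_module s M
  for s z x y x' and M :: "('k::field comb set, 'm) module" +
  assumes rhombus_module: "rhombus_module (rauzy_algebra s) z x y x' M"
begin

abbreviation "Rad \<equiv> rad (rauzy_algebra s) M"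
abbreviation "Soc \<equiv> soc (rauzy_algebra s) M"

lemmas Rad = rad_submodule[OF linear] and Soc = soc_submodule[OF linear]
lemmas Rad' = Rad[unfolded submodule_iff[OF linear]] and Soc' = Soc[unfolded submodule_iff[OF linear]]

text \<open>This and the next two lemmas turn the given isomorphisms into scalar functions on the
  layers of \<open>M\<close>, on each of which the algebra acts through the coefficient of a trivial
  path.\<close>

lemma top_map:
  obtains h :: "'m \<Rightarrow> 'k" where "\<And>c. \<exists>m\<in>carrier M. h m = c"
    "\<And>m n. m \<in> carrier M \<Longrightarrow> n \<in> carrier M \<Longrightarrow> h (m \<oplus>\<^bsub>M\<^esub> n) = h m + h n"
    "\<And>m f. m \<in> carrier M \<Longrightarrow> f \<in> combs \<Longrightarrow> h (act s M m f) = h m * pcoeff f [y]"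
    "\<And>m. m \<in> carrier M \<Longrightarrow> h m = 0 \<longleftrightarrow> m \<in> Rad"
proof -
  have "module_iso (rauzy_algebra s) (quotient_module M Rad) (simple_at y)"
    using rhombus_module unfolding rhombus_module_def by blast
  then obtain h where h: "linear_onto (rauzy_algebra s) M Rad (simple_at y) h"
    unfolding quotient_iso_iff[OF linear Rad abelian_group_simple_at] ..
  note h = h[unfolded linear_onto_def]
  show thesis
  proof (rule that[of h])
    show "\<exists>m\<in>carrier M. h m = c" for c
    proof -
      have "c \<in> h ` carrier M" using h by (simp add: simple_at_def)
      then show ?thesis by blast
    qed
    show "h (m \<oplus>\<^bsub>M\<^esub> n) = h m + h n" if "m \<in> carrier M" "n \<in> carrier M" for m n
      using h that by (simp add: simple_at_def)
    show "h (act s M m f) = h m * pcoeff f [y]" if "m \<in> carrier M" "f \<in> combs" for m f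
      using h that cl_carrier[OF that(2)] smult_simple[OF that(2)] unfolding act_def by simp
    show "h m = 0 \<longleftrightarrow> m \<in> Rad" if "m \<in> carrier M" for m
      using h that by (simp add: simple_at_def)
  qed
qed

lemma socle_map:
  obtains h :: "'m \<Rightarrow> 'k" where "inj_on h Soc"
    "\<And>m n. m \<in> Soc \<Longrightarrow> n \<in> Soc \<Longrightarrow> h (m \<oplus>\<^bsub>M\<^esub> n) = h m + h n"
    "\<And>m f. m \<in> Soc \<Longrightarrow> f \<in> combs \<Longrightarrow> h (act s M m f) = h m * pcoeff f [z]"
proof -
  have "module_iso (rauzy_algebra s) (restrict_module M Soc) (simple_at z)"
    using rhombus_module unfolding rhombus_module_def by blast
  then obtain h where h: "bij_betw h (carrier (restrict_module M Soc)) (carrier (simple_at z :: ('k comb set, 'k) module)) \<and>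
     (\<forall>m\<in>carrier (restrict_module M Soc). \<forall>n\<in>carrier (restrict_module M Soc).
        h (m \<oplus>\<^bsub>restrict_module M Soc\<^esub> n) = h m \<oplus>\<^bsub>simple_at z\<^esub> h n) \<and>
     (\<forall>a\<in>carrier (rauzy_algebra s). \<forall>m\<in>carrier (restrict_module M Soc).
        h (a \<odot>\<^bsub>restrict_module M Soc\<^esub> m) = a \<odot>\<^bsub>simple_at z\<^esub> h m)"
    unfolding module_iso_def ..
  show thesis
  proof (rule that[of h])
    show "inj_on h Soc" using h unfolding bij_betw_def by (simp add: restrict_module_def)
    show "h (m \<oplus>\<^bsub>M\<^esub> n) = h m + h n" if "m \<in> Soc" "n \<in> Soc" for m n
      using h that by (simp add: restrict_module_def simple_at_def)
    show "h (act s M m f) = h m * pcoeff f [z]" if "m \<in> Soc" "f \<in> combs" for m f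
      using h that cl_carrier[OF that(2)] smult_simple[OF that(2)]
      unfolding act_def by (simp add: restrict_module_def)
  qed
qed

lemma middle_map:
  obtains h h' :: "'m \<Rightarrow> 'k" where
    "\<And>m n. m \<in> Rad \<Longrightarrow> n \<in> Rad \<Longrightarrow> h (m \<oplus>\<^bsub>M\<^esub> n) = h m + h n \<and> h' (m \<oplus>\<^bsub>M\<^esub> n) = h' m + h' n"
    "\<And>m f. m \<in> Rad \<Longrightarrow> f \<in> combs \<Longrightarrow> h (act s M m f) = h m * pcoeff f [x] \<and>
      h' (act s M m f) = h' m * pcoeff f [x']"
    "\<And>m. m \<in> Rad \<Longrightarrow> h m = 0 \<and> h' m = 0 \<longleftrightarrow> m \<in> Soc"
proof -
  let ?R = "restrict_module M Rad" and ?T = "direct_sum (simple_at x) (simple_at x')"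
  have sub: "Soc \<subseteq> Rad" using rhombus_module unfolding rhombus_module_def by blast
  have "module_iso (rauzy_algebra s) (quotient_module ?R Soc) ?T"
    using rhombus_module unfolding rhombus_module_def by blast
  then obtain g where g: "linear_onto (rauzy_algebra s) ?R Soc ?T g"
    unfolding quotient_iso_iff[OF linear_module_restrict[OF linear Rad]
        submodule_restrict[OF linear Rad Soc sub]
        abelian_group_direct_sum[OF abelian_group_simple_at abelian_group_simple_at]] ..
  note g = g[unfolded linear_onto_def]
  note g_add = bspec[OF bspec[OF g[THEN conjunct2, THEN conjunct1]]]
    and g_smult = bspec[OF bspec[OF g[THEN conjunct2, THEN conjunct2, THEN conjunct1]]]
    and g_zero = bspec[OF g[THEN conjunct2, THEN conjunct2, THEN conjunct2]]
  have R: "carrier ?R = Rad" "add ?R = add M" "smult ?R = smult M" by (simp_all add: restrict_module_def)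
  have T: "u \<oplus>\<^bsub>?T\<^esub> v = (fst u + fst v, snd u + snd v)" "\<zero>\<^bsub>?T\<^esub> = (0, 0)"
    for u v :: "'k \<times> 'k" by (simp_all add: direct_sum_def simple_at_def)
  show thesis
  proof (rule that[of "\<lambda>m. fst (g m)" "\<lambda>m. snd (g m)"])
    show "fst (g (m \<oplus>\<^bsub>M\<^esub> n)) = fst (g m) + fst (g n) \<and> snd (g (m \<oplus>\<^bsub>M\<^esub> n)) = snd (g m) + snd (g n)"
      if "m \<in> Rad" "n \<in> Rad" for m n
      using g_add[unfolded R, OF that] unfolding T by simp
    show "fst (g (act s M m f)) = fst (g m) * pcoeff f [x] \<and> snd (g (act s M m f)) = snd (g m) * pcoeff f [x']"
      if "m \<in> Rad" "f \<in> combs" for m f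
    proof -
      have "g (act s M m f) = cl (rauzy_ideal s) f \<odot>\<^bsub>?T\<^esub> g m"
        using g_smult[unfolded R, OF cl_carrier[OF that(2)] that(1)] unfolding act_def .
      then show ?thesis using smult_simple[OF that(2)] by (simp add: direct_sum_def)
    qed
    show "fst (g m) = 0 \<and> snd (g m) = 0 \<longleftrightarrow> m \<in> Soc" if "m \<in> Rad" for m
      using g_zero[unfolded R, OF that] unfolding T by (simp add: prod_eq_iff)
  qed
qed

text \<open>Lift 1 from the top and multiply by the trivial path at \<open>y\<close>. What a product
  with a path contributes to each layer is governed by its last vertex, and this decides which
  products vanish.\<close>

lemma ex_generator: "\<exists>n. generator s z x y x' M n"
proof (rule top_map, rule middle_map, rule socle_map)
  fix \<pi> \<rho> \<rho>' \<sigma> :: "'m \<Rightarrow> 'k"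
  assume \<pi>: "\<And>c. \<exists>m\<in>carrier M. \<pi> m = c"
    "\<And>m n. m \<in> carrier M \<Longrightarrow> n \<in> carrier M \<Longrightarrow> \<pi> (m \<oplus>\<^bsub>M\<^esub> n) = \<pi> m + \<pi> n"
    "\<And>m f. m \<in> carrier M \<Longrightarrow> f \<in> combs \<Longrightarrow> \<pi> (act s M m f) = \<pi> m * pcoeff f [y]"
    "\<And>m. m \<in> carrier M \<Longrightarrow> \<pi> m = 0 \<longleftrightarrow> m \<in> Rad"
  and \<rho>: "\<And>m n. m \<in> Rad \<Longrightarrow> n \<in> Rad \<Longrightarrow> \<rho> (m \<oplus>\<^bsub>M\<^esub> n) = \<rho> m + \<rho> n \<and> \<rho>' (m \<oplus>\<^bsub>M\<^esub> n) = \<rho>' m + \<rho>' n"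
    "\<And>m f. m \<in> Rad \<Longrightarrow> f \<in> combs \<Longrightarrow> \<rho> (act s M m f) = \<rho> m * pcoeff f [x] \<and>
      \<rho>' (act s M m f) = \<rho>' m * pcoeff f [x']"
    "\<And>m. m \<in> Rad \<Longrightarrow> \<rho> m = 0 \<and> \<rho>' m = 0 \<longleftrightarrow> m \<in> Soc"
  and \<sigma>: "inj_on \<sigma> Soc"
    "\<And>m n. m \<in> Soc \<Longrightarrow> n \<in> Soc \<Longrightarrow> \<sigma> (m \<oplus>\<^bsub>M\<^esub> n) = \<sigma> m + \<sigma> n"
    "\<And>m f. m \<in> Soc \<Longrightarrow> f \<in> combs \<Longrightarrow> \<sigma> (act s M m f) = \<sigma> m * pcoeff f [z]"
  have SR: "Soc \<subseteq> Rad" using rhombus_module unfolding rhombus_module_def by blast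
  have Sc: "m \<in> carrier M" if "m \<in> Soc" for m using that Soc' by blast
  have Rc: "m \<in> carrier M" if "m \<in> Rad" for m using that Rad' by blast
  have "\<sigma> \<zero>\<^bsub>M\<^esub> = \<sigma> (\<zero>\<^bsub>M\<^esub> \<oplus>\<^bsub>M\<^esub> \<zero>\<^bsub>M\<^esub>)" by simp
  also have "\<dots> = \<sigma> \<zero>\<^bsub>M\<^esub> + \<sigma> \<zero>\<^bsub>M\<^esub>" using Soc' by (intro \<sigma>(2)) blast+
  finally have \<sigma>0: "\<sigma> \<zero>\<^bsub>M\<^esub> = 0" by (simp only: add_cancel_right_right)
  have soc_zero: "m = \<zero>\<^bsub>M\<^esub>" if "m \<in> Soc" "\<sigma> m = 0" for m
    using inj_onD[OF \<sigma>(1), of m "\<zero>\<^bsub>M\<^esub>"] that \<sigma>0 Soc' by simp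
  have pc: "pcoeff (pth u) v = (if u = v then 1 else 0)" for u v
    by (simp add: pth_def lookup_single when_def)
  have actR: "act s M m f \<in> Rad" if "m \<in> Rad" "f \<in> combs" for m f
    using that Rad' cl_carrier unfolding act_def by blast
  have actS: "act s M m f \<in> Soc" if "m \<in> Soc" "f \<in> combs" for m f
    using that Soc' cl_carrier unfolding act_def by blast
  obtain n\<^sub>0 where n0: "n\<^sub>0 \<in> carrier M" "\<pi> n\<^sub>0 = 1" using \<pi>(1) by blast
  have Py: "(pth [y] :: 'k comb) \<in> combs" by (simp add: path_simps)
  define n where "n = act s M n\<^sub>0 (pth [y])"
  have n: "n \<in> carrier M" "\<pi> n = 1" using n0 Py by (simp_all add: n_def \<pi>(3) pc)
  have ny: "act s M n (pth [y]) = n" using n0 Py by (simp add: n_def act_mult[symmetric] pth_mult)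
  have split: "act s M n (pth (u @ [w, v])) = act s M (act s M n (pth (u @ [w]))) (pth [w, v])"
    if "u @ [w] \<in> paths" "arrow w v" for u w v
    using that n(1) arrow_vertices[of w v] by (simp add: act_mult[symmetric] pth_mult path_simps)
  have last: "act s M (act s M n (pth u)) (pth [last u]) = act s M n (pth u)" if "u \<in> paths" for u
  proof -
    have "[last u] \<in> paths" by (rule paths_last[OF that])
    then show ?thesis using that n(1) by (simp add: act_mult[symmetric] pth_mult)
  qed
  have inRad: "act s M n (pth u) \<in> Rad" if "u \<in> paths" "u \<noteq> [y]" for u
    using \<pi>(3)[OF n(1), of "pth u"] \<pi>(4)[of "act s M n (pth u)"] that n(1) by (simp add: pc)
  have \<rho>_last: "\<rho> (act s M n (pth u)) = (if last u = x then \<rho> (act s M n (pth u)) else 0)"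
    "\<rho>' (act s M n (pth u)) = (if last u = x' then \<rho>' (act s M n (pth u)) else 0)"
    if "u \<in> paths" "u \<noteq> [y]" for u
  proof -
    have "[last u] \<in> paths" by (rule paths_last[OF that(1)])
    from \<rho>(2)[OF inRad[OF that], of "pth [last u]"] this
    have "\<rho> (act s M n (pth u)) = \<rho> (act s M n (pth u)) * pcoeff (pth [last u]) [x]"
      "\<rho>' (act s M n (pth u)) = \<rho>' (act s M n (pth u)) * pcoeff (pth [last u]) [x']"
      using last[OF that(1)] by simp_all
    then show "\<rho> (act s M n (pth u)) = (if last u = x then \<rho> (act s M n (pth u)) else 0)"
      "\<rho>' (act s M n (pth u)) = (if last u = x' then \<rho>' (act s M n (pth u)) else 0)"
      by (auto simp: pc)
  qed
  have soc_last: "act s M n (pth u) = \<zero>\<^bsub>M\<^esub>" if "u \<in> paths" "last u \<noteq> z" "act s M n (pth u) \<in> Soc" for u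
  proof -
    have "[last u] \<in> paths" by (rule paths_last[OF that(1)])
    then have "\<sigma> (act s M n (pth u)) = 0"
      using \<sigma>(3)[OF that(3), of "pth [last u]"] last[OF that(1)] that(2) by (simp add: pc)
    then show ?thesis using soc_zero that(3) by blast
  qed
  \<comment> \<open>Ending at neither \<open>x\<close> nor \<open>x'\<close>, the product has no
    part in the middle layer and lies in the socle. Only products ending at \<open>z\<close> survive
    there, and \<open>z\<close> is not adjacent to \<open>y\<close>.\<close>
  have one: "act s M n (pth [y, w]) = \<zero>\<^bsub>M\<^esub>" if w: "arrow y w" "w \<noteq> x" "w \<noteq> x'" for w
  proof -
    have P: "[y, w] \<in> paths" using w arrow_vertices[of y w] by (simp add: path_simps)
    have "act s M n (pth [y, w]) \<in> Soc"
      using \<rho>_last[OF P] \<rho>(3)[OF inRad[OF P]] w by simp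
    moreover have "w \<noteq> z" using w(1) rhombus_distinct(2)[OF r] by blast
    ultimately show ?thesis using soc_last[OF P] by simp
  qed
  \<comment> \<open>An arrow maps the radical into the socle, since it has no coefficient at a
    trivial path.\<close>
  have two_soc: "act s M n (pth [y, w, v]) \<in> Soc" if w: "arrow y w" "arrow w v" for w v
  proof -
    have P: "[y] @ [w] \<in> paths" using w arrow_vertices[of y w] by (simp add: path_simps)
    have wv: "(pth [w, v] :: 'k comb) \<in> combs" "[y, w, v] \<in> paths"
      using w arrow_vertices[of w v] by (simp_all add: path_simps)
    have "\<rho> (act s M n (pth [y, w, v])) = 0 \<and> \<rho>' (act s M n (pth [y, w, v])) = 0"
      using split[OF P w(2)] \<rho>(2)[OF inRad[OF P] wv(1)] by (simp add: pc)
    then show ?thesis using \<rho>(3)[OF inRad[OF wv(2)]] by simp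
  qed
  have two: "act s M n (pth [y, w, v]) = \<zero>\<^bsub>M\<^esub>" if w: "w \<in> {x, x'}" "arrow w v" "v \<noteq> z" for w v
  proof -
    have "arrow y w" using w arrows by blast
    moreover from this have "[y, w, v] \<in> paths" using w arrow_vertices[of w v] by (simp add: path_simps)
    ultimately show ?thesis using soc_last two_soc w by simp
  qed
  have three: "act s M n (pth [y, x, z, w]) = \<zero>\<^bsub>M\<^esub>" if w: "arrow z w" for w
  proof -
    have zw: "(pth [z, w] :: 'k comb) \<in> combs" using w arrow_vertices[of z w] by (simp add: path_simps)
    have S: "act s M n (pth [y, x, z]) \<in> Soc" using two_soc arrows by blast
    have e: "act s M n (pth [y, x, z, w]) = act s M (act s M n (pth [y, x, z])) (pth [z, w])"
      using split[of "[y, x]" z w] w by (simp add: path_simps)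
    have "\<sigma> (act s M n (pth [y, x, z, w])) = 0" unfolding e using \<sigma>(3)[OF S zw] by (simp add: pc)
    then show ?thesis using soc_zero actS[OF S zw] e by simp
  qed
  have two_eq: "act s M n (pth [y, x', z]) = act s M n (pth [y, x, z])"
    using act_cong[OF two_ways[of "[]"]] by (simp add: path_simps)
  \<comment> \<open>Otherwise \<open>n [y, x]\<close> and \<open>n [y, x']\<close> are killed by all
    arrows; if nonzero, they would lie in the socle without ending at \<open>z\<close>. So they
    vanish, hence \<open>n\<close> itself is killed by all arrows and lies in the socle, although
    its image in the top is 1.\<close>
  have cycle: "act s M n (pth [y, x, z]) \<noteq> \<zero>\<^bsub>M\<^esub>"
  proof
    assume 0: "act s M n (pth [y, x, z]) = \<zero>\<^bsub>M\<^esub>"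
    have zero: "act s M n (pth [y, w]) = \<zero>\<^bsub>M\<^esub>" if w: "w \<in> {x, x'}" for w
    proof (rule ccontr)
      assume ne: "act s M n (pth [y, w]) \<noteq> \<zero>\<^bsub>M\<^esub>"
      have ar: "arrow y w" "w \<in> vertices" "w \<noteq> z" using w arrows vertices distinct by auto
      have P: "[y] @ [w] \<in> paths" using ar by (simp add: path_simps)
      have "act s M (act s M n (pth [y, w])) (pth [w, v]) = \<zero>\<^bsub>M\<^esub>" if v: "arrow w v" for v
        using split[OF P v] two[OF w v] w 0 two_eq by (cases "v = z") auto
      then have "act s M n (pth [y, w]) \<in> Soc"
        using simple_span[OF _ ne ar(2)] last[OF P] n(1) P by simp
      then show False using soc_last[OF P] ar(3) ne by simp
    qed
    then have "act s M n (pth [y, w]) = \<zero>\<^bsub>M\<^esub>" if "arrow y w" for w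
      using one[OF that] by blast
    moreover have "n \<noteq> \<zero>\<^bsub>M\<^esub>" using n(2) \<pi>(4)[of "\<zero>\<^bsub>M\<^esub>"] Rad' by auto
    ultimately have "n \<in> Soc" using simple_span[OF n(1) _ vertices(3) ny] by blast
    then show False using SR \<pi>(4)[OF n(1)] n(2) by auto
  qed
  \<comment> \<open>Subtract multiples of the basis elements layer by layer: the top determines
    \<alpha>, the middle layer \<beta> and \<gamma>, the socle \<delta>.\<close>
  have onto: "m \<in> act s M n ` combs" if m: "m \<in> carrier M" for m
  proof -
    have minus: "\<exists>m'\<in>carrier M. m = act s M n f \<oplus>\<^bsub>M\<^esub> m'" if "f \<in> combs" for f
      using that n(1) m by (intro bexI[of _ "\<ominus>\<^bsub>M\<^esub> act s M n f \<oplus>\<^bsub>M\<^esub> m"]) (simp_all add: a_assoc[symmetric] r_neg)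
    have P: "[y] \<in> paths" "[y, x] \<in> paths" "[y, x'] \<in> paths" "[y, x, z] \<in> paths" "[x] \<in> paths" "[x'] \<in> paths" "[z] \<in> paths"
      by (simp_all add: path_simps)
    have sing: "act s M n (single u c) = act s M (act s M n (pth u)) (single [last u] c)"
      if "u \<in> paths" for u c
    proof -
      have "[last u] \<in> paths" by (rule paths_last[OF that])
      then show ?thesis using that n(1) by (simp add: act_mult[symmetric] pth_def path_mult_single)
    qed
    define \<alpha> where "\<alpha> = \<pi> m"
    obtain m1 where m1: "m1 \<in> carrier M" "m = act s M n (single [y] \<alpha>) \<oplus>\<^bsub>M\<^esub> m1"
      using minus[of "single [y] \<alpha>"] P by auto
    have "\<pi> m = \<pi> (act s M n (single [y] \<alpha>)) + \<pi> m1"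
      unfolding m1(2) by (rule \<pi>(2)) (use n(1) P m1 in simp_all)
    also have "\<pi> (act s M n (single [y] \<alpha>)) = \<alpha>"
      using \<pi>(3)[OF n(1), of "single [y] \<alpha>"] P n(2) by simp
    finally have m1R: "m1 \<in> Rad" using \<pi>(4)[OF m1(1)] \<alpha>_def by simp
    have Rx: "act s M n (pth [y, x]) \<in> Rad" "act s M n (pth [y, x']) \<in> Rad" using inRad P by simp_all
    have ne: "act s M n (pth [y, w]) \<notin> Soc" if w: "w \<in> {x, x'}" for w
    proof
      assume "act s M n (pth [y, w]) \<in> Soc"
      then have "act s M n (pth [y, w]) = \<zero>\<^bsub>M\<^esub>"
        by (rule soc_last[rotated 2]) (use w P distinct in auto)
      then have "act s M n (pth [y, w, z]) = \<zero>\<^bsub>M\<^esub>"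
        using split[of "[y]" w z] w P arrows by (auto simp: path_simps)
      then show False using cycle two_eq w by auto
    qed
    define r1 r2 where "r1 = \<rho> (act s M n (pth [y, x]))" and "r2 = \<rho>' (act s M n (pth [y, x']))"
    have cross: "\<rho>' (act s M n (pth [y, x])) = 0" "\<rho> (act s M n (pth [y, x'])) = 0"
      using \<rho>_last(2)[OF P(2)] \<rho>_last(1)[OF P(3)] distinct by simp_all
    \<comment> \<open>By \<open>cycle\<close>, neither \<open>n [y, x]\<close> nor
      \<open>n [y, x']\<close> lies in the socle, and each has only one component in the middle
      layer.\<close>
    have r12: "r1 \<noteq> 0" "r2 \<noteq> 0"
      using ne[of x] ne[of x'] \<rho>(3)[OF Rx(1)] \<rho>(3)[OF Rx(2)] cross unfolding r1_def r2_def by auto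
    define \<beta> \<gamma> where "\<beta> = \<rho> m1 / r1" and "\<gamma> = \<rho>' m1 / r2"
    define f where "f = single [y, x] \<beta> + single [y, x'] \<gamma>"
    have fc: "f \<in> combs" unfolding f_def using P by simp
    define k where "k = act s M n f"
    have k: "k = act s M (act s M n (pth [y, x])) (single [x] \<beta>) \<oplus>\<^bsub>M\<^esub>
        act s M (act s M n (pth [y, x'])) (single [x'] \<gamma>)"
      unfolding k_def f_def using n(1) P sing[OF P(2)] sing[OF P(3)] by (simp add: act_add)
    have kx: "act s M (act s M n (pth [y, x])) (single [x] \<beta>) \<in> Rad"
      "act s M (act s M n (pth [y, x'])) (single [x'] \<gamma>) \<in> Rad"
      using actR[OF Rx(1)] actR[OF Rx(2)] P by simp_all
    have kR: "k \<in> Rad" unfolding k using Rad' kx by blast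
    have "\<rho> k = r1 * \<beta> \<and> \<rho>' k = r2 * \<gamma>"
      unfolding k using \<rho>(1)[OF kx] \<rho>(2)[OF Rx(1), of "single [x] \<beta>"]
        \<rho>(2)[OF Rx(2), of "single [x'] \<gamma>"] P cross distinct
      by (simp add: r1_def r2_def lookup_single when_def)
    then have \<rho>k: "\<rho> k = \<rho> m1" "\<rho>' k = \<rho>' m1" using r12 by (simp_all add: \<beta>_def \<gamma>_def)
    define m2 where "m2 = \<ominus>\<^bsub>M\<^esub> k \<oplus>\<^bsub>M\<^esub> m1"
    have m2R: "m2 \<in> Rad" unfolding m2_def using Rad' kR m1R by blast
    have m1k: "m1 = k \<oplus>\<^bsub>M\<^esub> m2"
      unfolding m2_def using Rc[OF kR] m1(1) by (simp add: a_assoc[symmetric] r_neg)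
    have "\<rho> m1 = \<rho> k + \<rho> m2 \<and> \<rho>' m1 = \<rho>' k + \<rho>' m2"
      unfolding m1k by (rule \<rho>(1)[OF kR m2R])
    then have m2S: "m2 \<in> Soc" using \<rho>(3)[OF m2R] \<rho>k by simp
    have S: "act s M n (pth [y, x, z]) \<in> Soc" using two_soc arrows by blast
    define r3 where "r3 = \<sigma> (act s M n (pth [y, x, z]))"
    have r3: "r3 \<noteq> 0" using soc_zero[OF S] cycle unfolding r3_def by blast
    define \<delta> where "\<delta> = \<sigma> m2 / r3"
    have "act s M n (single [y, x, z] \<delta>) = act s M (act s M n (pth [y, x, z])) (single [z] \<delta>)"
      using sing[OF P(4)] by simp
    moreover have "\<sigma> (act s M (act s M n (pth [y, x, z])) (single [z] \<delta>)) = \<sigma> m2"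
      using \<sigma>(3)[OF S, of "single [z] \<delta>"] P r3 by (simp add: r3_def[symmetric] \<delta>_def)
    then have "act s M (act s M n (pth [y, x, z])) (single [z] \<delta>) = m2"
      using inj_onD[OF \<sigma>(1)] actS[OF S] m2S P by simp
    ultimately have "m = act s M n (single [y] \<alpha> + (f + single [y, x, z] \<delta>))"
      unfolding m1(2) m1k k_def using n(1) P fc by (simp add: act_add)
    then show ?thesis using P fc by auto
  qed
  then have "carrier M = act s M n ` combs" using n(1) by auto
  then have "generator s z x y x' M n"
    unfolding generator_def using n(1) ny one two three cycle by blast
  then show "\<exists>n. generator s z x y x' M n" by blast
qed

end

section \<open>The right ideal generated by two sides of the rhombus\<close>

context rauzy_rhombus
begin

definition rhombus_ideal :: "('k::field comb set, 'k comb set) module" where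
  "rhombus_ideal = right_ideal_module (rauzy_algebra s) (cl (rauzy_ideal s) (pth [z, x, y]))"

lemma side_path: "[z, x, y] \<in> paths"
  by (simp add: path_simps)

lemma rauzy_mult:
  "f \<in> combs \<Longrightarrow> g \<in> combs \<Longrightarrow>
    cl (rauzy_ideal s) f \<otimes>\<^bsub>rauzy_algebra s\<^esub> cl (rauzy_ideal s) g = cl (rauzy_ideal s) (path_mult f g)"
  unfolding rauzy_algebra_def by (rule quot_mult[OF two_sided_rauzy_ideal])

lemma rhombus_ideal_simps:
  fixes f g h :: "'k::field comb"
  shows "carrier rhombus_ideal = (\<lambda>f :: 'k comb. cl (rauzy_ideal s) (path_mult (pth [z, x, y]) f)) ` combs"
    "\<zero>\<^bsub>rhombus_ideal\<^esub> = cl (rauzy_ideal s) (0 :: 'k comb)"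
    "cl (rauzy_ideal s) f \<oplus>\<^bsub>rhombus_ideal\<^esub> cl (rauzy_ideal s) g = cl (rauzy_ideal s) (f + g)"
    "g \<in> combs \<Longrightarrow> h \<in> combs \<Longrightarrow>
      cl (rauzy_ideal s) h \<odot>\<^bsub>rhombus_ideal\<^esub> cl (rauzy_ideal s) g = cl (rauzy_ideal s) (path_mult g h)"
proof -
  let ?G = "cl (rauzy_ideal s) (pth [z, x, y] :: 'k comb)"
  have "carrier rhombus_ideal = (\<lambda>f :: 'k comb. ?G \<otimes>\<^bsub>rauzy_algebra s\<^esub> cl (rauzy_ideal s) f) ` combs"
    unfolding rhombus_ideal_def right_ideal_module_def rauzy_algebra_carrier by auto
  also have "\<dots> = (\<lambda>f. cl (rauzy_ideal s) (path_mult (pth [z, x, y]) f)) ` combs"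
    using side_path by (intro image_cong) (simp_all add: rauzy_mult)
  finally show "carrier rhombus_ideal = (\<lambda>f :: 'k comb. cl (rauzy_ideal s) (path_mult (pth [z, x, y]) f)) ` combs" .
  show "\<zero>\<^bsub>rhombus_ideal\<^esub> = cl (rauzy_ideal s) (0 :: 'k comb)"
    unfolding rhombus_ideal_def right_ideal_module_def rauzy_algebra_def
    using quot_simps(2)[OF two_sided_rauzy_ideal] by simp
  show "cl (rauzy_ideal s) f \<oplus>\<^bsub>rhombus_ideal\<^esub> cl (rauzy_ideal s) g = cl (rauzy_ideal s) (f + g)"
    unfolding rhombus_ideal_def right_ideal_module_def rauzy_algebra_def
    using quot_add[OF two_sided_rauzy_ideal] by simp
  show "cl (rauzy_ideal s) h \<odot>\<^bsub>rhombus_ideal\<^esub> cl (rauzy_ideal s) g = cl (rauzy_ideal s) (path_mult g h)"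
    if "g \<in> combs" "h \<in> combs"
    using that unfolding rhombus_ideal_def right_ideal_module_def by (simp add: rauzy_mult)
qed

lemma right_module_rhombus_ideal: "right_module (rauzy_algebra s) (rhombus_ideal :: ('k::field comb set, 'k comb set) module)"
proof -
  let ?R = "rhombus_ideal :: ('k comb set, 'k comb set) module"
  let ?G = "pth [z, x, y] :: 'k comb"
  define e where "e f = cl (rauzy_ideal s) (path_mult ?G f)" for f
  have G: "?G \<in> combs" using side_path by simp
  have Gf: "path_mult ?G f \<in> combs" if "f \<in> combs" for f using G that by simp
  have car: "carrier ?R = e ` combs" by (simp add: rhombus_ideal_simps e_def)
  have add: "e f \<oplus>\<^bsub>?R\<^esub> e g = e (f + g)" for f g
    by (simp add: e_def rhombus_ideal_simps path_mult_add_right)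
  have zero: "\<zero>\<^bsub>?R\<^esub> = e 0" by (simp add: e_def rhombus_ideal_simps)
  have act: "cl (rauzy_ideal s) h \<odot>\<^bsub>?R\<^esub> e f = e (path_mult f h)" if "f \<in> combs" "h \<in> combs" for f h
    using that G by (simp add: e_def rhombus_ideal_simps path_mult_assoc)
  have grp: "abelian_group ?R"
  proof (rule abelian_groupI)
    fix m assume "m \<in> carrier ?R"
    then obtain f where f: "f \<in> combs" "m = e f" unfolding car by blast
    then show "\<exists>m'\<in>carrier ?R. m' \<oplus>\<^bsub>?R\<^esub> m = \<zero>\<^bsub>?R\<^esub>"
      by (intro bexI[of _ "e (- f)"]) (auto simp: add zero car)
  qed (auto simp: car add zero add_ac)
  have gen: "e f \<in> generate (add_monoid ?R) {a \<odot>\<^bsub>?R\<^esub> m | a m. a \<in> carrier (rauzy_algebra s) \<and> m \<in> carrier ?R}"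
    (is "_ \<in> generate _ ?S") if "f \<in> combs" for f
    using that
  proof (induction f rule: combs_induct)
    case zero
    then show ?case using generate.one[of "add_monoid ?R" ?S] zero by (simp add: \<open>\<zero>\<^bsub>?R\<^esub> = e 0\<close>)
  next
    case (add f g)
    then show ?case using generate.eng[of "e f" "add_monoid ?R" ?S "e g"] by (simp add: \<open>\<And>f g. e f \<oplus>\<^bsub>?R\<^esub> e g = e (f + g)\<close>)
  next
    case (single u a)
    have l: "[last u] \<in> paths" by (rule paths_last[OF single])
    \<comment> \<open>A path is fixed by the trivial path at its end, which gives
      \<open>M A = M\<close> without a unit.\<close>
    have "e (single u a) = cl (rauzy_ideal s) (pth [last u]) \<odot>\<^bsub>?R\<^esub> e (single u a)"
      using single l by (simp add: act pth_def path_mult_single)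
    moreover have "cl (rauzy_ideal s) (pth [last u] :: 'k comb) \<in> carrier (rauzy_algebra s)"
      using l by (simp add: rauzy_algebra_carrier)
    moreover have "e (single u a) \<in> carrier ?R" using single by (simp add: car)
    ultimately show ?case by (intro generate.incl CollectI exI conjI)
  qed
  have closed: "a \<odot>\<^bsub>?R\<^esub> m \<in> carrier ?R" if a: "a \<in> carrier (rauzy_algebra s)" and m: "m \<in> carrier ?R" for a m
    using a m act unfolding car rauzy_algebra_carrier by auto
  interpret R: abelian_group ?R by (rule grp)
  show ?thesis
    unfolding right_module_def
  proof (intro conjI ballI)
    show "abelian_group ?R" by (rule grp)
    fix a :: "'k comb set" and m assume a: "a \<in> carrier (rauzy_algebra s)" and m: "m \<in> carrier ?R"
    show "a \<odot>\<^bsub>?R\<^esub> m \<in> carrier ?R" by (rule closed[OF a m])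
    obtain h where h: "h \<in> combs" "a = cl (rauzy_ideal s) h" using a unfolding rauzy_algebra_carrier by blast
    obtain f where f: "f \<in> combs" "m = e f" using m unfolding car by blast
    show "a \<odot>\<^bsub>?R\<^esub> (m \<oplus>\<^bsub>?R\<^esub> n) = a \<odot>\<^bsub>?R\<^esub> m \<oplus>\<^bsub>?R\<^esub> a \<odot>\<^bsub>?R\<^esub> n" if n: "n \<in> carrier ?R" for n
    proof -
      obtain g where g: "g \<in> combs" "n = e g" using n unfolding car by blast
      show ?thesis using f g h by (simp add: add act path_mult_add_left)
    qed
  next
    fix a b :: "'k comb set" and m
    assume a: "a \<in> carrier (rauzy_algebra s)" "b \<in> carrier (rauzy_algebra s)" and m: "m \<in> carrier ?R"
    obtain h where h: "h \<in> combs" "a = cl (rauzy_ideal s) h" using a unfolding rauzy_algebra_carrier by blast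
    obtain g where g: "g \<in> combs" "b = cl (rauzy_ideal s) g" using a unfolding rauzy_algebra_carrier by blast
    obtain f where f: "f \<in> combs" "m = e f" using m unfolding car by blast
    have "a \<oplus>\<^bsub>rauzy_algebra s\<^esub> b = cl (rauzy_ideal s) (h + g)"
      unfolding h g rauzy_algebra_def by (rule quot_add[OF two_sided_rauzy_ideal])
    then show "(a \<oplus>\<^bsub>rauzy_algebra s\<^esub> b) \<odot>\<^bsub>?R\<^esub> m = a \<odot>\<^bsub>?R\<^esub> m \<oplus>\<^bsub>?R\<^esub> b \<odot>\<^bsub>?R\<^esub> m"
      using f g h by (simp add: add act path_mult_add_right)
    have "a \<otimes>\<^bsub>rauzy_algebra s\<^esub> b = cl (rauzy_ideal s) (path_mult h g)"
      unfolding h g by (rule rauzy_mult[OF h(1) g(1)])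
    then show "(a \<otimes>\<^bsub>rauzy_algebra s\<^esub> b) \<odot>\<^bsub>?R\<^esub> m = b \<odot>\<^bsub>?R\<^esub> (a \<odot>\<^bsub>?R\<^esub> m)"
      using f g h by (simp add: act path_mult_assoc)
  next
    let ?S = "{a \<odot>\<^bsub>?R\<^esub> m | a m. a \<in> carrier (rauzy_algebra s) \<and> m \<in> carrier ?R}"
    have "?S \<subseteq> carrier ?R" using closed by blast
    then have "generate (add_monoid ?R) ?S \<subseteq> carrier ?R"
      using R.add.generate_incl[of ?S] by simp
    then show "generate (add_monoid ?R) ?S = carrier ?R" using gen unfolding car by blast
  qed
qed

text \<open>Multiplying the generator by a path from \<open>y\<close> prolongs
  \<open>[z, x, y]\<close>, so each vanishing or nonvanishing condition becomes a statement on
  membership of a path in the ideal, which \<open>rhombus_paths\<close> provides.\<close>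

lemma generator_rhombus_ideal:
  "rauzy_rhombus_generator s z x y x' (rhombus_ideal :: ('k::field comb set, 'k comb set) module)
    (cl (rauzy_ideal s) (pth [z, x, y]))"
proof -
  let ?R = "rhombus_ideal :: ('k comb set, 'k comb set) module"
  let ?G = "pth [z, x, y] :: 'k comb"
  have G: "?G \<in> combs" using side_path by simp
  have act: "act s ?R (cl (rauzy_ideal s) ?G) f = cl (rauzy_ideal s) (path_mult ?G f)" if "f \<in> combs" for f
    using that G by (simp add: act_def rhombus_ideal_simps)
  have zero: "act s ?R (cl (rauzy_ideal s) ?G) (pth (y # u)) = \<zero>\<^bsub>?R\<^esub> \<longleftrightarrow> (pth (z # x # y # u) :: 'k comb) \<in> rauzy_ideal s"
    if "y # u \<in> paths" for u
    using cl_cong[OF two_sided_rauzy_ideal[of s], of "pth (z # x # y # u) :: 'k comb" 0] that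
    by (simp add: act pth_mult rhombus_ideal_simps)
  note rp = rhombus_paths[OF sign refl r, where 'k='k]
  have "generator s z x y x' ?R (cl (rauzy_ideal s) ?G)"
    unfolding generator_def
  proof (intro conjI allI ballI impI)
    show "cl (rauzy_ideal s) ?G \<in> carrier ?R"
      unfolding rhombus_ideal_simps by (rule image_eqI[of _ _ "pth [y]"]) (simp_all add: pth_mult path_simps)
    show "act s ?R (cl (rauzy_ideal s) ?G) (pth [y]) = cl (rauzy_ideal s) ?G"
      by (simp add: act path_simps pth_mult)
    show "act s ?R (cl (rauzy_ideal s) ?G) (pth [y, w]) = \<zero>\<^bsub>?R\<^esub>"
      if w: "arrow y w \<and> w \<noteq> x \<and> w \<noteq> x'" for w
      using zero[of "[w]"] rp(2)[of w] w arrow_vertices[of y w] by (simp add: path_simps)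
    show "act s ?R (cl (rauzy_ideal s) ?G) (pth [y, w, v]) = \<zero>\<^bsub>?R\<^esub>"
      if w: "w \<in> {x, x'}" "arrow w v \<and> v \<noteq> z" for w v
    proof -
      have "y # [w, v] \<in> paths" using w arrow_vertices[of w v] arrows by (auto simp: path_simps)
      then show ?thesis using zero[of "[w, v]"] rp(3)[of v] rp(4)[of v] w by auto
    qed
    show "act s ?R (cl (rauzy_ideal s) ?G) (pth [y, x, z, w]) = \<zero>\<^bsub>?R\<^esub>" if w: "arrow z w" for w
      using zero[of "[x, z, w]"] rp(6)[of w] w arrow_vertices[of z w] by (simp add: path_simps)
    show "act s ?R (cl (rauzy_ideal s) ?G) (pth [y, x, z]) \<noteq> \<zero>\<^bsub>?R\<^esub>"
      using zero[of "[x, z]"] rp(7) by (simp add: path_simps)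
    show "carrier ?R = act s ?R (cl (rauzy_ideal s) ?G) ` combs"
      unfolding rhombus_ideal_simps by (rule image_cong) (simp_all add: act)
  qed
  then show ?thesis
    by unfold_locales (use right_module_rhombus_ideal in auto)
qed

end

theorem lemma1:
  fixes s :: "3 \<Rightarrow> point \<Rightarrow> int" and z x\<^sub>1 y x\<^sub>2 :: point
    and A :: "'k::field comb set ring"
    and b\<^sub>1 b\<^sub>2 c d :: "'k comb set"
    and R :: "('k comb set, 'k comb set) module"
  assumes "sign_choice s"
    and "rhombus z x\<^sub>1 y x\<^sub>2"
    and "A = rauzy_algebra s"
    and "b\<^sub>1 = arrow_class s z x\<^sub>1" and "b\<^sub>2 = arrow_class s z x\<^sub>2"
    and "d = arrow_class s x\<^sub>1 y" and "c = arrow_class s x\<^sub>2 y"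
    and "R = right_ideal_module A (b\<^sub>1 \<otimes>\<^bsub>A\<^esub> d)"
  shows "rhombus_module A z x\<^sub>1 y x\<^sub>2 R \<and>
         R = right_ideal_module A (b\<^sub>2 \<otimes>\<^bsub>A\<^esub> c) \<and>
         (\<forall>N :: ('k comb set, 'm) module. rhombus_module A z x\<^sub>1 y x\<^sub>2 N \<longrightarrow> module_iso A N R)"
proof -
  interpret rauzy_rhombus s z x\<^sub>1 y x\<^sub>2 by unfold_locales (rule assms(1,2))+
  have mult: "arrow_class s z w \<otimes>\<^bsub>A\<^esub> arrow_class s w y = cl (rauzy_ideal s) (pth [z, w, y] :: 'k comb)"
    if "arrow z w" "arrow w y" for w
    using that arrow_vertices[of w y] rauzy_mult[of "pth [z, w] :: 'k comb" "pth [w, y]"]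
    unfolding arrow_class_def cl_def[symmetric] assms(3) by (simp add: path_simps pth_mult)
  have R: "R = rhombus_ideal"
    unfolding assms(8) assms(4,6) mult[OF arrows(1,3)] by (simp only: rhombus_ideal_def assms(3))
  have "b\<^sub>1 \<otimes>\<^bsub>A\<^esub> d = b\<^sub>2 \<otimes>\<^bsub>A\<^esub> c"
    unfolding assms(4-7) mult[OF arrows(1,3)] mult[OF arrows(5,7)] cl_cong[OF two_sided_rauzy_ideal]
    by (rule rhombus_paths(1)[OF sign refl r])
  then have "R = right_ideal_module A (b\<^sub>2 \<otimes>\<^bsub>A\<^esub> c)" using assms(8) by simp
  moreover have "rhombus_module A z x\<^sub>1 y x\<^sub>2 R"
    unfolding R assms(3) by (rule rauzy_rhombus_generator.rhombus_module[OF generator_rhombus_ideal])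
  moreover have "module_iso A N R" if N: "rhombus_module A z x\<^sub>1 y x\<^sub>2 N" for N :: "('k comb set, 'm) module"
  proof -
    have "right_module A N" using N unfolding rhombus_module_def by blast
    then interpret N: rauzy_rhombus_module s z x\<^sub>1 y x\<^sub>2 N
      by unfold_locales (use N assms(3) in auto)
    obtain n where "generator s z x\<^sub>1 y x\<^sub>2 N n" using N.ex_generator by blast
    then have "rauzy_rhombus_generator s z x\<^sub>1 y x\<^sub>2 N n" by unfold_locales
    from generator_iso[OF this generator_rhombus_ideal] show ?thesis unfolding R assms(3) .
  qed
  ultimately show ?thesis by blast
qed

end
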